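(* Fix any $\varepsilon>0$. If $p=p(n)\ge \frac{1+\varepsilon}{\log 2}\cdot\frac{\log n}{n}$, then with high probability $a_t(\mathcal{G}(n,p))=1$.
   Context: $\mathcal{G}(n,p)$ is the binomial random graph on vertex set $\{1,\dots,n\}$ in which each of the $\binom n2$ possible edges is present independently with probability $p$. "With high probability" means with probability tending to $1$ as $n\to\infty$. $\log$ denotes the natural logarithm. Total acquisition number: in a graph $G$, every vertex initially has weight $1$. A total acquisition move transfers all the weight from a vertex $v$ onto an adjacent vertex $u$, allowed only if immediately before the move the weight on $u$ is at least the weight on $v$. A maximal sequence of such moves (until no legal move remains) is an acquisition protocol, and the set of vertices with positive weight at its end is a residual set. $a_t(G)$ is the minimum possible size of a residual set over all acquisition protocols. *)

theory Defs
  imports "HOL-Probability.Probability" "HOL-Probability.Product_PMF"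
begin

section \<open>Binomial random graphs\<close>

definition all_edges :: "'a set \<Rightarrow> 'a set set" where
  "all_edges V = {e. e \<subseteq> V \<and> card e = 2}"

text \<open>
  A graph on vertex set \<open>V\<close> is given by its edge set \<open>E \<subseteq> all_edges V\<close>. Since \<open>V = {1..n}\<close>
  is fixed in the binomial random graph, the distribution is one on edge sets.
  Note that \<^const>\<open>bernoulli_pmf\<close> clamps its parameter to the unit interval.
\<close>

definition binomial_random_graph :: "nat \<Rightarrow> real \<Rightarrow> nat set set pmf" where
  "binomial_random_graph n p =
     map_pmf (\<lambda>present. {e \<in> all_edges {1..n}. present e})
       (Pi_pmf (all_edges {1..n}) False (\<lambda>_. bernoulli_pmf p))"

section \<open>Total acquisition\<close>

definition initial_weight :: "'a set \<Rightarrow> 'a \<Rightarrow> nat" where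
  "initial_weight V = (\<lambda>v. if v \<in> V then 1 else 0)"

text \<open>
  The weight moved must be positive: otherwise moves of weight zero would always remain
  available along an edge, and no sequence of moves could be maximal.
\<close>

inductive acquisition_move :: "'a set set \<Rightarrow> ('a \<Rightarrow> nat) \<Rightarrow> ('a \<Rightarrow> nat) \<Rightarrow> bool"
  for E :: "'a set set" where
  "\<lbrakk>{u, v} \<in> E; u \<noteq> v; 0 < w v; w v \<le> w u\<rbrakk>
     \<Longrightarrow> acquisition_move E w (w(u := w u + w v, v := 0))"

definition residual_set :: "'a set \<Rightarrow> 'a set set \<Rightarrow> 'a set \<Rightarrow> bool" where
  "residual_set V E R \<longleftrightarrow>
     (\<exists>w. (acquisition_move E)\<^sup>*\<^sup>* (initial_weight V) w \<and>
          \<not> (\<exists>w'. acquisition_move E w w') \<and>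
          R = {v \<in> V. 0 < w v})"

definition total_acquisition_number :: "'a set \<Rightarrow> 'a set set \<Rightarrow> nat" where
  "total_acquisition_number V E = (LEAST k. \<exists>R. residual_set V E R \<and> card R = k)"

end

theory Submission
  imports Defs "HOL-Real_Asymp.Real_Asymp"
begin

text \<open>
  It suffices to treat \<open>p = c ln n / n\<close> with \<open>c = (1 + \<epsilon>) / ln 2\<close>: gathering everything at one vertex
  is possible in any graph containing one where it is possible. A typical vertex then has slightly more
  than \<open>log\<^sub>2 n\<close> neighbours, which is what a vertex needs to double its weight up to order \<open>n\<close>.

  The skeleton is a tree in which every inner vertex first doubles its weight by absorbing binomial trees
  and then absorbs several equal subtrees, each at most as heavy as what it already has. Its bottoms may
  carry any additional load of weight \<open>O(ln n)\<close> without disturbing the order of the moves; all degrees are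
  below \<open>(1 + \<xi>) log\<^sub>2 n\<close> for any fixed \<open>\<xi> > 0\<close>, there are of order \<open>n / ln n\<close> bottoms, and the tree uses
  only a small fraction of the vertices. By the argument of Friedman and Pippenger (in Haxell's form) it embeds into the random graph on all but a
  reserved block of vertices, since small sets expand by a factor exceeding the maximal degree.

  The edges at the reserved block are independent of this embedding. A positive fraction \<open>Y\<close> of the block
  is adjacent to bottoms. By Hall's theorem nearly every other vertex can be sent to \<open>Y\<close> with bounded
  multiplicity, and the exceptional vertices are matched to ordinary ones, which then have weight two;
  every \<open>y\<close> in \<open>Y\<close> also receives a private leaf, so that it may accept weight two. Finally \<open>Y\<close> is moved
  into the bottoms and the skeleton is emptied into its root.
\<close>

section \<open>Gathering weight along trees\<close>

text \<open>A move at most doubles a weight, so a vertex gathering order \<open>n\<close> must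
  receive about \<open>ln n / ln 2\<close> moves, while degrees exceed \<open>ln n / ln 2\<close> by
  a constant factor only. Nearly the whole degree thus goes into doubling, and the branching number
  is a small multiple of \<open>ln n\<close>. A level with branching \<open>k\<close> has a relative
  overhead of about \<open>2 / k\<close>; over the roughly \<open>ln n / ln (ln n)\<close> levels
  this sums to \<open>o(1)\<close>, which is why the tree takes an arbitrarily small fraction of the
  vertices. Loads of order \<open>ln n\<close> are unavoidable, since order \<open>n / ln n\<close>
  bottoms must take in a linear number of vertices. Expansion by more than
  \<open>ln n / ln 2\<close> is available only for sets of order \<open>n / ln n\<close>; a tree of
  linear size still fits because the expansion factor exceeds the tree degree by a surplus of order
  \<open>ln n\<close>. Independence is kept by staged exposure: edges off the block fix tree and
  bottoms, edges between bottoms and block fix \<open>Y\<close>, and all others are fresh when the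
  degrees into \<open>Y\<close> are examined.\<close>

text \<open>\<open>gather E v A\<close>: starting from weight one everywhere, moves inside \<open>A\<close> can bring all its weight to \<open>v\<close>.\<close>

inductive gather :: "'a set set \<Rightarrow> 'a \<Rightarrow> 'a set \<Rightarrow> bool" for E :: "'a set set" where
  single: "gather E v {v}"
| join: "gather E v A \<Longrightarrow> gather E u B \<Longrightarrow> A \<inter> B = {} \<Longrightarrow> {u, v} \<in> E \<Longrightarrow> card B \<le> card A
    \<Longrightarrow> gather E v (A \<union> B)"

lemma gather_finite: "gather E v A \<Longrightarrow> finite A"
  by (induction rule: gather.induct) auto

lemma gather_root: "gather E v A \<Longrightarrow> v \<in> A"
  by (induction rule: gather.induct) auto

lemma gather_mono:
  assumes "gather E v A" "E \<subseteq> E'"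
  shows "gather E' v A"
  using assms(1)
proof (induction rule: gather.induct)
  case (join v A u B)
  then show ?case using assms(2) by (blast intro: gather.join)
qed (rule gather.single)

lemma gather_card_pos: "gather E v A \<Longrightarrow> 0 < card A"
  using gather_finite[of E v A] gather_root[of E v A] by (auto simp: card_gt_0_iff)

text \<open>Weights outside \<open>A\<close> are arbitrary, so that the moves for \<open>B\<close>
  can start from the weighting that the moves for \<open>A\<close> leave behind.\<close>

lemma gather_moves:
  assumes "gather E v A" "\<And>x. x \<in> A \<Longrightarrow> w x = 1"
  shows "(acquisition_move E)\<^sup>*\<^sup>* w (\<lambda>x. if x = v then card A else if x \<in> A then 0 else w x)"
  using assms
proof (induction arbitrary: w rule: gather.induct)
  case (single v)
  then have "(\<lambda>x. if x = v then card {v} else if x \<in> {v} then 0 else w x) = w"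
    by auto
  then show ?case by simp
next
  case (join v A u B)
  let ?w1 = "\<lambda>x. if x = v then card A else if x \<in> A then 0 else w x"
  let ?w2 = "\<lambda>x. if x = u then card B else if x \<in> B then 0 else ?w1 x"
  let ?w3 = "\<lambda>x. if x = v then card (A \<union> B) else if x \<in> A \<union> B then 0 else w x"
  have vA: "v \<in> A" "v \<notin> B" and uB: "u \<in> B" "u \<notin> A"
    using gather_root[OF join.hyps(1)] gather_root[OF join.hyps(2)] join.hyps(3) by auto
  have fin: "finite A" "finite B" using gather_finite[OF join.hyps(1)] gather_finite[OF join.hyps(2)] by auto
  have "(acquisition_move E)\<^sup>*\<^sup>* w ?w1"
    using join.IH(1) join.prems by simp
  moreover have "(acquisition_move E)\<^sup>*\<^sup>* ?w1 ?w2"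
    by (rule join.IH(2)) (use join.prems join.hyps(3) vA in auto)
  moreover have "acquisition_move E ?w2 (?w2(v := ?w2 v + ?w2 u, u := 0))"
  proof (rule acquisition_move.intros)
    show "{v, u} \<in> E" using join.hyps by (simp add: insert_commute)
    show "v \<noteq> u" using vA uB by auto
    show "0 < ?w2 u" using gather_card_pos[OF join.hyps(2)] by simp
    show "?w2 u \<le> ?w2 v" using vA uB join.hyps(5) by auto
  qed
  moreover have "?w2(v := ?w2 v + ?w2 u, u := 0) = ?w3"
    using vA uB join.hyps(3) fin by (auto simp: fun_eq_iff card_Un_disjoint)
  ultimately show ?case by (metis (no_types, lifting) rtranclp.rtrancl_into_rtrancl rtranclp_trans)
qed

text \<open>The receiver of a move ends with positive weight. This gives the lower bound 1 on the
  size of residual sets.\<close>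

lemma moves_keep_weight:
  assumes "(acquisition_move E)\<^sup>*\<^sup>* w w'" "E \<subseteq> all_edges V" "\<exists>v\<in>V. 0 < w v"
  shows "\<exists>v\<in>V. 0 < w' v"
  using assms(1,3)
proof (induction rule: rtranclp_induct)
  case (step y z)
  from step.hyps(2) show ?case
  proof cases
    case (1 u v)
    then have "u \<in> V" using assms(2) by (auto simp: all_edges_def)
    moreover have "0 < z u" using 1 by auto
    ultimately show ?thesis by blast
  qed
qed auto

lemma gather_total_acquisition_number:
  assumes g: "gather E r V" and E: "E \<subseteq> all_edges V"
  shows "total_acquisition_number V E = 1"
proof -
  have fin: "finite V" and r: "r \<in> V" using gather_finite[OF g] gather_root[OF g] by auto
  let ?w = "\<lambda>x. if x = r then card V else 0"
  have eq: "(\<lambda>x. if x = r then card V else if x \<in> V then 0 else initial_weight V x) = ?w"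
    by (auto simp: initial_weight_def fun_eq_iff)
  have "(acquisition_move E)\<^sup>*\<^sup>* (initial_weight V)
      (\<lambda>x. if x = r then card V else if x \<in> V then 0 else initial_weight V x)"
    by (rule gather_moves[OF g]) (simp add: initial_weight_def)
  then have reach: "(acquisition_move E)\<^sup>*\<^sup>* (initial_weight V) ?w"
    unfolding eq .
  \<comment> \<open>A move needs two distinct vertices of positive weight.\<close>
  have stuck: "\<not> (\<exists>w'. acquisition_move E ?w w')"
    by (auto elim!: acquisition_move.cases split: if_splits)
  have "{v \<in> V. 0 < ?w v} = {r}" using r fin by (auto simp: card_gt_0_iff)
  then have res: "residual_set V E {r}"
    unfolding residual_set_def using reach stuck by (intro exI[of _ ?w]) simp
  have pos: "card R > 0" if R: "residual_set V E R" for R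
  proof -
    obtain w where w: "(acquisition_move E)\<^sup>*\<^sup>* (initial_weight V) w" "R = {v \<in> V. 0 < w v}"
      using R unfolding residual_set_def by blast
    have "\<exists>v\<in>V. 0 < w v"
      by (rule moves_keep_weight[OF w(1) E]) (use r in \<open>auto simp: initial_weight_def\<close>)
    then show ?thesis using w(2) fin by (auto simp: card_gt_0_iff)
  qed
  show ?thesis
    unfolding total_acquisition_number_def
  proof (rule Least_equality)
    show "\<exists>R. residual_set V E R \<and> card R = 1" using res by (intro exI[of _ "{r}"]) simp
    show "1 \<le> k" if "\<exists>R. residual_set V E R \<and> card R = k" for k
      using that pos by (auto simp: Suc_le_eq)
  qed
qed

text \<open>Each \<open>B i\<close> is compared with \<open>A\<close> alone, so the branches may be
  absorbed in any order.\<close>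

lemma gather_Union:
  assumes "finite I" "gather E v A"
    and "\<And>i. i \<in> I \<Longrightarrow> gather E (u i) (B i)" "\<And>i. i \<in> I \<Longrightarrow> {u i, v} \<in> E"
    and "\<And>i. i \<in> I \<Longrightarrow> card (B i) \<le> card A" "\<And>i. i \<in> I \<Longrightarrow> A \<inter> B i = {}"
    and "disjoint_family_on B I"
  shows "gather E v (A \<union> (\<Union>i\<in>I. B i))"
  using assms(1,3-7)
proof (induction I rule: finite_induct)
  case empty
  then show ?case using assms(2) by simp
next
  case (insert i I)
  have g: "gather E v (A \<union> (\<Union>i\<in>I. B i))"
    by (rule insert.IH) (use insert.prems in \<open>auto simp: disjoint_family_on_def\<close>)
  have "gather E v ((A \<union> (\<Union>i\<in>I. B i)) \<union> B i)"
  proof (rule gather.join[OF g])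
    show "gather E (u i) (B i)" "{u i, v} \<in> E" using insert.prems by auto
    show "(A \<union> (\<Union>i\<in>I. B i)) \<inter> B i = {}"
    proof -
      have "A \<inter> B i = {}" using insert.prems(4) by simp
      moreover have "B j \<inter> B i = {}" if "j \<in> I" for j
        using insert.prems(5) insert.hyps(2) that unfolding disjoint_family_on_def
          by (metis insertI1 insertI2)
      ultimately show ?thesis by auto
    qed
    have "card A \<le> card (A \<union> (\<Union>i\<in>I. B i))"
      using gather_finite[OF g] by (intro card_mono) auto
    then show "card (B i) \<le> card (A \<union> (\<Union>i\<in>I. B i))" using insert.prems(3)[of i] by auto
  qed
  then show ?case by (simp add: Un_ac)
qed

text \<open>In \<open>Join a b\<close> the root of \<open>a\<close> gets one more child carrying \<open>b\<close>, the last one to be moved into it.\<close>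

datatype otree = Leaf | Join otree otree

primrec sz :: "otree \<Rightarrow> nat" where
  "sz Leaf = 1"
| "sz (Join a b) = sz a + sz b"

primrec root_deg :: "otree \<Rightarrow> nat" where
  "root_deg Leaf = 0"
| "root_deg (Join a b) = Suc (root_deg a)"

primrec max_deg :: "otree \<Rightarrow> nat" where
  "max_deg Leaf = 0"
| "max_deg (Join a b) = max (Suc (root_deg a)) (max (max_deg a) (max_deg b))"

primrec tree_at :: "'a set set \<Rightarrow> otree \<Rightarrow> 'a \<Rightarrow> 'a set \<Rightarrow> bool" where
  "tree_at E Leaf v A \<longleftrightarrow> A = {v}"
| "tree_at E (Join a b) v A \<longleftrightarrow> (\<exists>A1 A2 u. A = A1 \<union> A2 \<and> A1 \<inter> A2 = {} \<and> {u, v} \<in> E \<and>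
      tree_at E a v A1 \<and> tree_at E b u A2)"

lemma root_deg_le_max_deg: "root_deg t \<le> max_deg t"
  by (cases t) auto

lemma sz_pos: "0 < sz t"
  by (induction t) auto

lemma tree_at_finite: "tree_at E t v A \<Longrightarrow> finite A"
  by (induction t arbitrary: v A) auto

lemma tree_at_card: "tree_at E t v A \<Longrightarrow> card A = sz t"
  by (induction t arbitrary: v A) (auto simp: card_Un_disjoint tree_at_finite)

text \<open>Binomial trees: the children of the root carry weights 1, 2, 4, ... and are moved in
  this order. As a move at most doubles a weight, \<open>2 ^ t\<close> is the best possible for a
  root with \<open>t\<close> children.\<close>

primrec bin :: "nat \<Rightarrow> otree" where
  "bin 0 = Leaf"
| "bin (Suc t) = Join (bin t) (bin t)"

lemma sz_bin [simp]: "sz (bin t) = 2 ^ t"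
  by (induction t) auto

lemma root_deg_bin [simp]: "root_deg (bin t) = t"
  by (induction t) auto

lemma max_deg_bin [simp]: "max_deg (bin t) = t"
  by (induction t) auto

lemma tree_at_bin_gather: "tree_at E (bin t) v A \<Longrightarrow> gather E v A"
proof (induction t arbitrary: v A)
  case (Suc t)
  then obtain A1 A2 u where A: "A = A1 \<union> A2" "A1 \<inter> A2 = {}" "{u, v} \<in> E"
    "tree_at E (bin t) v A1" "tree_at E (bin t) u A2" by auto
  have "card A2 \<le> card A1" using A(4,5) by (simp add: tree_at_card)
  then show ?case using gather.join[OF Suc.IH[OF A(4)] Suc.IH[OF A(5)] A(2,3)] A(1) by simp
qed (simp add: gather.single)

definition level :: "nat \<Rightarrow> nat \<Rightarrow> otree \<Rightarrow> otree" where
  "level t k b = ((\<lambda>a. Join a b) ^^ k) (bin t)"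

lemma sz_level [simp]: "sz (level t k b) = 2 ^ t + k * sz b"
  unfolding level_def by (induction k) auto

lemma root_deg_level [simp]: "root_deg (level t k b) = t + k"
  unfolding level_def by (induction k) auto

lemma max_deg_level: "max_deg (level t k b) \<le> max (t + k) (max_deg b)"
proof -
  have "max_deg (((\<lambda>a. Join a b) ^^ k) (bin t)) \<le> max (t + k) (max_deg b)"
    using root_deg_level[unfolded level_def] by (induction k) (auto simp: max_def split: if_splits)
  then show ?thesis by (simp add: level_def)
qed

text \<open>
  \<open>K\<close> is the weight a bottom has before it takes its load, \<open>M\<close> bounds the loads.
\<close>

definition absorbs :: "'a set set \<Rightarrow> nat \<Rightarrow> 'a \<Rightarrow> 'a set \<Rightarrow> bool" where
  "absorbs E K s X \<longleftrightarrow> (\<forall>A. gather E s A \<longrightarrow> K \<le> card A \<longrightarrow> A \<inter> X = {} \<longrightarrow> gather E s (A \<union> X))"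

definition flexible :: "'a set set \<Rightarrow> nat \<Rightarrow> nat \<Rightarrow> 'a \<Rightarrow> 'a set \<Rightarrow> 'a set \<Rightarrow> bool" where
  "flexible E K M r T S \<longleftrightarrow> finite T \<and> S \<subseteq> T \<and> (\<forall>X. (\<forall>s\<in>S. finite (X s) \<and> card (X s) \<le> M \<and> X s \<inter> T = {} \<and>
    absorbs E K s (X s))
      \<longrightarrow> disjoint_family_on X S \<longrightarrow> gather E r (T \<union> (\<Union>s\<in>S. X s)))"

lemma flexible_bin:
  assumes "tree_at E (bin t) v A" "K \<le> 2 ^ t"
  shows "flexible E K M v A {v}"
proof -
  have "gather E v A" "card A = 2 ^ t" using assms tree_at_bin_gather tree_at_card by fastforce+
  then show ?thesis
    using assms(2) gather_root[of E v A] gather_finite[of E v A] unfolding flexible_def absorbs_def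
    by (simp add: Int_commute)
qed

text \<open>The condition \<open>card B + M * card R \<le> card A\<close> weighs the fully loaded
  branch against the receiver without any load, so one order of moves is legal for all admissible
  loads.\<close>

lemma flexible_join:
  assumes 1: "flexible E K M v A S" and 2: "flexible E K M u B R" and disj: "A \<inter> B = {}"
    and e: "{u, v} \<in> E" and le: "card B + M * card R \<le> card A"
  shows "flexible E K M v (A \<union> B) (S \<union> R)"
  unfolding flexible_def
proof (intro conjI allI impI)
  show "finite (A \<union> B)" "S \<union> R \<subseteq> A \<union> B" using 1 2 by (auto simp: flexible_def)
  fix X assume X: "\<forall>s\<in>S \<union> R. finite (X s) \<and> card (X s) \<le> M \<and> X s \<inter> (A \<union> B) = {} \<and> absorbs E K s (X s)"
    and dis: "disjoint_family_on X (S \<union> R)"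
  have sub: "S \<subseteq> A" "R \<subseteq> B" "finite A" "finite B" using 1 2 by (auto simp: flexible_def)
  then have fR: "finite R" "finite S" using finite_subset by auto
  have gA: "gather E v (A \<union> (\<Union>s\<in>S. X s))"
  proof -
    have "\<forall>s\<in>S. finite (X s) \<and> card (X s) \<le> M \<and> X s \<inter> A = {} \<and> absorbs E K s (X s)" using X by blast
    moreover have "disjoint_family_on X S" using dis by (rule disjoint_family_on_mono[rotated]) simp
    ultimately show ?thesis using 1 unfolding flexible_def by blast
  qed
  have gB: "gather E u (B \<union> (\<Union>s\<in>R. X s))"
  proof -
    have "\<forall>s\<in>R. finite (X s) \<and> card (X s) \<le> M \<and> X s \<inter> B = {} \<and> absorbs E K s (X s)" using X by blast
    moreover have "disjoint_family_on X R" using dis by (rule disjoint_family_on_mono[rotated]) simp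
    ultimately show ?thesis using 2 unfolding flexible_def by blast
  qed
  have "card (\<Union>s\<in>R. X s) \<le> (\<Sum>s\<in>R. card (X s))" by (rule card_UN_le[OF fR(1)])
  also have "\<dots> \<le> (\<Sum>s\<in>R. M)" using X by (intro sum_mono) auto
  finally have "card (B \<union> (\<Union>s\<in>R. X s)) \<le> card B + M * card R"
    using card_Un_le[of B "\<Union>s\<in>R. X s"] by (simp add: mult.commute)
  also have "\<dots> \<le> card (A \<union> (\<Union>s\<in>S. X s))"
    using le card_mono[OF gather_finite[OF gA], of A] by auto
  finally have le': "card (B \<union> (\<Union>s\<in>R. X s)) \<le> card (A \<union> (\<Union>s\<in>S. X s))" .
  have "S \<inter> R = {}" using sub disj by auto
  then have "(\<Union>s\<in>S. X s) \<inter> (\<Union>s\<in>R. X s) = {}"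
    using dis unfolding disjoint_family_on_def disjoint_iff by (metis UN_iff UnCI)
  moreover have "(\<Union>s\<in>S. X s) \<inter> B = {}" "(\<Union>s\<in>R. X s) \<inter> A = {}" using X by auto
  ultimately have dj: "(A \<union> (\<Union>s\<in>S. X s)) \<inter> (B \<union> (\<Union>s\<in>R. X s)) = {}"
    using disj by (auto simp: disjoint_iff)
  from gather.join[OF gA gB dj e le']
  show "gather E v (A \<union> B \<union> (\<Union>s\<in>S \<union> R. X s))" by (simp add: Un_ac)
qed

text \<open>\<open>ks\<close> lists the branching numbers from the root downwards, so
  \<open>prod_list ks\<close> counts the bottoms. The exponent is the least for which the doubling
  phase alone outweighs a fully loaded copy of the subtree.\<close>

primrec skel :: "nat \<Rightarrow> nat \<Rightarrow> nat list \<Rightarrow> otree" where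
  "skel t0 M [] = bin t0"
| "skel t0 M (k # ks) = level (LEAST t. sz (skel t0 M ks) + M * prod_list ks \<le> 2 ^ t) k (skel t0 M ks)"

text \<open>Rounding up to a power of two at most doubles a weight; the size estimates for the
  skeleton rest on this.\<close>

lemma le_pow2_Least:
  shows "(x::nat) \<le> 2 ^ (LEAST t. x \<le> 2 ^ t)" (is "_ \<le> 2 ^ ?t")
    and "0 < x \<Longrightarrow> 2 ^ (LEAST t. x \<le> 2 ^ t) \<le> 2 * x"
proof -
  show "x \<le> 2 ^ (LEAST t. x \<le> 2 ^ t)"
    by (rule LeastI[of "\<lambda>t. x \<le> 2 ^ t" x]) (simp add: less_imp_le)
  assume x: "0 < x"
  show "2 ^ ?t \<le> 2 * x"
  proof (cases ?t)
    case (Suc t)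
    then have "\<not> x \<le> 2 ^ t" using not_less_Least[of t "\<lambda>t. x \<le> 2 ^ t"] by simp
    then show ?thesis using Suc by simp
  qed (use x in simp)
qed

lemma tree_at_mono: "tree_at E t v A \<Longrightarrow> E \<subseteq> E' \<Longrightarrow> tree_at E' t v A"
  by (induction t arbitrary: v A) (simp, fastforce)

text \<open>The bottoms depend on the embedded tree only, so they may be fixed before further edges are revealed.\<close>

lemma skel_flexible:
  assumes "tree_at E (skel t0 M ks) v A" "K \<le> 2 ^ t0"
  shows "\<exists>S. card S = prod_list ks \<and> (\<forall>E'. E \<subseteq> E' \<longrightarrow> flexible E' K M v A S)"
  using assms(1)
proof (induction ks arbitrary: v A)
  case Nil
  then show ?case
    using flexible_bin[OF tree_at_mono assms(2)] by (intro exI[of _ "{v}"]) auto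
next
  case (Cons k ks)
  let ?b = "skel t0 M ks" and ?N = "prod_list ks"
  define t where "t = (LEAST t. sz ?b + M * ?N \<le> 2 ^ t)"
  have t: "sz ?b + M * ?N \<le> 2 ^ t" unfolding t_def by (rule le_pow2_Least)
  have "\<exists>S. card S = j * ?N \<and> (\<forall>E'. E \<subseteq> E' \<longrightarrow> flexible E' K M v A S)"
    if "tree_at E (level t j ?b) v A" for j v A
    using that
  proof (induction j arbitrary: v A)
    case 0
    then have *: "tree_at E (bin t) v A" by (simp add: level_def)
    have "gather E' v A" if "E \<subseteq> E'" for E'
      using tree_at_bin_gather[OF tree_at_mono[OF * that]] .
    \<comment> \<open>The doubling part contains no bottoms, so the witness is the empty set and
      flexibility reduces to \<open>gather\<close>.\<close>
    then show ?case using tree_at_finite[OF *] by (intro exI[of _ "{}"]) (simp add: flexible_def)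
  next
    case (Suc j)
    then obtain A1 A2 u where A: "A = A1 \<union> A2" "A1 \<inter> A2 = {}" "{u, v} \<in> E"
      "tree_at E (level t j ?b) v A1" "tree_at E ?b u A2"
      by (auto simp: level_def)
    obtain S1 where S1: "card S1 = j * ?N" "\<And>E'. E \<subseteq> E' \<Longrightarrow> flexible E' K M v A1 S1"
      using Suc.IH[OF A(4)] by blast
    obtain S2 where S2: "card S2 = ?N" "\<And>E'. E \<subseteq> E' \<Longrightarrow> flexible E' K M u A2 S2"
      using Cons.IH[OF A(5)] by blast
    have sub: "S1 \<subseteq> A1" "S2 \<subseteq> A2" "finite A1" "finite A2"
      using S1(2)[OF order_refl] S2(2)[OF order_refl] by (auto simp: flexible_def)
    then have "finite S1" "finite S2" "S1 \<inter> S2 = {}" using A(2) by (auto intro: finite_subset)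
    then have "card (S1 \<union> S2) = Suc j * ?N" using S1(1) S2(1) by (simp add: card_Un_disjoint)
    moreover have "flexible E' K M v A (S1 \<union> S2)" if "E \<subseteq> E'" for E'
      unfolding A(1)
    proof (rule flexible_join[OF S1(2)[OF that] S2(2)[OF that] A(2)])
      show "{u, v} \<in> E'" using A(3) that by blast
      show "card A2 + M * card S2 \<le> card A1"
        using t S2(1) by (simp add: tree_at_card[OF A(4)] tree_at_card[OF A(5)])
    qed
    ultimately show ?case by blast
  qed
  from this[of k v A] show ?case using Cons.prems by (simp add: t_def)
qed

section \<open>Embedding trees into expanders\<close>

text \<open>
  In an extendable state with vertex set \<open>S\<close>, where \<open>c x\<close> counts the children placed at \<open>x\<close> so far, every small
  set still has enough free neighbours for the children its elements are allowed to get. A child at \<open>v\<close>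
  spoils this only if it is a neighbour of a tight set avoiding \<open>v\<close>; tight sets are closed under union by
  submodularity, so if all choices were spoilt, the union together with \<open>v\<close> would violate the invariant.
\<close>

locale expander =
  fixes E :: "'a set set" and W :: "'a set" and N :: "'a \<Rightarrow> 'a set" and D e m :: nat
  assumes fin: "finite W" and N_subset: "x \<in> W \<Longrightarrow> N x \<subseteq> W"
    and N_edge: "x \<in> W \<Longrightarrow> y \<in> N x \<Longrightarrow> {y, x} \<in> E"
    and expand: "X \<subseteq> W \<Longrightarrow> card X \<le> 2 * m \<Longrightarrow> (D + e) * card X \<le> card (\<Union>(N ` X))"
    and pos: "0 < e" "0 < m"
begin

definition extendable :: "'a set \<Rightarrow> ('a \<Rightarrow> nat) \<Rightarrow> bool" where
  "extendable S c \<longleftrightarrow> S \<subseteq> W \<and> (\<forall>x\<in>W. c x \<le> D) \<and>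
     (\<forall>X\<subseteq>W. card X \<le> 2 * m \<longrightarrow> (\<Sum>x\<in>X. D - c x) \<le> card (\<Union>(N ` X) - S))"

definition tight :: "'a set \<Rightarrow> ('a \<Rightarrow> nat) \<Rightarrow> 'a set \<Rightarrow> bool" where
  "tight S c X \<longleftrightarrow> X \<subseteq> W \<and> card X \<le> 2 * m \<and> card (\<Union>(N ` X) - S) = (\<Sum>x\<in>X. D - c x)"

lemma finite_nbrs: "X \<subseteq> W \<Longrightarrow> finite (\<Union>(N ` X))"
  using fin N_subset by (meson UN_least finite_subset subsetD)

text \<open>A tight set \<open>X\<close> has at most \<open>D * card X\<close> neighbours outside
  \<open>S\<close> but at least \<open>(D + e) * card X\<close> in all, so
  \<open>e * card X \<le> card S\<close>. The drop from \<open>2 * m\<close> to \<open>m\<close>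
  keeps the union of two tight sets within the range of the invariant.\<close>

lemma tight_card:
  assumes "tight S c X" "finite S" "card S \<le> e * m"
  shows "card X \<le> m"
proof -
  have X: "X \<subseteq> W" "card X \<le> 2 * m" "card (\<Union>(N ` X) - S) = (\<Sum>x\<in>X. D - c x)"
    using assms(1) by (auto simp: tight_def)
  have "(D + e) * card X \<le> card (\<Union>(N ` X))" using expand X by blast
  also have "\<dots> \<le> card (\<Union>(N ` X) - S) + card S"
    using card_Un_le[of "\<Union>(N ` X) - S" S] finite_nbrs[OF X(1)] assms(2)
      card_mono[of "(\<Union>(N ` X) - S) \<union> S" "\<Union>(N ` X)"] by auto
  also have "\<dots> \<le> (\<Sum>x\<in>X. D) + e * m"
    using X(3) assms(3) sum_mono[of X "\<lambda>x. D - c x" "\<lambda>x. D"] by simp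
  finally have "e * card X \<le> e * m" by (simp add: algebra_simps)
  then show ?thesis using pos by simp
qed

lemma tight_Un:
  assumes ext: "extendable S c" and S: "card S \<le> e * m" and t: "tight S c X" "tight S c Y"
  shows "tight S c (X \<union> Y)"
proof -
  have fS: "finite S" using ext fin finite_subset by (auto simp: extendable_def)
  have hall: "\<And>X. X \<subseteq> W \<Longrightarrow> card X \<le> 2 * m \<Longrightarrow> (\<Sum>x\<in>X. D - c x) \<le> card (\<Union>(N ` X) - S)"
    using ext by (auto simp: extendable_def)
  have sub: "X \<subseteq> W" "Y \<subseteq> W" using t by (auto simp: tight_def)
  then have fXY: "finite X" "finite Y" using fin finite_subset by auto
  have "card X \<le> m" "card Y \<le> m" using tight_card fS S t by auto
  then have c: "card (X \<union> Y) \<le> 2 * m" "card (X \<inter> Y) \<le> 2 * m"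
    using card_Un_le[of X Y] card_mono[of X "X \<inter> Y"] fXY by auto
  let ?f = "\<lambda>X. \<Union>(N ` X) - S" and ?r = "\<lambda>X. \<Sum>x\<in>X. D - c x"
  have ff: "finite (?f X)" "finite (?f Y)" using finite_nbrs sub by auto
  have "?f (X \<union> Y) = ?f X \<union> ?f Y" by auto
  moreover have "card (?f (X \<inter> Y)) \<le> card (?f X \<inter> ?f Y)"
    by (rule card_mono) (use ff in auto)
  ultimately have "card (?f (X \<union> Y)) + card (?f (X \<inter> Y)) \<le> card (?f X) + card (?f Y)"
    using card_Un_Int[OF ff] by simp
  also have "\<dots> = ?r (X \<union> Y) + ?r (X \<inter> Y)"
    using t sum.union_inter[OF fXY, of "\<lambda>x. D - c x"] by (simp add: tight_def)
  finally have le: "card (?f (X \<union> Y)) + card (?f (X \<inter> Y)) \<le> ?r (X \<union> Y) + ?r (X \<inter> Y)" .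
  have a: "?r (X \<union> Y) \<le> card (?f (X \<union> Y))"
    by (rule hall) (use c sub in auto)
  have b: "?r (X \<inter> Y) \<le> card (?f (X \<inter> Y))"
    by (rule hall) (use c sub in auto)
  show ?thesis
    unfolding tight_def using le a b c sub by auto
qed

lemma extendable_step:
  assumes ext: "extendable S c" and S: "card S \<le> e * m" and v: "v \<in> W" "c v < D"
  shows "\<exists>y\<in>N v - S. extendable (insert y S) (c(v := Suc (c v)))"
proof (rule ccontr)
  assume no: "\<not> ?thesis"
  let ?c = "c(v := Suc (c v))"
  have SW: "S \<subseteq> W" and cD: "\<And>x. x \<in> W \<Longrightarrow> c x \<le> D"
    and hall: "\<And>X. X \<subseteq> W \<Longrightarrow> card X \<le> 2 * m \<Longrightarrow> (\<Sum>x\<in>X. D - c x) \<le> card (\<Union>(N ` X) - S)"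
    using ext by (auto simp: extendable_def)
  have obst: "\<exists>X. tight S c X \<and> v \<notin> X \<and> y \<in> \<Union>(N ` X)" if y: "y \<in> N v - S" for y
  proof -
    have "\<not> extendable (insert y S) ?c" using no y by blast
    moreover have "insert y S \<subseteq> W" using y SW N_subset v by auto
    moreover have "\<forall>x\<in>W. ?c x \<le> D" using cD v by auto
    ultimately obtain X where X: "X \<subseteq> W" "card X \<le> 2 * m"
      "card (\<Union>(N ` X) - insert y S) < (\<Sum>x\<in>X. D - ?c x)"
      unfolding extendable_def by (auto simp: not_le)
    have fX: "finite X" using X fin finite_subset by auto
    have ff: "finite (\<Union>(N ` X) - S)" using finite_nbrs X by auto
    have f': "card (\<Union>(N ` X) - insert y S) = card (\<Union>(N ` X) - S) - (if y \<in> \<Union>(N ` X) then 1 else 0)"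
    proof -
      have "\<Union>(N ` X) - insert y S = (\<Union>(N ` X) - S) - {y}" by auto
      then show ?thesis using ff y by (simp only: card_Diff_singleton_if) auto
    qed
    have r': "(\<Sum>x\<in>X. D - c x) = (\<Sum>x\<in>X. D - ?c x) + (if v \<in> X then 1 else 0)"
    proof (cases "v \<in> X")
      case True
      have "(\<Sum>x\<in>X. D - c x) = (D - c v) + (\<Sum>x\<in>X - {v}. D - c x)"
        using True fX by (simp add: sum.remove)
      also have "(\<Sum>x\<in>X - {v}. D - c x) = (\<Sum>x\<in>X - {v}. D - ?c x)" by (rule sum.cong) auto
      also have "D - c v = (D - ?c v) + 1" using v by auto
      finally show ?thesis using True fX by (simp add: sum.remove)
    next
      case False
      then have "(\<Sum>x\<in>X. D - c x) = (\<Sum>x\<in>X. D - ?c x)" by (intro sum.cong) auto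
      then show ?thesis using False by simp
    qed
    have h: "(\<Sum>x\<in>X. D - c x) \<le> card (\<Union>(N ` X) - S)" using hall X by blast
    \<comment> \<open>Taking \<open>y\<close> lowers the supply of \<open>X\<close> by at most one,
      and the new child lowers its demand by one exactly if \<open>v \<in> X\<close>; a new
      violation leaves only this combination.\<close>
    have "v \<notin> X \<and> y \<in> \<Union>(N ` X) \<and> card (\<Union>(N ` X) - S) = (\<Sum>x\<in>X. D - c x)"
      using X(3) f' r' h by (auto split: if_splits)
    then show ?thesis using X unfolding tight_def by blast
  qed
  have "\<exists>X. tight S c X \<and> v \<notin> X \<and> F \<subseteq> \<Union>(N ` X)" if "finite F" "F \<subseteq> N v - S" for F
    using that
  proof (induction F rule: finite_induct)
    case empty
    then show ?case by (intro exI[of _ "{}"]) (simp add: tight_def)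
  next
    case (insert y F)
    then obtain X where X: "tight S c X" "v \<notin> X" "F \<subseteq> \<Union>(N ` X)" by auto
    obtain Y where Y: "tight S c Y" "v \<notin> Y" "y \<in> \<Union>(N ` Y)" using obst insert.prems by blast
    show ?case using tight_Un[OF ext S X(1) Y(1)] X Y by (intro exI[of _ "X \<union> Y"]) auto
  qed
  moreover have "finite (N v - S)" using N_subset[OF v(1)] fin finite_subset by blast
  ultimately obtain X where X: "tight S c X" "v \<notin> X" "N v - S \<subseteq> \<Union>(N ` X)" by blast
  have fS: "finite S" using SW fin finite_subset by auto
  have XW: "X \<subseteq> W" and fX: "finite X" using X fin finite_subset by (auto simp: tight_def)
  \<comment> \<open>\<open>m + 1 \<le> 2 * m\<close> holds as \<open>0 < m\<close>. Adding
    \<open>v\<close> brings no free neighbours but a positive demand, since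
    \<open>c v < D\<close>.\<close>
  have "card (insert v X) \<le> 2 * m"
    using tight_card[OF X(1) fS S] X(2) fX pos by simp
  then have "(\<Sum>x\<in>insert v X. D - c x) \<le> card (\<Union>(N ` insert v X) - S)"
    using hall[of "insert v X"] XW v by auto
  also have "\<Union>(N ` insert v X) - S = \<Union>(N ` X) - S" using X(3) by auto
  also have "card \<dots> = (\<Sum>x\<in>X. D - c x)" using X(1) by (simp add: tight_def)
  finally show False using fX X(2) v by simp
qed

text \<open>The branch \<open>b\<close> of \<open>Join a b\<close> is embedded when \<open>a\<close>
  is already there, so the induction runs over arbitrary occupied sets and counters. The root
  \<open>v\<close> is counted both in \<open>S\<close> and in \<open>t\<close>, whence the
  \<open>Suc\<close> in the size bound.\<close>

lemma extendable_tree: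
  assumes "extendable S c" "v \<in> S" "c v + root_deg t \<le> D" "max_deg t \<le> D" "card S + sz t \<le> Suc (e * m)"
    and "\<And>x. x \<notin> S \<Longrightarrow> c x = 0"
  shows "\<exists>A c'. v \<in> A \<and> A \<inter> S = {v} \<and> extendable (S \<union> A) c' \<and> tree_at E t v A \<and>
    (\<forall>x\<in>S - {v}. c' x = c x) \<and> c' v = c v + root_deg t \<and> (\<forall>x. x \<notin> S \<union> A \<longrightarrow> c' x = 0)"
  using assms
proof (induction t arbitrary: S c v)
  case Leaf
  then show ?case by (intro exI[of _ "{v}"] exI[of _ c]) (auto simp: insert_absorb)
next
  case (Join a b)
  have fS: "finite S" using Join.prems(1) fin finite_subset by (auto simp: extendable_def)
  have "\<exists>A c'. v \<in> A \<and> A \<inter> S = {v} \<and> extendable (S \<union> A) c' \<and> tree_at E a v A \<and>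
    (\<forall>x\<in>S - {v}. c' x = c x) \<and> c' v = c v + root_deg a \<and> (\<forall>x. x \<notin> S \<union> A \<longrightarrow> c' x = 0)"
    by (rule Join.IH(1)) (use Join.prems in auto)
  then obtain A c1 where A: "v \<in> A" "A \<inter> S = {v}" "extendable (S \<union> A) c1" "tree_at E a v A"
    "\<forall>x\<in>S - {v}. c1 x = c x" "c1 v = c v + root_deg a" "\<forall>x. x \<notin> S \<union> A \<longrightarrow> c1 x = 0"
    by blast
  have fA: "finite A" by (rule tree_at_finite[OF A(4)])
  have cSA: "card (S \<union> A) + 1 = card S + sz a"
    using card_Un_Int[OF fS fA] A(2) tree_at_card[OF A(4)] by (simp add: Int_commute)
  have vW: "v \<in> W" using A(1,3) by (auto simp: extendable_def)
  have "card (S \<union> A) \<le> e * m" using cSA Join.prems(5) sz_pos[of b] by simp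
  from extendable_step[OF A(3) this vW] obtain u where
    u: "u \<in> N v - (S \<union> A)" "extendable (insert u (S \<union> A)) (c1(v := Suc (c1 v)))"
    using A(6) Join.prems(3) by auto
  let ?S = "insert u (S \<union> A)" and ?c = "c1(v := Suc (c1 v))"
  have cu: "?c u = 0" using u(1) A(1,7) by auto
  have "\<exists>B c'. u \<in> B \<and> B \<inter> ?S = {u} \<and> extendable (?S \<union> B) c' \<and> tree_at E b u B \<and>
    (\<forall>x\<in>?S - {u}. c' x = ?c x) \<and> c' u = ?c u + root_deg b \<and> (\<forall>x. x \<notin> ?S \<union> B \<longrightarrow> c' x = 0)"
  proof (rule Join.IH(2))
    show "?c u + root_deg b \<le> D" "max_deg b \<le> D"
      using cu root_deg_le_max_deg[of b] Join.prems(4) by auto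
    show "card ?S + sz b \<le> Suc (e * m)"
      using cSA Join.prems(5) u(1) fS fA by simp
    show "?c x = 0" if "x \<notin> ?S" for x using that A(1,7) by auto
    show "extendable ?S ?c" by (rule u(2))
  qed simp
  then obtain B c2 where B: "u \<in> B" "B \<inter> ?S = {u}" "extendable (?S \<union> B) c2" "tree_at E b u B"
    "\<forall>x\<in>?S - {u}. c2 x = ?c x" "\<forall>x. x \<notin> ?S \<union> B \<longrightarrow> c2 x = 0"
    by blast
  have un: "?S \<union> B = S \<union> (A \<union> B)" using B(1) by auto
  have AB: "A \<inter> B = {}" using B(2) u(1) by auto
  show ?case
  proof (intro exI[of _ "A \<union> B"] exI[of _ c2] conjI ballI allI impI)
    show "(A \<union> B) \<inter> S = {v}" using A(2) B(2) u(1) by auto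
    show "extendable (S \<union> (A \<union> B)) c2" using B(3) un by simp
    show "tree_at E (Join a b) v (A \<union> B)"
      using A(4) B(4) AB N_edge[OF vW, of u] u(1) by auto
    show "c2 x = c x" if "x \<in> S - {v}" for x
      using that bspec[OF A(5) that] bspec[OF B(5), of x] u(1) by auto
    show "c2 v = c v + root_deg (Join a b)" using bspec[OF B(5), of v] A(1,6) u(1) by auto
    show "c2 x = 0" if "x \<notin> S \<union> (A \<union> B)" for x using that B(1,6) by auto
  qed (use A(1) in simp)
qed

theorem tree_embedding:
  assumes "v \<in> W" "max_deg t \<le> D" "sz t \<le> e * m"
  shows "\<exists>A\<subseteq>W. tree_at E t v A"
proof -
  have "extendable {v} (\<lambda>_. 0)"
    unfolding extendable_def
  proof (intro conjI allI impI ballI)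
    fix X assume X: "X \<subseteq> W" "card X \<le> 2 * m"
    show "(\<Sum>x\<in>X. D - 0) \<le> card (\<Union>(N ` X) - {v})"
    proof (cases "card X = 0")
      case False
      \<comment> \<open>The surplus \<open>e > 0\<close> gives at least one extra neighbour, which
        pays for the loss of \<open>v\<close>.\<close>
      then have "D * card X < (D + e) * card X" using pos by (simp add: algebra_simps)
      also have "\<dots> \<le> card (\<Union>(N ` X))" by (rule expand[OF X])
      finally have "D * card X < card (\<Union>(N ` X))" .
      then show ?thesis
        by (auto simp: card_Diff_singleton_if mult.commute)
    qed simp
  qed (use assms in auto)
  from extendable_tree[OF this, of v t] show ?thesis
    using assms root_deg_le_max_deg[of t] by (auto simp: extendable_def)
qed

end

section \<open>Hall's theorem\<close>

text \<open>Halmos-Vaughan induction: a proper nonempty set attaining equality is matched inside its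
  own neighbourhood and the rest outside it; if there is none, every proper nonempty set has a spare
  neighbour and any first choice is safe.\<close>

theorem hall_matching:
  fixes N :: "'a \<Rightarrow> 'b set"
  assumes "finite A" "\<And>a. a \<in> A \<Longrightarrow> finite (N a)"
    and "\<And>X. X \<subseteq> A \<Longrightarrow> card X \<le> card (\<Union>(N ` X))"
  shows "\<exists>f. inj_on f A \<and> (\<forall>a\<in>A. f a \<in> N a)"
  using assms
proof (induction "card A" arbitrary: A N rule: less_induct)
  case less
  show ?case
  proof (cases "A = {}")
    case False
    then obtain a where a: "a \<in> A" by blast
    have fU: "finite (\<Union>(N ` X))" if "X \<subseteq> A" for X
      using that less.prems(1,2) finite_subset[OF that] by auto
    show ?thesis
    proof (cases "\<exists>X. X \<subset> A \<and> X \<noteq> {} \<and> card (\<Union>(N ` X)) = card X")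
      case True
      then obtain X where X: "X \<subset> A" "X \<noteq> {}" "card (\<Union>(N ` X)) = card X" by blast
      have fX: "finite X" using X less.prems(1) finite_subset by blast
      have lt: "card X < card A" using X less.prems(1) psubset_card_mono by blast
      obtain f where f: "inj_on f X" "\<And>a. a \<in> X \<Longrightarrow> f a \<in> N a"
        using less.hyps[OF lt fX, of N] less.prems X by (metis psubsetE subset_iff)
      let ?M = "\<lambda>a. N a - \<Union>(N ` X)"
      have lt': "card (A - X) < card A"
        using X less.prems(1) by (intro psubset_card_mono) auto
      have "\<exists>g. inj_on g (A - X) \<and> (\<forall>a\<in>A - X. g a \<in> ?M a)"
      proof (rule less.hyps[OF lt'])
        fix Y assume Y: "Y \<subseteq> A - X"
        have fY: "finite Y" using Y less.prems(1) finite_subset by blast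
        have "card X + card Y = card (X \<union> Y)" using Y fX fY by (subst card_Un_disjoint) auto
        also have "\<dots> \<le> card (\<Union>(N ` (X \<union> Y)))" using Y X by (intro less.prems(3)) auto
        also have "\<Union>(N ` (X \<union> Y)) = \<Union>(N ` X) \<union> \<Union>(?M ` Y)" by auto
        also have "card \<dots> \<le> card X + card (\<Union>(?M ` Y))" using card_Un_le X(3) by metis
        finally show "card Y \<le> card (\<Union>(?M ` Y))" by simp
      qed (use less.prems in auto)
      then obtain g where g: "inj_on g (A - X)" "\<And>a. a \<in> A - X \<Longrightarrow> g a \<in> ?M a" by blast
      let ?h = "\<lambda>a. if a \<in> X then f a else g a"
      have "inj_on ?h A"
      proof (rule inj_onI)
        fix x y assume xy: "x \<in> A" "y \<in> A" "?h x = ?h y"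
        consider "x \<in> X" "y \<in> X" | "x \<notin> X" "y \<notin> X" | "x \<in> X" "y \<notin> X" | "x \<notin> X" "y \<in> X" by blast
        then show "x = y"
        proof cases
          case 1 then show ?thesis using xy f(1) by (auto dest: inj_onD)
        next
          case 2 then show ?thesis using xy g(1) by (auto dest: inj_onD)
        next
          case 3 then show ?thesis using xy f(2)[of x] g(2)[of y] by auto
        next
          case 4 then show ?thesis using xy f(2)[of y] g(2)[of x] by auto
        qed
      qed
      moreover have "\<forall>a\<in>A. ?h a \<in> N a" using f(2) g(2) by auto
      ultimately show ?thesis by blast
    next
      case False
      have "card {a} \<le> card (\<Union>(N ` {a}))" by (rule less.prems(3)) (use a in simp)
      then have "N a \<noteq> {}" by auto
      then obtain b where b: "b \<in> N a" by blast
      let ?M = "\<lambda>x. N x - {b}"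
      have lt': "card (A - {a}) < card A" using a less.prems(1) by (intro psubset_card_mono) auto
      have "\<exists>g. inj_on g (A - {a}) \<and> (\<forall>x\<in>A - {a}. g x \<in> ?M x)"
      proof (rule less.hyps[OF lt'])
        fix Y assume Y: "Y \<subseteq> A - {a}"
        show "card Y \<le> card (\<Union>(?M ` Y))"
        proof (cases "Y = {}")
          case nonempty: False
          have "Y \<subset> A" using Y a by auto
          then have "card Y < card (\<Union>(N ` Y))"
            using False nonempty less.prems(3)[of Y] by (metis le_neq_implies_less psubset_imp_subset)
          moreover have "\<Union>(?M ` Y) = \<Union>(N ` Y) - {b}" by auto
          ultimately show ?thesis using fU[of Y] Y by (auto simp: card_Diff_singleton_if)
        qed simp
      qed (use less.prems in auto)
      then obtain g where g: "inj_on g (A - {a})" "\<And>x. x \<in> A - {a} \<Longrightarrow> g x \<in> ?M x" by blast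
      have "inj_on (g(a := b)) A"
      proof (rule inj_onI)
        fix x y assume xy: "x \<in> A" "y \<in> A" "(g(a := b)) x = (g(a := b)) y"
        show "x = y"
          using xy g(2)[of x] g(2)[of y] inj_onD[OF g(1), of x y] by (auto split: if_splits)
      qed
      moreover have "\<forall>x\<in>A. (g(a := b)) x \<in> N x" using g(2) b by auto
      ultimately show ?thesis by blast
    qed
  qed simp
qed

text \<open>Hall's theorem with every target replaced by \<open>C\<close> copies of itself.\<close>

corollary hall_assignment:
  fixes N :: "'a \<Rightarrow> 'b set"
  assumes "finite A" "\<And>a. a \<in> A \<Longrightarrow> finite (N a)"
    and "\<And>X. X \<subseteq> A \<Longrightarrow> card X \<le> C * card (\<Union>(N ` X))"
  shows "\<exists>f. (\<forall>a\<in>A. f a \<in> N a) \<and> (\<forall>b. card {a\<in>A. f a = b} \<le> C)"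
proof -
  have "\<exists>f. inj_on f A \<and> (\<forall>a\<in>A. f a \<in> N a \<times> {..<C})"
  proof (rule hall_matching[OF assms(1)])
    fix X assume X: "X \<subseteq> A"
    have "(\<Union>a\<in>X. N a \<times> {..<C}) = (\<Union>(N ` X)) \<times> {..<C}" by auto
    then show "card X \<le> card (\<Union>a\<in>X. N a \<times> {..<C})"
      using assms(3)[OF X] by (simp add: mult.commute card_cartesian_product)
  qed (use assms in auto)
  then obtain f where f: "inj_on f A" "\<And>a. a \<in> A \<Longrightarrow> f a \<in> N a \<times> {..<C}" by blast
  have "card {a \<in> A. fst (f a) = b} \<le> C" for b
  proof -
    have "card {a \<in> A. fst (f a) = b} = card (f ` {a \<in> A. fst (f a) = b})"
      using f(1) by (intro card_image[symmetric]) (auto intro: inj_on_subset)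
    also have "\<dots> \<le> card ({b} \<times> {..<C})"
    proof (rule card_mono)
      show "f ` {a \<in> A. fst (f a) = b} \<subseteq> {b} \<times> {..<C}"
      proof (rule image_subsetI)
        fix a assume "a \<in> {a \<in> A. fst (f a) = b}"
        then show "f a \<in> {b} \<times> {..<C}" using f(2)[of a] by (auto simp: mem_Times_iff)
      qed
    qed simp
    finally show ?thesis by (simp add: card_cartesian_product)
  qed
  moreover have "\<forall>a\<in>A. fst (f a) \<in> N a" using f(2) by (auto simp: mem_Times_iff)
  ultimately show ?thesis by (intro exI[of _ "fst \<circ> f"]) auto
qed

section \<open>Absorbing the remaining vertices\<close>

definition nbr :: "'a set set \<Rightarrow> 'a \<Rightarrow> 'a set" where
  "nbr E x = {y. {x, y} \<in> E}"

abbreviation deg :: "'a set set \<Rightarrow> 'a \<Rightarrow> 'a set \<Rightarrow> real" where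
  "deg E x S \<equiv> real (card (nbr E x \<inter> S))"

text \<open>Edges are counted from both ends, so \<open>\<eta>\<close> bounds the average degree of
  all small induced subgraphs.\<close>

definition sparse :: "'a set set \<Rightarrow> 'a set \<Rightarrow> real \<Rightarrow> real \<Rightarrow> bool" where
  "sparse E V \<eta> l \<longleftrightarrow> (\<forall>X\<subseteq>V. real (card X) \<le> l \<longrightarrow> real (\<Sum>x\<in>X. card (nbr E x \<inter> X)) \<le> \<eta> * real (card X))"

text \<open>If the neighbourhood were smaller than \<open>A\<close>, the two together would have
  fewer than \<open>2 * card A\<close> vertices but degree sum at least
  \<open>\<kappa> * card A\<close>, hence average degree above
  \<open>\<kappa> / 2 > \<eta>\<close>.\<close>

lemma sparse_expands:
  assumes "sparse E V \<eta> l" "finite V" "A \<subseteq> V" "W \<subseteq> V" "A \<inter> W = {}"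
    and deg: "\<And>a. a \<in> A \<Longrightarrow> \<kappa> \<le> deg E a W"
    and "2 * \<eta> < \<kappa>" "0 \<le> \<eta>" "2 * real (card A) \<le> l"
  shows "card A \<le> card (\<Union>a\<in>A. nbr E a \<inter> W)"
proof (rule ccontr)
  let ?N = "\<Union>a\<in>A. nbr E a \<inter> W"
  assume "\<not> ?thesis"
  then have lt: "card ?N < card A" by simp
  have "finite A" "finite W" using assms(2-4) finite_subset by auto
  then have fin: "finite A" "finite ?N" "finite W" by (auto intro: finite_subset[of _ W])
  let ?X = "A \<union> ?N"
  have cX: "real (card ?X) \<le> 2 * real (card A)"
    using card_Un_le[of A ?N] lt by linarith
  have "\<kappa> * real (card A) \<le> (\<Sum>a\<in>A. deg E a W)"
    using sum_mono[of A "\<lambda>_. \<kappa>"] deg by (simp add: mult.commute)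
  also have "\<dots> \<le> (\<Sum>a\<in>A. deg E a ?X)"
    using fin by (intro sum_mono) (auto intro!: card_mono)
  also have "\<dots> \<le> (\<Sum>a\<in>?X. deg E a ?X)"
    using fin by (intro sum_mono2) auto
  also have "\<dots> \<le> \<eta> * real (card ?X)"
  proof -
    have "?X \<subseteq> V" "real (card ?X) \<le> l" using assms(3,4,9) cX by auto
    then show ?thesis using assms(1) unfolding sparse_def by simp
  qed
  also have "\<dots> \<le> \<eta> * (2 * real (card A))" using cX assms(8) by (rule mult_left_mono)
  finally have "\<kappa> * real (card A) \<le> 2 * \<eta> * real (card A)" by simp
  moreover have "0 < real (card A)" using lt by simp
  ultimately show False using assms(7) by simp
qed

text \<open>
  A vertex \<open>\<mu> b\<close> with \<open>b \<in> B\<close> has weight two when it is moved to \<open>\<phi> (\<mu> b)\<close>; the private leaf \<open>\<mu> y\<close> has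
  raised the weight of that target \<open>y\<close> to two before.
\<close>

lemma gather_reserved:
  assumes "finite V" "T \<subseteq> V" "flexible E K M r T S"
    and Y: "Y \<subseteq> V - T" "\<And>y. y \<in> Y \<Longrightarrow> \<sigma> y \<in> S \<and> {y, \<sigma> y} \<in> E"
    and parts: "V - T - Y = R \<union> B" "R \<inter> B = {}"
    and \<mu>: "inj_on \<mu> (B \<union> Y)" "\<And>a. a \<in> B \<union> Y \<Longrightarrow> \<mu> a \<in> R \<and> {a, \<mu> a} \<in> E"
    and \<phi>: "\<And>z. z \<in> R - \<mu> ` Y \<Longrightarrow> \<phi> z \<in> Y \<and> {z, \<phi> z} \<in> E"
      "\<And>y. card {z \<in> R - \<mu> ` Y. \<phi> z = y} \<le> C"
    and deg: "\<And>s. s \<in> S \<Longrightarrow> card (nbr E s \<inter> V) \<le> \<Delta>"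
    and K: "2 + 2 * C \<le> K" and M: "\<Delta> * (2 + 2 * C) \<le> M"
  shows "gather E r V"
proof -
  have fin: "finite R" "finite B" "finite Y" "finite T"
  proof -
    have "R \<subseteq> V" "B \<subseteq> V" "Y \<subseteq> V" using Y(1) parts(1) by auto
    then show "finite R" "finite B" "finite Y" "finite T"
      using assms(2) finite_subset[OF _ assms(1)] by blast+
  qed
  have sep: "R \<inter> Y = {}" "B \<inter> Y = {}" "R \<inter> T = {}" "B \<inter> T = {}" "Y \<inter> T = {}"
    using parts(1) Y(1) by auto
  \<comment> \<open>Everything is collected upwards in bounded portions: \<open>G z\<close> has at
    most 2 elements, \<open>H y\<close> at most \<open>2 + 2 * C\<close>, and the load
    \<open>X s\<close> of a bottom consists of one portion \<open>H y\<close> for each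
    \<open>y\<close> assigned to \<open>s\<close>.\<close>
  define G where "G z = insert z {b \<in> B. \<mu> b = z}" for z
  define Z where "Z y = {z \<in> R - \<mu> ` Y. \<phi> z = y}" for y
  define H where "H y = {y, \<mu> y} \<union> (\<Union>z\<in>Z y. G z)" for y
  define X where "X s = (\<Union>y\<in>{y\<in>Y. \<sigma> y = s}. H y)" for s
  have G: "gather E z (G z)" "card (G z) \<le> 2" if z: "z \<in> R" for z
  proof -
    have "gather E z (G z) \<and> card (G z) \<le> 2"
    proof (cases "\<exists>b\<in>B. \<mu> b = z")
      case True
      then obtain b where b: "b \<in> B" "\<mu> b = z" by blast
      have "{b' \<in> B. \<mu> b' = z} = {b}"
        using b \<mu>(1) by (auto dest: inj_onD)
      then have eq: "G z = {z} \<union> {b}" by (auto simp: G_def)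
      have "z \<noteq> b" using b z parts(2) by auto
      then have "gather E z ({z} \<union> {b})"
        using \<mu>(2)[of b] b by (intro gather.join[of _ z "{z}" b "{b}"]) (auto intro: gather.single)
      then show ?thesis unfolding eq by (simp add: card_insert_if)
    next
      case False
      then have "G z = {z}" by (auto simp: G_def)
      then show ?thesis by (simp add: gather.single)
    qed
    then show "gather E z (G z)" "card (G z) \<le> 2" by auto
  qed
  have G_sub: "G z \<subseteq> insert z B" for z by (auto simp: G_def)
  have G_disj: "G z \<inter> G z' = {}" if "z \<in> R" "z' \<in> R" "z \<noteq> z'" for z z'
    using that parts(2) by (auto simp: G_def)
  have Z_sub: "Z y \<subseteq> R" for y by (auto simp: Z_def)
  have fZ: "finite (Z y)" for y using fin(1) Z_sub finite_subset by blast
  have H: "gather E y (H y)" "card (H y) \<le> 2 + 2 * C" if y: "y \<in> Y" for y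
  proof -
    have \<mu>y: "\<mu> y \<in> R" "{y, \<mu> y} \<in> E" using \<mu>(2) y by auto
    then have ne: "y \<noteq> \<mu> y" using sep y by auto
    have "gather E y ({y} \<union> {\<mu> y})"
      using \<mu>y ne by (intro gather.join) (auto intro: gather.single simp: insert_commute)
    then have base: "gather E y {y, \<mu> y}" by (simp add: insert_commute)
    have c: "card {y, \<mu> y} = 2" using ne by simp
    have dis: "{y, \<mu> y} \<inter> G z = {}" if "z \<in> Z y" for z
    proof -
      have "z \<in> R" "z \<noteq> \<mu> y" using that y by (auto simp: Z_def)
      moreover have "\<mu> y \<noteq> b" "y \<noteq> b" if "b \<in> B" for b
        using that sep y \<mu>y parts(2) by auto
      ultimately show ?thesis using sep y by (auto simp: G_def)
    qed
    show "gather E y (H y)"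
      unfolding H_def
    proof (rule gather_Union[OF fZ base, where u = "\<lambda>z. z"])
      fix z assume z: "z \<in> Z y"
      show "gather E z (G z)" "card (G z) \<le> card {y, \<mu> y}" using G z Z_sub c by auto
      show "{z, y} \<in> E" using \<phi>(1)[of z] z by (auto simp: Z_def)
      show "{y, \<mu> y} \<inter> G z = {}" by (rule dis[OF z])
    next
      show "disjoint_family_on G (Z y)"
        unfolding disjoint_family_on_def using G_disj Z_sub by blast
    qed
    have "card (\<Union>z\<in>Z y. G z) \<le> (\<Sum>z\<in>Z y. card (G z))" by (rule card_UN_le[OF fZ])
    also have "\<dots> \<le> (\<Sum>z\<in>Z y. 2)" using G(2) Z_sub by (intro sum_mono) auto
    also have "\<dots> \<le> 2 * C" using \<phi>(2)[of y] by (simp add: Z_def)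
    finally show "card (H y) \<le> 2 + 2 * C"
      using card_Un_le[of "{y, \<mu> y}" "\<Union>z\<in>Z y. G z"] c by (simp add: H_def)
  qed
  have H_sub: "H y \<subseteq> Y \<union> R \<union> B" if "y \<in> Y" for y
    using that \<mu>(2)[of y] Z_sub[of y] G_sub by (fastforce simp: H_def)
  have H_disj: "H y \<inter> H y' = {}" if yy: "y \<in> Y" "y' \<in> Y" "y \<noteq> y'" for y y'
  proof -
    have m: "\<mu> y \<noteq> \<mu> y'" using yy \<mu>(1) by (auto dest: inj_onD)
    have r: "\<mu> y \<in> R" "\<mu> y' \<in> R" using \<mu>(2) yy by auto
    have "Z y \<inter> Z y' = {}" using yy by (auto simp: Z_def)
    then have 1: "(\<Union>z\<in>Z y. G z) \<inter> (\<Union>z\<in>Z y'. G z) = {}"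
      using G_disj Z_sub by (fastforce simp: disjoint_iff)
    have 2: "w \<notin> G z" if "w \<in> {y, \<mu> y, y', \<mu> y'}" "z \<in> Z y \<union> Z y'" for w z
    proof -
      have "z \<in> R" "z \<noteq> \<mu> y" "z \<noteq> \<mu> y'" using that(2) yy by (auto simp: Z_def)
      then show ?thesis using that(1) yy r sep parts(2) by (auto simp: G_def)
    qed
    show ?thesis
      using 1 2 m r yy sep by (auto simp: H_def disjoint_iff)
  qed
  have X_sub: "X s \<subseteq> Y \<union> R \<union> B" for s using H_sub by (auto simp: X_def)
  have X_disj: "disjoint_family_on X S"
    unfolding disjoint_family_on_def
  proof (intro ballI impI)
    fix s s' assume "s \<in> S" "s' \<in> S" "s \<noteq> s'"
    then show "X s \<inter> X s' = {}" unfolding X_def using H_disj by (fastforce simp: disjoint_iff)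
  qed
  have X: "finite (X s) \<and> card (X s) \<le> M \<and> X s \<inter> T = {} \<and> absorbs E K s (X s)" if s: "s \<in> S" for s
  proof (intro conjI)
    show "finite (X s)" using X_sub fin finite_subset by (meson finite_UnI)
    show "X s \<inter> T = {}" using X_sub[of s] sep by blast
    let ?I = "{y\<in>Y. \<sigma> y = s}"
    have fI: "finite ?I" using fin by simp
    \<comment> \<open>A bottom serves only its neighbours, so the degree bound
      \<open>\<Delta>\<close> limits its load.\<close>
    have "?I \<subseteq> nbr E s \<inter> V" using Y by (auto simp: nbr_def insert_commute)
    then have "card ?I \<le> card (nbr E s \<inter> V)" using assms(1) by (intro card_mono) auto
    then have cI: "card ?I \<le> \<Delta>" using deg[OF s] by simp
    have "card (X s) \<le> (\<Sum>y\<in>?I. card (H y))" unfolding X_def by (rule card_UN_le[OF fI])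
    also have "\<dots> \<le> (\<Sum>y\<in>?I. 2 + 2 * C)" using H(2) by (intro sum_mono) auto
    also have "\<dots> = card ?I * (2 + 2 * C)" by simp
    also have "\<dots> \<le> \<Delta> * (2 + 2 * C)" by (rule mult_le_mono1[OF cI])
    finally show "card (X s) \<le> M" using M by simp
    show "absorbs E K s (X s)"
      unfolding absorbs_def
    proof (intro allI impI)
      fix A assume A: "gather E s A" "K \<le> card A" "A \<inter> X s = {}"
      show "gather E s (A \<union> X s)"
        unfolding X_def
      proof (rule gather_Union[OF fI A(1), where u = "\<lambda>y. y"])
        fix y assume y: "y \<in> ?I"
        show "gather E y (H y)" "card (H y) \<le> card A" using H[of y] y A(2) K by auto
        show "{y, s} \<in> E" using Y(2) y by auto
        show "A \<inter> H y = {}" using A(3) y by (auto simp: X_def)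
      next
        show "disjoint_family_on H ?I" unfolding disjoint_family_on_def using H_disj by auto
      qed
    qed
  qed
  have "gather E r (T \<union> (\<Union>s\<in>S. X s))"
    using assms(3) X X_disj unfolding flexible_def by blast
  moreover have "T \<union> (\<Union>s\<in>S. X s) = V"
  proof
    show "T \<union> (\<Union>s\<in>S. X s) \<subseteq> V" using X_sub assms(2) parts(1) Y(1) by blast
    show "V \<subseteq> T \<union> (\<Union>s\<in>S. X s)"
    proof
      fix x assume x: "x \<in> V"
      have HX: "w \<in> (\<Union>s\<in>S. X s)" if "y \<in> Y" "w \<in> H y" for w y
        using that Y(2)[of y] by (auto simp: X_def)
      have RX: "w \<in> (\<Union>s\<in>S. X s)" if z: "z \<in> R" "w \<in> G z" for w z
      proof (cases "z \<in> \<mu> ` Y")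
        case True
        then obtain y where y: "y \<in> Y" "z = \<mu> y" by blast
        \<comment> \<open>\<open>\<mu>\<close> is injective on \<open>B \<union> Y\<close>, so the
          private leaf of \<open>y\<close> carries no exceptional vertex.\<close>
        have "w = z" using z y \<mu>(1) sep(2) by (auto simp: G_def dest: inj_onD)
        then show ?thesis using HX[of y] y by (simp add: H_def)
      next
        case False
        then show ?thesis using HX[of "\<phi> z" w] \<phi>(1)[of z] z by (auto simp: H_def Z_def)
      qed
      consider "x \<in> T" | "x \<in> Y" | "x \<in> R" | "x \<in> B" using x parts(1) by blast
      then show "x \<in> T \<union> (\<Union>s\<in>S. X s)"
      proof cases
        case 2 then show ?thesis using HX[of x x] by (simp add: H_def)
      next
        case 3 then show ?thesis using RX[of x x] by (simp add: G_def)
      next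
        case 4 then show ?thesis using RX[of "\<mu> x" x] \<mu>(2)[of x] by (simp add: G_def)
      qed simp
    qed
  qed
  ultimately show ?thesis by simp
qed

text \<open>Vertices with at least \<open>\<theta>\<close> neighbours in the set are added one by
  one. Each adds at least \<open>\<theta>\<close> to the degree sum, so at twice the initial size
  the average degree would be at least \<open>\<theta> / 2 > \<eta>\<close>. The process is replaced
  by a largest set with such a degree sum.\<close>

lemma peeling:
  assumes sp: "sparse E V \<eta> l" and fin: "finite V" and F0: "F0 \<subseteq> V" "2 * real (card F0) \<le> l"
    and \<eta>: "2 * \<eta> < \<theta>" "0 \<le> \<eta>"
  shows "\<exists>F. F0 \<subseteq> F \<and> F \<subseteq> V \<and> card F \<le> 2 * card F0 \<and> (\<forall>x\<in>V - F. deg E x F < \<theta>)"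
proof -
  let ?s = "\<lambda>F. real (\<Sum>x\<in>F. card (nbr E x \<inter> F))"
  let ?P = "\<lambda>F. F0 \<subseteq> F \<and> F \<subseteq> V \<and> card F \<le> 2 * card F0 \<and> \<theta> * (real (card F) - real (card F0)) \<le> ?s F"
  have fF0: "finite F0" using F0 fin finite_subset by auto
  have "\<exists>F. ?P F \<and> (\<forall>G. ?P G \<longrightarrow> card G \<le> card F)"
  proof (rule ex_has_greatest_nat)
    have "0 \<le> ?s F0" by (rule of_nat_0_le_iff)
    then show "?P F0" using F0 by simp
    show "\<forall>F. ?P F \<longrightarrow> card F < Suc (2 * card F0)" by (simp add: less_Suc_eq_le)
  qed
  then obtain F where F: "?P F" and mx: "\<And>G. ?P G \<Longrightarrow> card G \<le> card F" by blast
  have fF: "finite F" using F fin finite_subset by blast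
  show ?thesis
  proof (intro exI[of _ F] conjI ballI)
    show "F0 \<subseteq> F" "F \<subseteq> V" "card F \<le> 2 * card F0" using F by auto
    fix x assume x: "x \<in> V - F"
    show "deg E x F < \<theta>"
    proof (rule ccontr)
      assume "\<not> ?thesis"
      then have big: "\<theta> \<le> deg E x F" by simp
      have lt: "card F < 2 * card F0"
      proof (rule ccontr)
        assume "\<not> card F < 2 * card F0"
        then have eq: "card F = 2 * card F0" using F by simp
        have "real (card F) \<le> l" using eq F0 by simp
        then have "?s F \<le> \<eta> * real (card F)" using sp F unfolding sparse_def by blast
        moreover have "\<theta> * real (card F0) \<le> ?s F" using F eq by simp
        ultimately have "\<theta> * real (card F0) \<le> 2 * \<eta> * real (card F0)" using eq by simp
        then have "card F0 = 0" using \<eta> by (metis mult_le_cancel_right not_less of_nat_0_le_iff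
          of_nat_eq_0_iff order_le_less)
        then have "F = {}" using eq fF by simp
        then show False using big \<eta> by simp
      qed
      let ?G = "insert x F"
      have cG: "card ?G = Suc (card F)" using fF x by simp
      have "?s F + \<theta> \<le> ?s ?G"
      proof -
        have "(\<Sum>y\<in>F. card (nbr E y \<inter> F)) \<le> (\<Sum>y\<in>F. card (nbr E y \<inter> ?G))"
          using fF by (intro sum_mono card_mono) auto
        moreover have "card (nbr E x \<inter> F) \<le> card (nbr E x \<inter> ?G)" using fF by (intro card_mono) auto
        ultimately have "(\<Sum>y\<in>F. card (nbr E y \<inter> F)) + card (nbr E x \<inter> F) \<le> (\<Sum>y\<in>?G. card (nbr E y \<inter> ?G))"
          using fF x by simp
        then have "real ((\<Sum>y\<in>F. card (nbr E y \<inter> F)) + card (nbr E x \<inter> F)) \<le> ?s ?G"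
          by (rule of_nat_mono)
        then show ?thesis using big by (simp only: of_nat_add)
      qed
      then have "?P ?G" using F lt x cG by (auto simp: algebra_simps)
      from mx[OF this] cG show False by simp
    qed
  qed
qed

text \<open>
  Vertices in \<open>Q\<close> have few neighbours in \<open>Z\<close>. Keeping the tree away from their neighbourhoods and from \<open>Z\<close>
  leaves every vertex with many neighbours off the tree.
\<close>

lemma skeleton_embedding:
  assumes fin: "finite V'" and V': "V' = U \<union> Z" "U \<inter> Z = {}"
    and sp: "sparse E V' \<eta> l" and \<eta>: "2 * \<eta> < \<theta>" "0 \<le> \<eta>"
    and sp2: "\<And>X Y. X \<subseteq> U \<Longrightarrow> Y \<subseteq> U \<Longrightarrow> X \<inter> Y = {} \<Longrightarrow> X \<noteq> {} \<Longrightarrow> card X \<le> 2 * m \<Longrightarrow>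
      card Y \<le> (D + e) * card X \<Longrightarrow> real (\<Sum>x\<in>X. card (nbr E x \<inter> Y)) < h * real (card X)"
    and low: "\<And>x. x \<in> U - Low \<Longrightarrow> h + 2 * \<theta> \<le> deg E x U"
    and Q: "Q \<subseteq> V'" "\<And>x. x \<in> V' - Q \<Longrightarrow> c \<le> deg E x Z"
    and deg: "\<And>x. x \<in> V' \<Longrightarrow> c \<le> deg E x V'"
    and F0: "F0 = U \<inter> (Low \<union> Q \<union> (\<Union>x\<in>Q. nbr E x))" "2 * real (card F0) \<le> l" "2 * card F0 < card U"
    and m: "2 * real m \<le> l" "0 < m" "0 < e"
    and t: "max_deg t \<le> D" "sz t \<le> e * m"
  shows "\<exists>v T. T \<subseteq> U \<and> tree_at E t v T \<and> (\<forall>x\<in>V'. c \<le> deg E x (V' - T))"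
proof -
  have spU: "sparse E U \<eta> l" using sp V'(1) unfolding sparse_def by blast
  have fU: "finite U" using fin V' by auto
  have "F0 \<subseteq> U" using F0(1) by auto
  from peeling[OF spU fU this F0(2) \<eta>] obtain F where F: "F0 \<subseteq> F" "F \<subseteq> U" "card F \<le> 2 * card F0"
    "\<And>x. x \<in> U - F \<Longrightarrow> deg E x F < \<theta>" by blast
  define W where "W = U - F"
  have fW: "finite W" and fF: "finite F" using fU F(2) finite_subset by (auto simp: W_def)
  have degW: "h + \<theta> < deg E x W" if x: "x \<in> W" for x
  proof -
    have "x \<in> U - Low" using x F(1) F0(1) by (auto simp: W_def)
    then have "h + 2 * \<theta> \<le> deg E x U" by (rule low)
    also have "nbr E x \<inter> U = (nbr E x \<inter> W) \<union> (nbr E x \<inter> F)" using F(2) by (auto simp: W_def)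
    also have "real (card \<dots>) \<le> deg E x W + deg E x F"
      using card_Un_le[of "nbr E x \<inter> W" "nbr E x \<inter> F"] by linarith
    finally show ?thesis using F(4)[of x] x by (simp add: W_def)
  qed
  interpret expander E W "\<lambda>x. nbr E x \<inter> W" D e m
  proof
    fix X assume X: "X \<subseteq> W" "card X \<le> 2 * m"
    show "(D + e) * card X \<le> card (\<Union>x\<in>X. nbr E x \<inter> W)"
    proof (rule ccontr)
      let ?N = "\<Union>x\<in>X. nbr E x \<inter> W"
      \<comment> \<open>Edges leaving \<open>X\<close> are bounded by \<open>sp2\<close>, which
        speaks of disjoint sets, and edges inside \<open>X\<close> by sparseness; together
        \<open>h + \<eta> < h + \<theta>\<close> per vertex.\<close>
      let ?Y = "?N - X"
      assume "\<not> (D + e) * card X \<le> card ?N"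
      then have lt: "card ?N < (D + e) * card X" by simp
      then have ne: "X \<noteq> {}" by auto
      have fX: "finite X" using X(1) fW finite_subset by auto
      have fN: "finite ?N" using fW by (auto intro: finite_subset[of _ W])
      have XU: "X \<subseteq> U" "?Y \<subseteq> U" using X(1) by (auto simp: W_def)
      have "card ?Y \<le> card ?N" using fN by (intro card_mono) auto
      then have 1: "real (\<Sum>x\<in>X. card (nbr E x \<inter> ?Y)) < h * real (card X)"
        using lt X ne XU by (intro sp2) auto
      have "real (card X) \<le> l" using X(2) m(1) by linarith
      then have 2: "real (\<Sum>x\<in>X. card (nbr E x \<inter> X)) \<le> \<eta> * real (card X)"
        using spU XU unfolding sparse_def by blast
      have "(h + \<theta>) * real (card X) \<le> (\<Sum>x\<in>X. deg E x W)"
        using sum_mono[of X "\<lambda>_. h + \<theta>"] degW X(1) by (simp add: mult.commute less_imp_le subset_iff)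
      also have "\<dots> \<le> (\<Sum>x\<in>X. deg E x ?Y + deg E x X)"
      proof (rule sum_mono)
        fix x assume x: "x \<in> X"
        have "card (nbr E x \<inter> W) \<le> card ((nbr E x \<inter> ?Y) \<union> (nbr E x \<inter> X))"
        proof (rule card_mono)
          show "nbr E x \<inter> W \<subseteq> (nbr E x \<inter> ?Y) \<union> (nbr E x \<inter> X)" using x by auto
          show "finite ((nbr E x \<inter> ?Y) \<union> (nbr E x \<inter> X))" using fN fX by auto
        qed
        also have "\<dots> \<le> card (nbr E x \<inter> ?Y) + card (nbr E x \<inter> X)" by (rule card_Un_le)
        finally show "deg E x W \<le> deg E x ?Y + deg E x X"
          by linarith
      qed
      also have "\<dots> < h * real (card X) + \<eta> * real (card X)"
        using 1 2 by (simp add: sum.distrib)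
      finally have "\<theta> * real (card X) < \<eta> * real (card X)" by (simp add: algebra_simps)
      then show False using \<eta> by (auto simp: mult_less_cancel_right)
    qed
  qed (use fW m in \<open>auto simp: nbr_def insert_commute\<close>)
  have "W \<noteq> {}"
  proof
    assume "W = {}"
    then have "card U \<le> card F" using fF by (intro card_mono) (auto simp: W_def)
    then show False using F(3) F0(3) by simp
  qed
  then obtain v where "v \<in> W" by blast
  from tree_embedding[OF this t] obtain T where T: "T \<subseteq> W" "tree_at E t v T" by blast
  have "c \<le> deg E x (V' - T)" if x: "x \<in> V'" for x
  proof (cases "x \<in> Q")
    case True
    \<comment> \<open>All neighbours in \<open>U\<close> of a vertex of \<open>Q\<close> lie in
      \<open>F0\<close> and hence off the tree.\<close>
    have "nbr E x \<inter> V' = nbr E x \<inter> (V' - T)"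
      using True T(1) F(1) F0(1) by (auto simp: W_def)
    then show ?thesis using deg[OF x] by simp
  next
    case False
    have "card (nbr E x \<inter> Z) \<le> card (nbr E x \<inter> (V' - T))"
    proof (rule card_mono)
      show "finite (nbr E x \<inter> (V' - T))" using \<open>finite V'\<close> by simp
      show "nbr E x \<inter> Z \<subseteq> nbr E x \<inter> (V' - T)" using T(1) V' by (auto simp: W_def)
    qed
    then show ?thesis using Q(2)[of x] x False by simp
  qed
  moreover have "T \<subseteq> U" using T(1) by (auto simp: W_def)
  ultimately show ?thesis using T(2) by blast
qed

section \<open>Random subsets\<close>

abbreviation (input) prob :: "'a pmf \<Rightarrow> 'a set \<Rightarrow> real" where
  "prob M A \<equiv> measure_pmf.prob M A"

definition random_subset :: "'a set \<Rightarrow> real \<Rightarrow> 'a set pmf" where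
  "random_subset A p = map_pmf (\<lambda>f. {e \<in> A. f e}) (Pi_pmf A False (\<lambda>_. bernoulli_pmf p))"

lemma binomial_random_graph_eq: "binomial_random_graph n p = random_subset (all_edges {1..n}) p"
  by (simp add: binomial_random_graph_def random_subset_def)

lemma set_random_subset: "set_pmf (random_subset A p) \<subseteq> Pow A"
  by (auto simp: random_subset_def)

lemma random_subset_empty: "random_subset {} p = return_pmf {}"
  by (simp add: random_subset_def map_pmf_def bind_return_pmf)

lemma random_subset_insert:
  assumes "finite A" "x \<notin> A"
  shows "random_subset (insert x A) p =
    bind_pmf (bernoulli_pmf p) (\<lambda>b. map_pmf (\<lambda>X. if b then insert x X else X) (random_subset A p))"
proof -
  have eq: "(if b then insert x {e \<in> A. f e} else {e \<in> A. f e}) = {e \<in> insert x A. (f(x := b)) e}" for f b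
    using assms(2) by auto
  show ?thesis
    unfolding random_subset_def Pi_pmf_insert'[OF assms] map_pmf_comp eq
    by (simp add: map_pmf_def bind_assoc_pmf bind_return_pmf)
qed

lemma prob_random_subset_insert:
  assumes "finite A" "x \<notin> A" "0 \<le> p" "p \<le> 1"
  shows "prob (random_subset (insert x A) p) S =
    p * prob (random_subset A p) {X. insert x X \<in> S} + (1 - p) * prob (random_subset A p) S"
proof -
  let ?P = "\<lambda>S. prob (random_subset A p) S"
  have "ennreal (prob (random_subset (insert x A) p) S) =
      ennreal (?P {X. insert x X \<in> S}) * p + ennreal (?P S) * (1 - p)"
    unfolding measure_pmf.emeasure_eq_measure[symmetric] random_subset_insert[OF assms(1,2)]
    using assms(3,4) by (simp add: vimage_def emeasure_map_pmf)
  also have "\<dots> = ennreal (p * ?P {X. insert x X \<in> S} + (1 - p) * ?P S)"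
    using assms(3,4) by (simp add: ennreal_mult mult.commute)
  finally show ?thesis using assms(3,4) by (subst (asm) ennreal_inj) auto
qed

text \<open>In place of a coupling, one element is split off at a time: its presence only helps, so
  shifting weight \<open>q - p\<close> to that case increases the average.\<close>

lemma prob_random_subset_mono:
  assumes "finite A" "0 \<le> p" "p \<le> q" "q \<le> 1" "\<And>X Y. X \<in> S \<Longrightarrow> X \<subseteq> Y \<Longrightarrow> Y \<in> S"
  shows "prob (random_subset A p) S \<le> prob (random_subset A q) S"
  using assms(1,5)
proof (induction A arbitrary: S rule: finite_induct)
  case (insert x A)
  let ?S = "{X. insert x X \<in> S}"
  have up: "Y \<in> ?S" if "X \<in> ?S" "X \<subseteq> Y" for X Y
    using insert.prems[of "insert x X" "insert x Y"] that by auto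
  have le: "prob (random_subset A q) S \<le> prob (random_subset A q) ?S"
    using insert.prems[of _ "insert x _"] by (intro measure_pmf.finite_measure_mono) auto
  have "p * prob (random_subset A p) ?S + (1 - p) * prob (random_subset A p) S
      \<le> p * prob (random_subset A q) ?S + (1 - p) * prob (random_subset A q) S"
    using insert.IH[OF up] insert.IH[OF insert.prems] assms
    by (intro add_mono mult_left_mono) auto
  also have "\<dots> \<le> q * prob (random_subset A q) ?S + (1 - q) * prob (random_subset A q) S"
    using mult_right_mono[OF le, of "q - p"] assms by (simp add: algebra_simps)
  finally show ?case
    using insert.hyps assms by (simp add: prob_random_subset_insert)
qed (simp add: random_subset_empty)

text \<open>Conditioning on the part inside \<open>A\<close>, phrased as an induction over its
  elements that leaves \<open>P\<close> and \<open>Q\<close> free to absorb what has been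
  seen.\<close>

lemma prob_random_subset_Un:
  assumes "finite A" "A \<inter> B = {}" "finite B" "0 \<le> p" "p \<le> 1" "0 \<le> b"
    and "\<And>X. X \<subseteq> A \<Longrightarrow> prob (random_subset B p) {Z. Q (X \<union> Z)} \<le> (if P X then b else 0)"
  shows "prob (random_subset (A \<union> B) p) {E. Q E} \<le> b * prob (random_subset A p) {X. P X}"
  using assms(1,2,7)
proof (induction A arbitrary: P Q rule: finite_induct)
  case empty
  from empty.prems(2)[of "{}"] show ?case by (auto simp: random_subset_empty indicator_def)
next
  case (insert x A)
  have 1: "prob (random_subset (A \<union> B) p) {E. Q E} \<le> b * prob (random_subset A p) {X. P X}"
    using insert.prems(1) by (intro insert.IH insert.prems(2)) auto
  have 2: "prob (random_subset (A \<union> B) p) {E. Q (insert x E)}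
      \<le> b * prob (random_subset A p) {X. P (insert x X)}"
  proof (rule insert.IH)
    fix X assume "X \<subseteq> A"
    then show "prob (random_subset B p) {Z. Q (insert x (X \<union> Z))} \<le> (if P (insert x X) then b else 0)"
      using insert.prems(2)[of "insert x X"] by (simp add: subset_insertI2 insert_mono)
  qed (use insert.prems in auto)
  have "prob (random_subset (insert x A \<union> B) p) {E. Q E} =
      p * prob (random_subset (A \<union> B) p) {E. Q (insert x E)}
      + (1 - p) * prob (random_subset (A \<union> B) p) {E. Q E}"
    using prob_random_subset_insert[of "A \<union> B" x p "{E. Q E}"] insert.hyps insert.prems(1) assms by auto
  also have "\<dots> \<le> p * (b * prob (random_subset A p) {X. P (insert x X)})
      + (1 - p) * (b * prob (random_subset A p) {X. P X})"
    using 1 2 assms by (intro add_mono mult_left_mono) auto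
  also have "\<dots> = b * prob (random_subset (insert x A) p) {X. P X}"
    unfolding prob_random_subset_insert[OF insert.hyps(1,2) assms(4,5)] by (simp add: algebra_simps)
  finally show ?case .
qed

text \<open>Deferred decisions: an estimate valid for every outcome on \<open>A\<close> holds
  overall. The staged exposures rest on this form.\<close>

corollary prob_random_subset_reveal:
  assumes "finite A" "A \<inter> B = {}" "finite B" "0 \<le> p" "p \<le> 1" "0 \<le> b"
    and "\<And>X. X \<subseteq> A \<Longrightarrow> prob (random_subset B p) {Z. Q (X \<union> Z)} \<le> b"
  shows "prob (random_subset (A \<union> B) p) {E. Q E} \<le> b"
  using prob_random_subset_Un[of A B p b Q "\<lambda>_. True"] assms by simp

text \<open>Both tails at once: \<open>R k a\<close> is \<open>a \<le> k\<close> (with \<open>\<rho> \<ge> 1\<close>) or \<open>k \<le> a\<close> (with \<open>\<rho> \<le> 1\<close>).\<close>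

lemma random_subset_tail_aux:
  assumes "finite A" "0 \<le> p" "p \<le> 1" "0 < \<rho>"
    and R: "\<And>a. R 0 a \<Longrightarrow> 1 \<le> \<rho> powr (-a)" "\<And>k a. R (Suc k) a \<longleftrightarrow> R k (a - 1)"
  shows "prob (random_subset A p) {X. R (card (X \<inter> F)) a} \<le> \<rho> powr (-a) * (1 - p + p * \<rho>) ^ card (A \<inter> F)"
  using assms(1)
proof (induction A arbitrary: a rule: finite_induct)
  case empty
  show ?case using R(1)[of a] by (auto simp: random_subset_empty indicator_def)
next
  case (insert x A)
  let ?M = "(1 - p + p * \<rho>) ^ card (A \<inter> F)"
  have "0 \<le> ?M" using assms by simp
  have AE: "AE X in measure_pmf (random_subset A p). finite X \<and> x \<notin> X"
    using set_random_subset[of A p] insert.hyps by (auto simp: AE_measure_pmf_iff intro: finite_subset)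
  show ?case
  proof (cases "x \<in> F")
    case True
    \<comment> \<open>A present element of \<open>F\<close> shifts the threshold by one, which costs
      the factor \<open>\<rho>\<close>; averaging with its absence gives
      \<open>1 - p + p * \<rho>\<close>.\<close>
    have "prob (random_subset A p) {X. R (card (insert x X \<inter> F)) a}
        = prob (random_subset A p) {X. R (card (X \<inter> F)) (a - 1)}"
    proof (rule measure_pmf.finite_measure_eq_AE)
      show "AE X in measure_pmf (random_subset A p).
         (X \<in> {X. R (card (insert x X \<inter> F)) a}) = (X \<in> {X. R (card (X \<inter> F)) (a - 1)})"
        using AE by (rule AE_mp) (auto intro!: AE_I2 simp: True R(2))
    qed auto
    also have "\<dots> \<le> \<rho> powr (-(a - 1)) * ?M" by (rule insert.IH)
    also have "\<rho> powr (-(a - 1)) = \<rho> * \<rho> powr (-a)" using assms(4)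
      by (simp add: powr_diff powr_minus field_simps)
    finally have 1: "prob (random_subset A p) {X. R (card (insert x X \<inter> F)) a} \<le> \<rho> * \<rho> powr (-a) * ?M" .
    have "prob (random_subset (insert x A) p) {X. R (card (X \<inter> F)) a} \<le>
        p * (\<rho> * \<rho> powr (-a) * ?M) + (1 - p) * (\<rho> powr (-a) * ?M)"
      using 1 insert.IH[of a] insert.hyps assms(2,3)
      by (simp add: prob_random_subset_insert add_mono mult_left_mono)
    also have "\<dots> = \<rho> powr (-a) * (1 - p + p * \<rho>) ^ Suc (card (A \<inter> F))" by (simp add: algebra_simps)
    also have "Suc (card (A \<inter> F)) = card (insert x A \<inter> F)" using True insert.hyps by simp
    finally show ?thesis .
  next
    case False
    then have "insert x X \<inter> F = X \<inter> F" "insert x A \<inter> F = A \<inter> F" for X by auto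
    then have "prob (random_subset (insert x A) p) {X. R (card (X \<inter> F)) a}
        = prob (random_subset A p) {X. R (card (X \<inter> F)) a}"
      using insert.hyps assms(2,3) by (simp add: prob_random_subset_insert algebra_simps)
    then show ?thesis using insert.IH[of a] \<open>\<And>X. insert x A \<inter> F = A \<inter> F\<close> by simp
  qed
qed

lemma pow_le_exp: "0 \<le> 1 - p + p * \<rho> \<Longrightarrow> (1 - p + p * \<rho>) ^ k \<le> exp ((\<rho> - 1) * p * real k)" for p \<rho> :: real
proof -
  assume "0 \<le> 1 - p + p * \<rho>"
  moreover have "1 - p + p * \<rho> \<le> exp ((\<rho> - 1) * p)"
    using exp_ge_add_one_self[of "(\<rho> - 1) * p"] by (simp add: algebra_simps)
  ultimately have "(1 - p + p * \<rho>) ^ k \<le> exp ((\<rho> - 1) * p) ^ k" by (intro power_mono)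
  then show ?thesis by (simp add: exp_of_nat_mult[symmetric] mult.commute)
qed

text \<open>\<open>\<rho>\<close> stays free instead of being optimised: it is as large as
  \<open>n / card X\<close> for edges inside a small set \<open>X\<close>, but only
  \<open>exp 1\<close> for degrees.\<close>

lemma upper_tail:
  assumes "finite A" "F \<subseteq> A" "0 \<le> p" "p \<le> 1" "1 \<le> \<rho>"
  shows "prob (random_subset A p) {X. a \<le> real (card (X \<inter> F))} \<le> \<rho> powr (-a) * exp ((\<rho> - 1) * p * real (card
    F))"
proof -
  have "prob (random_subset A p) {X. a \<le> real (card (X \<inter> F))} \<le> \<rho> powr (-a) * (1 - p + p * \<rho>) ^ card (A \<inter> F)"
    using assms by (intro random_subset_tail_aux[where R = "\<lambda>k a. a \<le>
      real k"]) (auto simp: ge_one_powr_ge_zero)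
  also have "\<dots> \<le> \<rho> powr (-a) * exp ((\<rho> - 1) * p * real (card (A \<inter> F)))"
    using assms by (intro mult_left_mono pow_le_exp) auto
  also have "A \<inter> F = F" using assms(2) by auto
  finally show ?thesis .
qed

lemma lower_tail:
  assumes "finite A" "F \<subseteq> A" "0 \<le> p" "p \<le> 1" "0 < \<rho>" "\<rho> \<le> 1"
  shows "prob (random_subset A p) {X. real (card (X \<inter> F)) \<le> a} \<le> \<rho> powr (-a) * exp (- (1 - \<rho>) * p * real
    (card F))"
proof -
  have pw: "1 \<le> \<rho> powr (- a)" if "0 \<le> a" for a
  proof -
    have "0 \<le> - a * ln \<rho>" using assms(5,6) that by (simp add: mult_nonneg_nonpos)
    then show ?thesis using assms(5) by (simp add: powr_def)
  qed
  have "prob (random_subset A p) {X. real (card (X \<inter> F)) \<le> a} \<le> \<rho> powr (-a) * (1 - p + p * \<rho>) ^ card (A \<inter> F)"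
    using assms pw by (intro random_subset_tail_aux[where R = "\<lambda>k a. real k \<le> a"]) auto
  also have "\<dots> \<le> \<rho> powr (-a) * exp ((\<rho> - 1) * p * real (card (A \<inter> F)))"
    using assms by (intro mult_left_mono pow_le_exp) auto
  also have "A \<inter> F = F" using assms(2) by auto
  finally show ?thesis by (simp add: algebra_simps)
qed

section \<open>Union bound and Markov's inequality\<close>

lemma prob_UN_le:
  assumes "finite I" "\<And>x. x \<in> set_pmf M \<Longrightarrow> Q x \<Longrightarrow> \<exists>i\<in>I. R i x"
    and "\<And>i. i \<in> I \<Longrightarrow> prob M {x. R i x} \<le> b i"
  shows "prob M {x. Q x} \<le> (\<Sum>i\<in>I. b i)"
proof -
  have "prob M {x. Q x} \<le> prob M (\<Union>i\<in>I. {x. R i x})"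
    using assms(2) by (intro measure_pmf.finite_measure_mono_AE) (auto simp: AE_measure_pmf_iff)
  also have "\<dots> \<le> (\<Sum>i\<in>I. prob M {x. R i x})"
    using assms(1) by (intro measure_pmf.finite_measure_subadditive_finite) auto
  also have "\<dots> \<le> (\<Sum>i\<in>I. b i)" using assms(3) by (rule sum_mono)
  finally show ?thesis .
qed

lemma prob_card_ge:
  assumes "finite I" "\<And>i. i \<in> I \<Longrightarrow> prob M {x. R i x} \<le> q" "0 < a"
  shows "prob M {x. a \<le> real (card {i \<in> I. R i x})} \<le> real (card I) * q / a"
proof -
  have eq: "real (card {i \<in> I. R i x}) = (\<Sum>i\<in>I. indicator {x. R i x} x)" for x
  proof -
    have "(\<Sum>i\<in>I. indicator {x. R i x} x) = (\<Sum>i\<in>{i \<in> I. R i x}. (1::real))"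
      using assms(1) by (intro sum.mono_neutral_cong_right) (auto simp: indicator_def)
    then show ?thesis by simp
  qed
  have int: "integrable M (\<lambda>x. indicator {x. R i x} x :: real)" for i
    by (intro measure_pmf.integrable_const_bound[where B = 1]) (auto simp: indicator_def)
  have "prob M {x \<in> space M. a \<le> real (card {i \<in> I. R i x})}
      \<le> measure_pmf.expectation M (\<lambda>x. real (card {i \<in> I. R i x})) / a"
    unfolding eq using int assms(3)
    by (intro integral_Markov_inequality_measure[where A = "{}"]) (auto intro!: sum_nonneg)
  also have "measure_pmf.expectation M (\<lambda>x. real (card {i \<in> I. R i x})) = (\<Sum>i\<in>I. prob M {x. R i x})"
    unfolding eq using int by (subst Bochner_Integration.integral_sum) auto
  also have "\<dots> \<le> (\<Sum>i\<in>I. q)" using assms(2) by (rule sum_mono)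
  finally show ?thesis using assms(3) by (simp add: divide_right_mono)
qed

section \<open>Size of the skeleton\<close>

text \<open>The weight gathered when every bottom carries the maximal load.\<close>

abbreviation skel_weight :: "nat \<Rightarrow> nat \<Rightarrow> nat list \<Rightarrow> nat" where
  "skel_weight t0 M ks \<equiv> sz (skel t0 M ks) + M * prod_list ks"

lemma skel_weight_Cons_le:
  "skel_weight t0 M (k # ks) \<le> (k + 2) * skel_weight t0 M ks"
  "sz (skel t0 M (k # ks)) \<le> 2 * skel_weight t0 M ks + k * sz (skel t0 M ks)"
proof -
  have "2 ^ (LEAST t. skel_weight t0 M ks \<le> 2 ^ t) \<le> 2 * skel_weight t0 M ks"
    by (rule le_pow2_Least(2)) (simp add: sz_pos)
  then show "skel_weight t0 M (k # ks) \<le> (k + 2) * skel_weight t0 M ks"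
    "sz (skel t0 M (k # ks)) \<le> 2 * skel_weight t0 M ks + k * sz (skel t0 M ks)"
    by (simp_all add: algebra_simps)
qed

text \<open>A level multiplies the loaded weight by at most \<open>k + 2\<close>, the 2 coming from
  rounding to a power of two, and \<open>k + 2 \<le> k * exp (2 / k)\<close>.\<close>

lemma skel_weight_le:
  assumes "\<And>k. k \<in> set ks \<Longrightarrow> 1 \<le> k"
  shows "real (skel_weight t0 M ks) \<le> real (prod_list ks) * real (2 ^ t0 + M) * exp (2 * (\<Sum>k\<leftarrow>ks. 1 / real k))"
  using assms
proof (induction ks)
  case (Cons k ks)
  let ?s = "\<Sum>k\<leftarrow>ks. 1 / real k"
  have k: "1 \<le> k" using Cons.prems by simp
  have "real (skel_weight t0 M (k # ks)) \<le> real ((k + 2) * skel_weight t0 M ks)"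
    by (rule of_nat_mono[OF skel_weight_Cons_le(1)])
  also have "\<dots> = real (k + 2) * real (skel_weight t0 M ks)" by (rule of_nat_mult)
  also have "\<dots> \<le> (real k * exp (2 * (1 / real k))) * (real (prod_list ks) * real (2 ^ t0 + M) * exp (2 * ?s))"
  proof (rule mult_mono)
    have "real k * (1 + 2 * (1 / real k)) \<le> real k * exp (2 * (1 / real k))"
      by (intro mult_left_mono exp_ge_add_one_self) simp
    then show "real (k + 2) \<le> real k * exp (2 * (1 / real k))" using k by (simp add: algebra_simps)
    show "real (skel_weight t0 M ks) \<le> real (prod_list ks) * real (2 ^ t0 + M) * exp (2 * ?s)"
      using Cons by simp
  qed auto
  also have "\<dots> = real (prod_list (k # ks)) * real (2 ^ t0 + M) * exp (2 * (\<Sum>k\<leftarrow>k # ks. 1 / real k))"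
    by (simp add: exp_add distrib_left)
  finally show ?case .
qed simp

text \<open>\<open>M\<close> enters the bare size only through the doubling parts, whose share at a
  level is about \<open>2 / k\<close>. So it is accompanied by the sum of reciprocals; this is
  essential, since the number of bottoms times \<open>M\<close> is itself of order
  \<open>n\<close>.\<close>

lemma sz_skel_le:
  assumes "\<And>k. k \<in> set ks \<Longrightarrow> 1 \<le> k"
  shows "real (sz (skel t0 M ks)) \<le> real (prod_list ks) *
    (2 ^ t0 + 2 * real (2 ^ t0 + M) * (\<Sum>k\<leftarrow>ks. 1 / real k) * exp (2 * (\<Sum>k\<leftarrow>ks. 1 / real k)))"
  using assms
proof (induction ks)
  case (Cons k ks)
  let ?s = "\<Sum>k\<leftarrow>ks. 1 / real k" and ?v = "real (2 ^ t0 + M)" and ?N = "real (prod_list ks)"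
  let ?s' = "1 / real k + ?s"
  have k: "1 \<le> k" and ks: "\<And>k. k \<in> set ks \<Longrightarrow> 1 \<le> k" using Cons.prems by auto
  have s: "0 \<le> ?s" by (intro sum_list_nonneg) auto
  have e: "exp (2 * ?s) \<le> exp (2 * ?s')" using k by simp
  have "real (sz (skel t0 M (k # ks))) \<le> real (2 * skel_weight t0 M ks + k * sz (skel t0 M ks))"
    by (rule of_nat_mono[OF skel_weight_Cons_le(2)])
  also have "\<dots> = 2 * real (skel_weight t0 M ks) + real k * real (sz (skel t0 M ks))" by simp
  also have "\<dots> \<le> 2 * (?N * ?v * exp (2 * ?s)) + real k * (?N * (2 ^ t0 + 2 * ?v * ?s * exp (2 * ?s)))"
    using skel_weight_le[of ks t0 M] ks Cons.IH by (intro add_mono mult_left_mono) auto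
  also have "\<dots> \<le> 2 * (?N * ?v * exp (2 * ?s')) + real k * (?N * (2 ^ t0 + 2 * ?v * ?s * exp (2 * ?s')))"
    using e s by (intro add_mono mult_left_mono order_refl) auto
  also have "\<dots> = real (prod_list (k # ks)) * (2 ^ t0 + 2 * ?v * ?s' * exp (2 * ?s'))"
    using k by (simp add: field_simps)
  finally show ?case by simp
qed simp

text \<open>Loaded weights do not decrease towards the root, so an exponent good for the total
  weight bounds the doubling phase at all levels.\<close>

lemma max_deg_skel_le:
  assumes "\<And>k. k \<in> set ks \<Longrightarrow> 1 \<le> k \<and> k \<le> K" "2 * skel_weight t0 M ks \<le> 2 ^ \<tau>"
  shows "max_deg (skel t0 M ks) \<le> max t0 (\<tau> + K)"
  using assms
proof (induction ks)
  case (Cons k ks)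
  define t where "t = (LEAST t. skel_weight t0 M ks \<le> 2 ^ t)"
  have k: "1 \<le> k" "k \<le> K" using Cons.prems(1) by auto
  have "skel_weight t0 M ks \<le> k * skel_weight t0 M ks"
    using mult_le_mono1[OF k(1), of "skel_weight t0 M ks"] by (simp only: mult_1)
  also have "\<dots> \<le> skel_weight t0 M (k # ks)" by (simp add: algebra_simps)
  finally have "skel_weight t0 M ks \<le> skel_weight t0 M (k # ks)" .
  from order_trans[OF mult_le_mono2[OF this] Cons.prems(2)] have le: "2 * skel_weight t0 M ks \<le> 2 ^ \<tau>" .
  have "2 ^ t \<le> 2 * skel_weight t0 M ks"
    unfolding t_def by (rule le_pow2_Least(2)) (simp add: sz_pos)
  then have "(2::nat) ^ t \<le> 2 ^ \<tau>" using le by linarith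
  then have "t \<le> \<tau>" by simp
  have "max_deg (skel t0 M ks) \<le> max t0 (\<tau> + K)" using Cons.IH Cons.prems(1) le by simp
  moreover have "t + k \<le> \<tau> + K" using \<open>t \<le> \<tau>\<close> k by simp
  moreover have "max_deg (skel t0 M (k # ks)) \<le> max (t + k) (max_deg (skel t0 M ks))"
    unfolding t_def skel.simps by (rule max_deg_level)
  ultimately show ?case by linarith
qed simp

text \<open>For the maximal \<open>h\<close> with \<open>k ^ Suc h \<le> x\<close> the quotient
  \<open>x / k ^ h\<close> lies between \<open>k\<close> and \<open>k ^ 2\<close>. It may exceed
  \<open>k\<close>, so it is approximated by two equal factors near its square root; each is at
  least \<open>sqrt k - 1\<close>, which keeps the reciprocals small, and rounding them down loses
  at most a factor 4.\<close>

lemma branching_exists: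
  fixes x :: real and k :: nat
  assumes k: "2 \<le> k" and x: "real k \<le> x"
  shows "\<exists>ks. (\<forall>i\<in>set ks. 1 \<le> i \<and> i \<le> k) \<and> x / 4 \<le> real (prod_list ks) \<and> real (prod_list ks) \<le> x \<and>
    ((2::real) < sqrt k \<longrightarrow> (\<Sum>i\<leftarrow>ks. 1 / real i) \<le> 2 / (sqrt k - 1) + ln x / (real k * ln k))"
proof -
  have x0: "x > 0" using k x by linarith
  have lnk: "0 < ln (real k)" using k by simp
  have bound: "real h \<le> ln x / ln k" if "real k ^ Suc h \<le> x" for h
  proof -
    have "real k ^ h \<le> real k ^ Suc h" using k by (intro power_increasing) auto
    then have "real k ^ h \<le> x" using that by linarith
    then have "ln (real k ^ h) \<le> ln x" using x0 k by (subst ln_le_cancel_iff) auto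
    then have "real h * ln k \<le> ln x" using k by (simp add: ln_realpow)
    then show ?thesis using lnk by (simp add: field_simps)
  qed
  have "\<exists>h. real k ^ Suc h \<le> x \<and> (\<forall>h'. real k ^ Suc h' \<le> x \<longrightarrow> h' \<le> h)"
  proof (rule ex_has_greatest_nat)
    show "real k ^ Suc 0 \<le> x" using x by simp
    show "\<forall>h. real k ^ Suc h \<le> x \<longrightarrow> h < nat \<lceil>ln x / ln k\<rceil> + 1"
    proof (intro allI impI)
      fix h assume "real k ^ Suc h \<le> x"
      then have "real h \<le> ln x / ln k" by (rule bound)
      then have "h \<le> nat \<lceil>ln x / ln k\<rceil>" by linarith
      then show "h < nat \<lceil>ln x / ln k\<rceil> + 1" by simp
    qed
  qed
  then obtain h where h: "real k ^ Suc h \<le> x" "\<And>h'. real k ^ Suc h' \<le> x \<Longrightarrow> h' \<le> h" by blast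
  define \<rho> where "\<rho> = x / real k ^ h"
  define j where "j = nat \<lfloor>sqrt \<rho>\<rfloor>"
  have kh: "0 < real k ^ h" using k by simp
  have r1: "real k \<le> \<rho>" using h(1) kh by (simp add: \<rho>_def field_simps)
  have "\<not> real k ^ Suc (Suc h) \<le> x" using h(2)[of "Suc h"] by auto
  then have r2: "\<rho> < real k ^ 2" using kh by (simp add: \<rho>_def field_simps power2_eq_square)
  have r0: "1 \<le> \<rho>" using r1 k by simp
  have sr: "1 \<le> sqrt \<rho>" using r0 by simp
  then have j: "real j \<le> sqrt \<rho>" "sqrt \<rho> < real j + 1" "1 \<le> j" by (auto simp: j_def le_nat_floor)
  have "sqrt \<rho> < real k" using r2 by (intro real_less_lsqrt) auto
  then have jk: "j \<le> k" using j(1) by linarith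
  have "real j ^ 2 \<le> sqrt \<rho> ^ 2" using j by (intro power_mono) auto
  then have j2: "real j ^ 2 \<le> \<rho>" using r0 by simp
  have "sqrt \<rho> \<le> 2 * real j" using j by linarith
  then have "sqrt \<rho> ^ 2 \<le> (2 * real j) ^ 2" using sr by (intro power_mono) auto
  then have j4: "\<rho> / 4 \<le> real j ^ 2" using r0 by (simp add: power_mult_distrib)
  let ?ks = "[j, j] @ replicate h k"
  have P: "real (prod_list ?ks) = real j ^ 2 * real k ^ h" by (simp add: power2_eq_square)
  have px: "\<rho> * real k ^ h = x" using kh by (simp add: \<rho>_def)
  have "real j ^ 2 * real k ^ h \<le> \<rho> * real k ^ h" using j2 by (intro mult_right_mono) auto
  then have "real (prod_list ?ks) \<le> x" unfolding P px .
  moreover have "\<rho> / 4 * real k ^ h \<le> real j ^ 2 * real k ^ h" using j4 by (intro mult_right_mono) auto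
  then have "x / 4 \<le> real (prod_list ?ks)" unfolding P using px by simp
  moreover have "(\<Sum>i\<leftarrow>?ks. 1 / real i) \<le> 2 / (sqrt k - 1) + ln x / (real k * ln k)" if "2 < sqrt k"
  proof -
    have "sqrt k \<le> sqrt \<rho>" using r1 by simp
    then have "sqrt k - 1 \<le> real j" using j by linarith
    then have "1 / real j \<le> 1 / (sqrt k - 1)" using that k by (intro frac_le) auto
    moreover have "real h / real k \<le> ln x / (real k * ln k)"
      using bound[OF h(1)] k by (simp add: field_simps)
    ultimately show ?thesis by (simp add: sum_list_replicate)
  qed
  moreover have "\<forall>i\<in>set ?ks. 1 \<le> i \<and> i \<le> k" using j(3) jk k by auto
  ultimately show ?thesis by blast
qed

lemma skeleton_exists:
  fixes C0 \<zeta> \<xi> :: real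
  assumes "0 < C0" "0 < \<zeta>" "0 < \<xi>"
  shows "\<forall>\<^sub>F n in sequentially. \<forall>M. real (2 ^ t0 + M) \<le> C0 * ln n \<longrightarrow>
    (\<exists>ks. real n / (4 * ln n) \<le> real (prod_list ks) \<and> real (sz (skel t0 M ks)) \<le> \<zeta> * n \<and>
       real (max_deg (skel t0 M ks)) \<le> (1 + \<xi>) * (ln n / ln 2))"
proof -
  \<comment> \<open>A bound on the sum of reciprocals that keeps the doubling parts below
    \<open>\<zeta> / 2 * n\<close>; the bottoms take the other half.\<close>
  obtain \<sigma>0 :: real where \<sigma>0: "0 < \<sigma>0" "\<sigma>0 \<le> 1" "2 * C0 * \<sigma>0 * exp 2 \<le> \<zeta> / 2"
  proof
    let ?a = "4 * C0 * exp (2::real)"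
    show "0 < min 1 (\<zeta> / ?a)" "min 1 (\<zeta> / ?a) \<le> 1" using assms by auto
    have "2 * C0 * min 1 (\<zeta> / ?a) * exp 2 \<le> 2 * C0 * (\<zeta> / ?a) * exp 2"
      using assms by (intro mult_right_mono mult_left_mono) auto
    also have "\<dots> = \<zeta> / 2" using assms by simp
    finally show "2 * C0 * min 1 (\<zeta> / ?a) * exp 2 \<le> \<zeta> / 2" .
  qed
  \<comment> \<open>The slack \<open>\<xi> * ln n / ln 2\<close> equals \<open>2 * a * ln n\<close>:
    half is for the branching number, half for the additive constants in the doubling
    exponent.\<close>
  define a where "a = \<xi> / (2 * ln 2)"
  have a: "0 < a" using assms by (simp add: a_def)
  have "\<forall>\<^sub>F n::nat in sequentially. 10 \<le> a * ln n" using a by real_asymp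
  moreover have "\<forall>\<^sub>F n::nat in sequentially. a * ln n \<le> n / ln n" by real_asymp
  \<comment> \<open>About \<open>ln n / ln (ln n)\<close> reciprocals of order
    \<open>1 / ln n\<close>, and two of order \<open>1 / sqrt (ln n)\<close>, sum to
    \<open>o(1)\<close>.\<close>
  moreover have "\<forall>\<^sub>F n::nat in sequentially. 2 / (sqrt (a * ln n - 1) - 1) + ln n / ((a * ln n - 1) * ln (a
    * ln n - 1)) < \<sigma>0"
  proof -
    have "((\<lambda>n::nat. 2 / (sqrt (a * ln n - 1) - 1) + ln n / ((a * ln n - 1) * ln (a * ln n - 1))) \<longlongrightarrow> 0)
      sequentially"
      using a by real_asymp
    then show ?thesis using \<sigma>0(1) by (rule order_tendstoD)
  qed
  moreover have "\<forall>\<^sub>F n::nat in sequentially. n / ln n * 2 ^ t0 \<le> \<zeta> / 2 * n"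
    using assms(2) by real_asymp
  moreover have "\<forall>\<^sub>F n::nat in sequentially. ln (2 * C0 * exp 2 * n) / ln 2 + 1 + a * ln n \<le>
    (1 + \<xi>) * (ln n / ln 2)"
  proof -
    define b where "b = ln (2 * C0 * exp 2) / ln 2 + 1"
    have "\<forall>\<^sub>F n::nat in sequentially. b \<le> a * ln n" using a by real_asymp
    moreover have "\<forall>\<^sub>F n::nat in sequentially. 0 < n" by (rule eventually_gt_at_top)
    ultimately show ?thesis
    proof eventually_elim
      case (elim n)
      have "ln (2 * C0 * exp 2 * n) = ln (2 * C0 * exp 2) + ln n" using assms elim(2) by (subst ln_mult) auto
      moreover have "(1 + \<xi>) * (ln n / ln 2) = ln n / ln 2 + 2 * (a * ln n)" by (simp add: a_def field_simps)
      ultimately show ?case using elim(1) by (simp add: b_def add_divide_distrib)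
    qed
  qed
  moreover have "\<forall>\<^sub>F n::nat in sequentially. real t0 \<le> (1 + \<xi>) * (ln n / ln 2)"
    using assms by real_asymp
  moreover have "\<forall>\<^sub>F n::nat in sequentially. 1 < ln n" by real_asymp
  moreover have "\<forall>\<^sub>F n::nat in sequentially. 1 \<le> 2 * C0 * exp 2 * n" using assms by real_asymp
  ultimately show ?thesis
  proof eventually_elim
    case (elim n)
    show ?case
    proof (intro allI impI)
      fix M assume M: "real (2 ^ t0 + M) \<le> C0 * ln n"
      define k where "k = nat \<lfloor>a * ln n\<rfloor>"
      define x where "x = n / ln n"
      have n0: "0 < real n" using elim(7) by (cases n) auto
      have k: "real k \<le> a * ln n" "a * ln n - 1 \<le> real k" using elim(1) by (auto simp: k_def)
      have k9: "9 \<le> real k" using k elim(1) by linarith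
      have sq: "2 < sqrt k" using k9 by (intro real_less_rsqrt) auto
      obtain ks where ks: "\<forall>i\<in>set ks. 1 \<le> i \<and> i \<le> k" "x / 4 \<le> real (prod_list ks)" "real (prod_list ks) \<le> x"
        "(\<Sum>i\<leftarrow>ks. 1 / real i) \<le> 2 / (sqrt k - 1) + ln x / (real k * ln k)"
        using branching_exists[of k x] k k9 elim(2) sq by (force simp: x_def)
      let ?s = "\<Sum>i\<leftarrow>ks. 1 / real i"
      have s0: "0 \<le> ?s" by (intro sum_list_nonneg) auto
      have y: "9 \<le> a * ln n - 1" using elim(1) by linarith
      have "ln x \<le> ln n" using elim(7) n0 by (simp add: x_def ln_div)
      then have "ln x / (real k * ln k) \<le> ln n / ((a * ln n - 1) * ln (a * ln n - 1))"
        using k y k9 elim(7) by (intro frac_le mult_mono) auto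
      moreover have "2 / (sqrt k - 1) \<le> 2 / (sqrt (a * ln n - 1) - 1)"
      proof (rule divide_left_mono)
        have "2 < sqrt (a * ln n - 1)" using y by (intro real_less_rsqrt) auto
        then have "0 < sqrt (a * ln n - 1) - 1" "0 < sqrt k - 1" using sq by linarith+
        then show "0 < (sqrt k - 1) * (sqrt (a * ln n - 1) - 1)" by (rule mult_pos_pos[rotated])
      qed (use k in auto)
      ultimately have s: "?s \<le> \<sigma>0" using ks(4) elim(3) by linarith
      have e: "exp (2 * ?s) \<le> exp 2" using s \<sigma>0 by simp
      have x0: "0 \<le> x" using n0 elim(7) by (simp add: x_def)
      have "real (sz (skel t0 M ks)) \<le> real (prod_list ks) * (2 ^ t0 + 2 * real (2 ^ t0 +
        M) * ?s * exp (2 * ?s))"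
        using ks(1) by (intro sz_skel_le) auto
      also have "\<dots> \<le> x * (2 ^ t0 + 2 * (C0 * ln n) * \<sigma>0 * exp 2)"
        using ks(3) M s s0 e x0 \<sigma>0 assms elim(7) by (intro mult_mono add_mono) auto
      also have "\<dots> = x * 2 ^ t0 + (2 * C0 * \<sigma>0 * exp 2) * n"
        using elim(7) by (simp add: x_def field_simps)
      also have "\<dots> \<le> \<zeta> / 2 * n + \<zeta> / 2 * n"
        using elim(4) \<sigma>0(3) n0 by (intro add_mono mult_right_mono) (auto simp: x_def)
      finally have S: "real (sz (skel t0 M ks)) \<le> \<zeta> * n" by simp
      have "real (skel_weight t0 M ks) \<le> real (prod_list ks) * real (2 ^ t0 + M) * exp (2 * ?s)"
        using ks(1) by (intro skel_weight_le) auto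
      also have "\<dots> \<le> x * (C0 * ln n) * exp 2"
        using ks(3) M e x0 assms elim(7) by (intro mult_mono) auto
      also have "\<dots> = C0 * exp 2 * n" using elim(7) by (simp add: x_def field_simps)
      finally have W: "real (2 * skel_weight t0 M ks) \<le> 2 * C0 * exp 2 * n" by simp
      define \<tau> where "\<tau> = nat \<lceil>ln (2 * C0 * exp 2 * n) / ln 2\<rceil>"
      have "0 \<le> ln (2 * C0 * exp 2 * n) / ln 2" using elim(8) by simp
      then have \<tau>: "ln (2 * C0 * exp 2 * n) / ln 2 \<le> real \<tau>" "real \<tau> \<le> ln (2 * C0 * exp 2 * n) / ln 2 + 1"
        unfolding \<tau>_def by linarith+
      have "ln (2 * C0 * exp 2 * n) \<le> real \<tau> * ln 2" using \<tau>(1) by (simp add: field_simps)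
      also have "\<dots> = ln (2 ^ \<tau>)" by (simp add: ln_realpow)
      finally have "ln (2 * C0 * exp 2 * n) \<le> ln (2 ^ \<tau>)" .
      moreover have "0 < 2 * C0 * exp 2 * n" "(0::real) < 2 ^ \<tau>" using elim(8) by (linarith, simp)
      ultimately have "2 * C0 * exp 2 * n \<le> 2 ^ \<tau>" by (simp only: ln_le_cancel_iff)
      then have "real (2 * skel_weight t0 M ks) \<le> real (2 ^ \<tau>)" using W by simp
      then have "2 * skel_weight t0 M ks \<le> 2 ^ \<tau>" unfolding of_nat_le_iff .
      then have "max_deg (skel t0 M ks) \<le> max t0 (\<tau> + k)"
        using ks(1) by (intro max_deg_skel_le) auto
      then have "real (max_deg (skel t0 M ks)) \<le> max (real t0) (real \<tau> + real k)" by linarith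
      also have "\<dots> \<le> (1 + \<xi>) * (ln n / ln 2)" using \<tau>(2) k(1) elim(5,6) by linarith
      finally have "real (max_deg (skel t0 M ks)) \<le> (1 + \<xi>) * (ln n / ln 2)" .
      then show "\<exists>ks. real n / (4 * ln n) \<le> real (prod_list ks) \<and> real (sz (skel t0 M ks)) \<le> \<zeta> * n \<and>
          real (max_deg (skel t0 M ks)) \<le> (1 + \<xi>) * (ln n / ln 2)"
        using S ks(2) by (intro exI[of _ ks]) (simp add: x_def)
    qed
  qed
qed

section \<open>Typical properties of the random graph\<close>

definition cross :: "'a set \<Rightarrow> 'a set \<Rightarrow> 'a set set" where
  "cross X Y = (\<lambda>(x, y). {x, y}) ` (X \<times> Y)"

lemma inj_on_cross: "X \<inter> Y = {} \<Longrightarrow> inj_on (\<lambda>(x, y). {x, y}) (X \<times> Y)"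
  by (auto simp: inj_on_def doubleton_eq_iff)

lemma card_cross: "X \<inter> Y = {} \<Longrightarrow> card (cross X Y) = card X * card Y"
  unfolding cross_def by (simp add: card_image inj_on_cross card_cartesian_product)

lemma cross_subset: "X \<subseteq> V \<Longrightarrow> Y \<subseteq> V \<Longrightarrow> X \<inter> Y = {} \<Longrightarrow> cross X Y \<subseteq> all_edges V"
  by (auto simp: cross_def all_edges_def card_insert_if)

lemma finite_all_edges [simp]: "finite V \<Longrightarrow> finite (all_edges V)"
  by (simp add: all_edges_def)

lemma all_edges_mono: "X \<subseteq> V \<Longrightarrow> all_edges X \<subseteq> all_edges V"
  by (auto simp: all_edges_def)

lemma sum_nbr_cross:
  assumes "finite X" "finite Y" "X \<inter> Y = {}"
  shows "(\<Sum>x\<in>X. card (nbr E x \<inter> Y)) = card (E \<inter> cross X Y)"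
proof -
  have "(\<Sum>x\<in>X. card (nbr E x \<inter> Y)) = card (SIGMA x:X. nbr E x \<inter> Y)"
    using assms by (simp add: card_SigmaI)
  also have "\<dots> = card ((\<lambda>(x, y). {x, y}) ` (SIGMA x:X. nbr E x \<inter> Y))"
    using inj_on_cross[OF assms(3)] by (intro card_image[symmetric]) (auto intro: inj_on_subset)
  also have "(\<lambda>(x, y). {x, y}) ` (SIGMA x:X. nbr E x \<inter> Y) = E \<inter> cross X Y"
    by (auto simp: cross_def nbr_def)
  finally show ?thesis .
qed

lemma card_nbr_cross:
  "finite Y \<Longrightarrow> x \<notin> Y \<Longrightarrow> card (nbr E x \<inter> Y) = card (E \<inter> cross {x} Y)"
  using sum_nbr_cross[of "{x}" Y E] by simp

lemma sum_nbr_inside: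
  assumes "finite X" "E \<subseteq> all_edges V"
  shows "(\<Sum>x\<in>X. card (nbr E x \<inter> X)) \<le> 2 * card (E \<inter> all_edges X)"
proof -
  let ?F = "E \<inter> all_edges X"
  have fF: "finite ?F" using assms by simp
  have "card (nbr E x \<inter> X) \<le> card {e \<in> ?F. x \<in> e}" if x: "x \<in> X" for x
  proof (rule card_inj_on_le)
    show "inj_on (\<lambda>y. {x, y}) (nbr E x \<inter> X)" by (auto simp: inj_on_def doubleton_eq_iff)
    show "(\<lambda>y. {x, y}) ` (nbr E x \<inter> X) \<subseteq> {e \<in> ?F. x \<in> e}"
      using x assms(2) by (auto simp: nbr_def all_edges_def)
    show "finite {e \<in> ?F. x \<in> e}" by (rule finite_subset[OF _ fF]) auto
  qed
  then have "(\<Sum>x\<in>X. card (nbr E x \<inter> X)) \<le> (\<Sum>x\<in>X. card {e \<in> ?F. x \<in> e})" by (rule sum_mono)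
  also have "\<dots> = (\<Sum>x\<in>X. \<Sum>e\<in>?F. if x \<in> e then 1 else 0)"
    using fF by (intro sum.cong) (auto simp: sum.If_cases Int_def)
  also have "\<dots> = (\<Sum>e\<in>?F. \<Sum>x\<in>X. if x \<in> e then 1 else 0)" by (rule sum.swap)
  also have "\<dots> = (\<Sum>e\<in>?F. 2)"
  proof (rule sum.cong)
    fix e assume e: "e \<in> ?F"
    then have "X \<inter> e = e" "card e = 2" by (auto simp: all_edges_def)
    then show "(\<Sum>x\<in>X. if x \<in> e then 1 else 0) = (2::nat)"
      using assms(1) by (simp add: sum.If_cases)
  qed simp
  finally show ?thesis by simp
qed

lemma card_all_edges_le: "finite X \<Longrightarrow> card (all_edges X) \<le> card X * card X"
proof -
  assume X: "finite X"
  have "all_edges X \<subseteq> (\<lambda>(x, y). {x, y}) ` (X \<times> X)"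
  proof
    fix e assume "e \<in> all_edges X"
    then obtain x y where "e = {x, y}" "x \<in> X" "y \<in> X" by (auto simp: all_edges_def card_2_iff)
    then show "e \<in> (\<lambda>(x, y). {x, y}) ` (X \<times> X)" by auto
  qed
  then have "card (all_edges X) \<le> card (X \<times> X)" using X by (intro surj_card_le) auto
  then show ?thesis by (simp add: card_cartesian_product)
qed

section \<open>Weighted sums over families of subsets\<close>

lemma sum_pow_card_Pow:
  fixes x :: real
  assumes "finite A"
  shows "(\<Sum>X\<in>Pow A. x ^ card X) = (1 + x) ^ card A"
  using assms
proof (induction A rule: finite_induct)
  case (insert a A)
  have "(\<Sum>X\<in>Pow (insert a A). x ^ card X) = (\<Sum>X\<in>Pow A. x ^ card X) + (\<Sum>X\<in>insert a ` Pow A. x ^ card X)"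
    unfolding Pow_insert using insert.hyps by (intro sum.union_disjoint) auto
  also have "(\<Sum>X\<in>insert a ` Pow A. x ^ card X) = (\<Sum>X\<in>Pow A. x ^ card (insert a X))"
    using insert.hyps by (subst sum.reindex) (auto simp: inj_on_def)
  also have "\<dots> = (\<Sum>X\<in>Pow A. x * x ^ card X)"
    using insert.hyps by (intro sum.cong) (auto simp: finite_subset card_insert_if)
  finally show ?case using insert by (simp add: sum_distrib_left[symmetric] algebra_simps)
qed simp

text \<open>For union bounds over all sets at once: if a set of size \<open>s\<close> fails with
  probability at most \<open>x ^ s\<close>, the nonempty ones contribute at most
  \<open>exp (n * x) - 1\<close>, which vanishes when \<open>n * x\<close> does.\<close>

lemma sum_pow_card_le_exp:
  fixes x :: real
  assumes "finite A" "0 \<le> x"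
  shows "(\<Sum>X\<in>Pow A. x ^ card X) \<le> exp (real (card A) * x)"
    and "(\<Sum>X\<in>Pow A - {{}}. x ^ card X) \<le> exp (real (card A) * x) - 1"
proof -
  have "(1 + x) ^ card A \<le> exp x ^ card A" using assms by (intro power_mono exp_ge_add_one_self) auto
  then show 1: "(\<Sum>X\<in>Pow A. x ^ card X) \<le> exp (real (card A) * x)"
    using assms by (simp add: sum_pow_card_Pow exp_of_nat_mult)
  have "(\<Sum>X\<in>Pow A. x ^ card X) = 1 + (\<Sum>X\<in>Pow A - {{}}. x ^ card X)"
    using assms by (subst sum.remove[of _ "{}"]) auto
  then show "(\<Sum>X\<in>Pow A - {{}}. x ^ card X) \<le> exp (real (card A) * x) - 1" using 1 by simp
qed

text \<open>Each counted set has \<open>w powr (card X - k) \<ge> 1\<close>. The choice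
  \<open>w = k / card A\<close> gives the familiar bound
  \<open>(exp 1 * card A / k) powr k\<close>.\<close>

lemma card_small_subsets_le:
  fixes w k :: real
  assumes "finite A" "0 < w" "w \<le> 1"
  shows "real (card {X \<in> Pow A. real (card X) \<le> k}) \<le> w powr (-k) * exp (real (card A) * w)"
proof -
  have "real (card {X \<in> Pow A. real (card X) \<le> k}) = (\<Sum>X\<in>{X \<in> Pow A. real (card X) \<le> k}. 1)" by simp
  also have "\<dots> \<le> (\<Sum>X\<in>{X \<in> Pow A. real (card X) \<le> k}. w powr (-k) * w ^ card X)"
  proof (rule sum_mono)
    fix X assume "X \<in> {X \<in> Pow A. real (card X) \<le> k}"
    then have "w powr k \<le> w powr real (card X)" using assms by (intro powr_mono') auto
    then show "1 \<le> w powr (-k) * w ^ card X"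
      using assms by (simp add: powr_minus powr_realpow field_simps)
  qed
  also have "\<dots> \<le> (\<Sum>X\<in>Pow A. w powr (-k) * w ^ card X)"
    using assms by (intro sum_mono2) auto
  also have "\<dots> = w powr (-k) * (\<Sum>X\<in>Pow A. w ^ card X)" by (rule sum_distrib_left[symmetric])
  also have "\<dots> \<le> w powr (-k) * exp (real (card A) * w)"
    using sum_pow_card_le_exp(1)[OF assms(1), of w] assms by (intro mult_left_mono) auto
  finally show ?thesis .
qed

text \<open>For small \<open>n\<close> this may exceed 1; only large \<open>n\<close> matter below.\<close>

abbreviation edge_prob :: "real \<Rightarrow> nat \<Rightarrow> real" where
  "edge_prob c n \<equiv> c * ln (real n) / real n"

abbreviation gnp :: "real \<Rightarrow> nat \<Rightarrow> nat set set pmf" where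
  "gnp c n \<equiv> random_subset (all_edges {1..n}) (edge_prob c n)"

section \<open>Events that hold with high probability\<close>

definition whp :: "real \<Rightarrow> (nat \<Rightarrow> nat set set \<Rightarrow> bool) \<Rightarrow> bool" where
  "whp c P \<longleftrightarrow> (\<lambda>n. prob (gnp c n) {E. \<not> P n E}) \<longlonglongrightarrow> 0"

lemma whpI:
  assumes "\<forall>\<^sub>F n in sequentially. prob (gnp c n) {E. \<not> P n E} \<le> b n" "b \<longlonglongrightarrow> 0"
  shows "whp c P"
  unfolding whp_def
  by (rule tendsto_sandwich[OF _ assms(1) tendsto_const assms(2)]) simp

lemma whp_conj: "whp c P \<Longrightarrow> whp c Q \<Longrightarrow> whp c (\<lambda>n E. P n E \<and> Q n E)"
proof (rule whpI)
  assume "whp c P" "whp c Q"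
  then show "(\<lambda>n. prob (gnp c n) {E. \<not> P n E} + prob (gnp c n) {E. \<not> Q n E}) \<longlonglongrightarrow> 0"
    unfolding whp_def using tendsto_add by fastforce
  show "\<forall>\<^sub>F n in sequentially. prob (gnp c n) {E. \<not> (P n E \<and> Q n E)} \<le>
    prob (gnp c n) {E. \<not> P n E} + prob (gnp c n) {E. \<not> Q n E}"
  proof (rule always_eventually, rule allI)
    fix n
    have "{E. \<not> (P n E \<and> Q n E)} = {E. \<not> P n E} \<union> {E. \<not> Q n E}" by auto
    then show "prob (gnp c n) {E. \<not> (P n E \<and> Q n E)} \<le>
      prob (gnp c n) {E. \<not> P n E} + prob (gnp c n) {E. \<not> Q n E}"
      by (simp add: measure_Un_le)
  qed
qed

lemma whp_mono:
  assumes "whp c P" "\<forall>\<^sub>F n in sequentially. \<forall>E\<subseteq>all_edges {1..n}. P n E \<longrightarrow> Q n E"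
  shows "whp c Q"
proof (rule whpI)
  show "(\<lambda>n. prob (gnp c n) {E. \<not> P n E}) \<longlonglongrightarrow> 0" using assms(1) by (simp add: whp_def)
  show "\<forall>\<^sub>F n in sequentially. prob (gnp c n) {E. \<not> Q n E} \<le> prob (gnp c n) {E. \<not> P n E}"
    using assms(2)
  proof eventually_elim
    case (elim n)
    show ?case
      using elim set_random_subset[of "all_edges {1..n}" "edge_prob c n"]
      by (intro measure_pmf.finite_measure_mono_AE) (auto simp: AE_measure_pmf_iff)
  qed
qed

text \<open>Read backwards, a set \<open>X\<close> that sends at least \<open>h\<close> edges per
  vertex to the outside has more than \<open>A * card X\<close> neighbours there.\<close>

abbreviation expanding :: "'a set set \<Rightarrow> 'a set \<Rightarrow> real \<Rightarrow> nat \<Rightarrow> real \<Rightarrow> bool" where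
  "expanding E V k A h \<equiv> \<forall>X\<subseteq>V. \<forall>Y\<subseteq>V. X \<inter> Y = {} \<longrightarrow> X \<noteq> {} \<longrightarrow> real (card X) \<le> k \<longrightarrow>
    card Y \<le> A * card X \<longrightarrow> real (\<Sum>x\<in>X. card (nbr E x \<inter> Y)) < h * real (card X)"

abbreviation joined :: "'a set set \<Rightarrow> 'a set \<Rightarrow> real \<Rightarrow> real \<Rightarrow> bool" where
  "joined E V k l \<equiv> \<forall>X\<subseteq>V. \<forall>Y\<subseteq>V. X \<inter> Y = {} \<longrightarrow> k \<le> real (card X) \<longrightarrow> l \<le> real (card Y) \<longrightarrow>
    (\<exists>x\<in>X. \<exists>y\<in>Y. {x, y} \<in> E)"

abbreviation covers :: "'a set set \<Rightarrow> 'a set \<Rightarrow> 'a set \<Rightarrow> real \<Rightarrow> real \<Rightarrow> bool" where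
  "covers E V Z s g \<equiv> \<forall>S\<subseteq>V. s \<le> real (card S) \<longrightarrow> g \<le> real (card (Z \<inter> (\<Union>x\<in>S. nbr E x)))"

lemma edge_prob_bounds:
  assumes "0 < c"
  shows "\<forall>\<^sub>F n in sequentially. 1 \<le> n \<and> 1 \<le> ln (real n) \<and> 0 \<le> edge_prob c n \<and> edge_prob c n \<le> 1"
proof -
  have "\<forall>\<^sub>F n::nat in sequentially. 1 \<le> ln n" by real_asymp
  moreover have "\<forall>\<^sub>F n::nat in sequentially. 0 \<le> c * ln n / n" using assms by real_asymp
  moreover have "\<forall>\<^sub>F n::nat in sequentially. c * ln n / n \<le> 1" using assms by real_asymp
  moreover have "\<forall>\<^sub>F n::nat in sequentially. 1 \<le> n" by (rule eventually_ge_at_top)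
  ultimately show ?thesis by eventually_elim auto
qed

text \<open>As \<open>n * exp (- 3 * ln n)\<close> is \<open>1 / n ^ 2\<close>, the failure
  probabilities of all sets add up to at most \<open>exp (1 / n ^ 2) - 1\<close>.\<close>

lemma whp_Ball_sets:
  assumes "\<forall>\<^sub>F n in sequentially. \<forall>X\<in>Pow {1..n} - {{}}.
    prob (gnp c n) {E. R n X E} \<le> exp (- 3 * ln (real n)) ^ card X"
  shows "whp c (\<lambda>n E. \<forall>X\<in>Pow {1..n} - {{}}. \<not> R n X E)"
proof (rule whpI)
  show "(\<lambda>n. exp (real n * exp (- 3 * ln (real n))) - 1) \<longlonglongrightarrow> 0" by real_asymp
  show "\<forall>\<^sub>F n in sequentially. prob (gnp c n) {E. \<not> (\<forall>X\<in>Pow {1..n} - {{}}. \<not> R n X E)}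
    \<le> exp (real n * exp (- 3 * ln (real n))) - 1"
    using assms
  proof eventually_elim
    case (elim n)
    have "prob (gnp c n) {E. \<not> (\<forall>X\<in>Pow {1..n} - {{}}. \<not> R n X E)}
      \<le> (\<Sum>X\<in>Pow {1..n} - {{}}. exp (- 3 * ln (real n)) ^ card X)"
      using elim by (intro prob_UN_le[where R = "R n"]) auto
    also have "\<dots> \<le> exp (real n * exp (- 3 * ln (real n))) - 1"
      using sum_pow_card_le_exp(2)[of "{1..n}" "exp (- 3 * ln (real n))"] by simp
    finally show ?case .
  qed
qed

lemma whp_sparse:
  assumes c: "0 < c" and \<eta>: "0 < \<eta>"
  shows "\<exists>\<theta>::real. 0 < \<theta> \<and> whp c (\<lambda>n E. sparse E {1..n} (\<eta> * ln n) (\<theta> * n))"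
proof -
  \<comment> \<open>For sets of size \<open>s\<close> and
    \<open>\<rho> = n / s \<ge> 1 / \<theta>\<close>, the exponential factor of the tail bound is at
    most \<open>exp (c * s * ln n)\<close>. This \<open>\<theta>\<close> makes the other factor at
    most \<open>exp (- (c + 3) * s * ln n)\<close>.\<close>
  define \<theta> where "\<theta> = exp (- 2 * (c + 3) / \<eta>)"
  have \<theta>: "0 < \<theta>" "\<theta> \<le> 1" using c \<eta> by (auto simp: \<theta>_def divide_nonpos_pos)
  let ?R = "\<lambda>(n::nat) (X::nat set) E. real (card X) \<le> \<theta> * n \<and> \<eta> * ln n * real (card X) <
    real (\<Sum>x\<in>X. card (nbr E x \<inter> X))"
  have "whp c (\<lambda>n E. \<forall>X\<in>Pow {1..n} - {{}}. \<not> ?R n X E)"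
  proof (rule whp_Ball_sets)
    show "\<forall>\<^sub>F n in sequentially. \<forall>X\<in>Pow {1..n} - {{}}.
      prob (gnp c n) {E. ?R n X E} \<le> exp (- 3 * ln (real n)) ^ card X"
      using edge_prob_bounds[OF c]
    proof eventually_elim
      case (elim n)
      show ?case
      proof
        fix X assume X: "X \<in> Pow {1..n} - {{}}"
        let ?s = "real (card X)"
        have fX: "finite X" using X finite_subset by blast
        have s0: "0 < ?s" using X fX by (auto simp: card_gt_0_iff)
        show "prob (gnp c n) {E. ?R n X E} \<le> exp (- 3 * ln (real n)) ^ card X"
        proof (cases "?s \<le> \<theta> * n")
          case small: True
          let ?\<rho> = "real n / ?s"
          have \<rho>: "1 / \<theta> \<le> ?\<rho>" "1 \<le> ?\<rho>" using small s0 \<theta> by (auto simp: field_simps)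
             (use mult_right_mono[of \<theta> 1 "real n"] in linarith)
          let ?a = "\<eta> * ln n * ?s / 2"
          have "prob (gnp c n) {E. ?R n X E} \<le> prob (gnp c n) {E. ?a \<le> real (card (E \<inter> all_edges X))}"
          proof (rule measure_pmf.finite_measure_mono_AE)
            show "AE E in gnp c n. E \<in> {E. ?R n X E} \<longrightarrow> E \<in> {E. ?a \<le> real (card (E \<inter> all_edges X))}"
            proof (rule AE_pmfI)
              fix E assume "E \<in> set_pmf (gnp c n)"
              then have "E \<subseteq> all_edges {1..n}" using set_random_subset by blast
              from sum_nbr_inside[OF fX this]
              have "real (\<Sum>x\<in>X. card (nbr E x \<inter> X)) \<le> 2 * real (card (E \<inter> all_edges X))" by linarith
              then show "E \<in> {E. ?R n X E} \<longrightarrow> E \<in> {E. ?a \<le> real (card (E \<inter> all_edges X))}" by auto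
            qed
          qed simp
          also have "\<dots> \<le> ?\<rho> powr (- ?a) * exp ((?\<rho> - 1) * edge_prob c n * real (card (all_edges X)))"
            using X elim \<rho> by (intro upper_tail all_edges_mono) auto
          also have "\<dots> \<le> (1 / \<theta>) powr (- ?a) * exp (c * ln n * ?s)"
          proof (rule mult_mono)
            show "?\<rho> powr (- ?a) \<le> (1 / \<theta>) powr (- ?a)"
              using \<rho> \<theta> \<eta> elim by (intro powr_mono2') auto
            have "(?\<rho> - 1) * edge_prob c n * real (card (all_edges X)) \<le> ?\<rho> * edge_prob c n * (?s * ?s)"
              using card_all_edges_le[OF fX] elim \<rho> c by (intro mult_mono mult_nonneg_nonneg) (auto simp
                flip: of_nat_mult)
            also have "\<dots> = c * ln n * ?s" using s0 elim by (simp add: field_simps)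
            finally show "exp ((?\<rho> - 1) * edge_prob c n * real (card (all_edges X))) \<le> exp (c * ln n * ?s)"
              by simp
          qed auto
          also have "\<dots> = exp (- 3 * ln n * ?s)"
            using \<eta> \<theta> by (simp add: \<theta>_def powr_def exp_add[symmetric] ln_div exp_minus[symmetric] field_simps)
          also have "\<dots> = exp (- 3 * ln (real n)) ^ card X"
            using exp_of_nat_mult[of "card X" "- 3 * ln (real n)"] by (simp add: mult.commute)
          finally show ?thesis .
        qed (simp add: not_le)
      qed
    qed
  qed
  then have "whp c (\<lambda>n E. sparse E {1..n} (\<eta> * ln n) (\<theta> * n))"
  proof (rule whp_mono)
    show "\<forall>\<^sub>F n in sequentially. \<forall>E\<subseteq>all_edges {1..n}. (\<forall>X\<in>Pow {1..n} - {{}}. \<not> ?R n X E) \<longrightarrow>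
      sparse E {1..n} (\<eta> * ln n) (\<theta> * n)"
    proof (intro always_eventually allI impI)
      fix n E assume *: "\<forall>X\<in>Pow {1..n} - {{}}. \<not> ?R n X E"
      show "sparse E {1..n} (\<eta> * ln n) (\<theta> * n)"
        unfolding sparse_def
      proof (intro allI impI)
        fix X assume "X \<subseteq> {1..n}" "real (card X) \<le> \<theta> * n"
        then show "real (\<Sum>x\<in>X. card (nbr E x \<inter> X)) \<le> \<eta> * ln n * real (card X)"
          using *[rule_format, of X] by (cases "X = {}") auto
      qed
    qed
  qed
  then show ?thesis using \<theta>(1) by (intro exI[of _ \<theta>] conjI)
qed

text \<open>For \<open>s = card X\<close>, choosing \<open>Y\<close> costs roughly
  \<open>(1 / (s * p)) ^ (A * s)\<close>, while the edges gain \<open>(s * p) ^ (h * s)\<close>. The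
  excess \<open>\<eta>\<close> of \<open>h\<close> over \<open>A\<close> leaves a positive power of
  \<open>s * p\<close>, which is at most \<open>\<kappa> * c\<close>.\<close>

lemma whp_sparse_pairs:
  assumes c: "1 \<le> c" and \<eta>: "0 < \<eta>"
  shows "\<exists>\<kappa>::real. 0 < \<kappa> \<and> (\<forall>A h. (\<forall>\<^sub>F n in sequentially. ln (real n) \<le> real (A n) \<and> real (A n) \<le>
    c * ln (real n) \<and> (1 + \<eta>) * real (A n) \<le> h n) \<longrightarrow>
    whp c (\<lambda>n E. expanding E {1..n} (\<kappa> * (n / ln n)) (A n) (h n)))"
proof -
  \<comment> \<open>Chosen so that \<open>\<eta> * ln (\<kappa> * c) = - (5 + ln c)\<close>. Per
    unit of \<open>A * s\<close> this pays 2 for two exponential factors, \<open>ln c\<close> for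
    comparing \<open>w\<close> below with \<open>s * p\<close>, and 3 for the target bound.\<close>
  define \<kappa> where "\<kappa> = (1 / c) * exp (- (5 + ln c) / \<eta>)"
  have "0 \<le> ln c" using c by simp
  then have "- (5 + ln c) / \<eta> \<le> 0" using \<eta> by (intro divide_nonpos_pos) linarith+
  then have \<kappa>: "0 < \<kappa>" "\<kappa> * c \<le> 1" using c by (simp_all add: \<kappa>_def)
  have ln\<kappa>: "\<eta> * ln (\<kappa> * c) = - (5 + ln c)" using c \<eta> by (simp add: \<kappa>_def ln_mult)
  have main: "whp c (\<lambda>n E. expanding E {1..n} (\<kappa> * (n / ln n)) (A n) (h n))"
    if Ah: "\<forall>\<^sub>F n in sequentially. ln (real n) \<le> real (A n) \<and> real (A n) \<le> c * ln (real n) \<and>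
      (1 + \<eta>) * real (A n) \<le> h n"
    for A :: "nat \<Rightarrow> nat" and h
  proof -
    let ?R = "\<lambda>(n::nat) (X::nat set) E. real (card X) \<le> \<kappa> * (n / ln n) \<and> (\<exists>Y\<subseteq>{1..n}. X \<inter> Y = {} \<and>
      card Y \<le> A n * card X \<and>
      h n * real (card X) \<le> real (\<Sum>x\<in>X. card (nbr E x \<inter> Y)))"
    have c0: "0 < c" using c by simp
    have "whp c (\<lambda>n E. \<forall>X\<in>Pow {1..n} - {{}}. \<not> ?R n X E)"
    proof (rule whp_Ball_sets)
      show "\<forall>\<^sub>F n in sequentially. \<forall>X\<in>Pow {1..n} - {{}}.
        prob (gnp c n) {E. ?R n X E} \<le> exp (- 3 * ln (real n)) ^ card X"
        using edge_prob_bounds[OF c0] Ah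
      proof eventually_elim
        case (elim n)
        let ?p = "edge_prob c n"
        have p0: "0 < ?p" using elim c by auto
        show ?case
        proof
          fix X assume X: "X \<in> Pow {1..n} - {{}}"
          let ?s = "real (card X)" and ?a = "real (A n)"
          have fX: "finite X" using X finite_subset by blast
          have s1: "1 \<le> ?s" using X fX by (auto simp: Suc_le_eq card_gt_0_iff)
          have a0: "0 < ?a" using elim by linarith
          have L: "0 < ln (real n)" "0 < real n" using elim by linarith+
          show "prob (gnp c n) {E. ?R n X E} \<le> exp (- 3 * ln (real n)) ^ card X"
          proof (cases "?s \<le> \<kappa> * (n / ln n)")
            case small: True
            let ?I = "{Y \<in> Pow {1..n}. real (card Y) \<le> ?a * ?s}"
            have sp: "?s * ?p \<le> \<kappa> * c"
            proof -
              have "?s * ?p \<le> (\<kappa> * (n / ln n)) * ?p" using small p0 by (intro mult_right_mono) auto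
              also have "\<dots> = \<kappa> * c" using L by (simp add: field_simps)
              finally show ?thesis .
            qed
            have sp1: "?s * ?p \<le> 1" using sp \<kappa> by linarith
            have sp2: "0 < ?s * ?p" using s1 p0 by (intro mult_pos_pos) auto
            let ?\<rho> = "1 / (?s * ?p)"
            have \<rho>: "1 \<le> ?\<rho>" using sp1 sp2 by (simp only: le_divide_eq if_True simp_thms)
            let ?b = "?\<rho> powr (- (h n * ?s)) * exp (?a * ?s)"
            have each: "prob (gnp c n) {E. X \<inter> Y = {} \<and> h n * ?s \<le> real (\<Sum>x\<in>X. card (nbr E x \<inter> Y))} \<le> ?b"
              if Y: "Y \<in> ?I" for Y
            proof (cases "X \<inter> Y = {}")
              case True
              have fY: "finite Y" using Y finite_subset by blast
              have "prob (gnp c n) {E. X \<inter> Y = {} \<and> h n * ?s \<le> real (\<Sum>x\<in>X. card (nbr E x \<inter> Y))}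
                = prob (gnp c n) {E. h n * ?s \<le> real (card (E \<inter> cross X Y))}"
                using True by (simp only: sum_nbr_cross[OF fX fY True] simp_thms)
              also have "\<dots> \<le> ?\<rho> powr (- (h n * ?s)) * exp ((?\<rho> - 1) * ?p * real (card (cross X Y)))"
                using X Y elim \<rho> True by (intro upper_tail cross_subset) auto
              also have "\<dots> \<le> ?b"
              proof (intro mult_left_mono)
                have "(?\<rho> - 1) * ?p * real (card (cross X Y)) \<le> ?\<rho> * ?p * (?s * (?a * ?s))"
                  unfolding card_cross[OF True] of_nat_mult using Y p0 \<rho> by (intro mult_mono) auto
                also have "\<dots> = ?a * ?s"
                proof -
                  have "1 / (s * q) * q * (s * (a * s)) = a * s" if "0 < s" "0 < q" for s q a :: real
                    using that by simp
                  then show ?thesis using p0 s1 by (metis less_le_trans zero_less_one)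
                qed
                finally show "exp ((?\<rho> - 1) * ?p * real (card (cross X Y))) \<le> exp (?a * ?s)" by simp
              qed simp
              finally show ?thesis .
            qed (simp add: zero_le_mult_iff)
            have "prob (gnp c n) {E. ?R n X E} \<le> (\<Sum>Y\<in>?I. ?b)"
            proof (rule prob_UN_le[where R = "\<lambda>Y E. X \<inter> Y = {} \<and> h n * ?s \<le> real (\<Sum>x\<in>X. card (nbr E x \<inter> Y))"])
              fix E assume "?R n X E"
              then obtain Y where Y: "Y \<subseteq> {1..n}" "X \<inter> Y = {}" "card Y \<le> A n * card X"
                "h n * ?s \<le> real (\<Sum>x\<in>X. card (nbr E x \<inter> Y))" by blast
              have "real (card Y) \<le> ?a * ?s" using of_nat_mono[OF Y(3), where ?'a = real] by simp
              then show "\<exists>Y\<in>?I. X \<inter> Y = {} \<and> h n * ?s \<le> real (\<Sum>x\<in>X. card (nbr E x \<inter> Y))" using Y by blast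
            qed (use each in auto)
            also have "\<dots> = real (card ?I) * ?b" by simp
            also have "\<dots> \<le> exp (- 3 * ln n * ?s)"
            proof -
              define w where "w = ?a * ?s / n"
              have "?a * ?s \<le> (c * ln n) * (\<kappa> * (n / ln n))" using small elim a0 by (intro mult_mono) auto
              also have "\<dots> = \<kappa> * c * n" using L by (simp add: field_simps)
              also have "\<dots> \<le> 1 * real n" using \<kappa> by (intro mult_right_mono) auto
              finally have w: "0 < w" "w \<le> 1" using a0 s1 elim by (auto simp: w_def)
              have "real (card ?I) \<le> w powr (- (?a * ?s)) * exp (real n * w)"
                using card_small_subsets_le[of "{1..n}" w "?a * ?s"] w by simp
              also have "real n * w = ?a * ?s" using elim by (simp add: w_def)
              finally have "real (card ?I) * ?b \<le> w powr (- (?a * ?s)) * exp (?a * ?s) * ?b"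
                by (intro mult_right_mono) auto
              also have "\<dots> = exp (- (?a * ?s) * ln w + 2 * (?a * ?s) + h n * ?s * ln (?s * ?p))"
              proof -
                have "(1 / q) powr (- y) = exp (y * ln q)" if "0 < q" for q y :: real
                  using that by (simp add: powr_def ln_div)
                note q = this[OF sp2]
                have "w powr (- (?a * ?s)) = exp (- (?a * ?s) * ln w)" using w(1) by (simp add: powr_def)
                then show ?thesis unfolding q by (simp add: exp_add[symmetric] algebra_simps)
              qed
              also have "\<dots> \<le> exp (- 3 * ln n * ?s)"
              proof -
                have "w = ?s * ?p * (?a / (c * ln n))" using L c by (simp add: w_def field_simps)
                moreover have "0 < ?a / (c * ln n)" using a0 L c by (intro divide_pos_pos mult_pos_pos) auto
                ultimately have "ln w = ln (?s * ?p) + ln (?a / (c * ln n))"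
                  by (simp only: ln_mult_pos[OF sp2])
                moreover have "- ln c \<le> ln (?a / (c * ln n))"
                proof -
                  have "1 / c \<le> ?a / (c * ln n)" using elim L c by (simp add: field_simps)
                  then have "ln (1 / c) \<le> ln (?a / (c * ln n))" using c less_le_trans[of 0 "1 / c"]
                    by (subst ln_le_cancel_iff) auto
                  then show ?thesis using c by (simp add: ln_div)
                qed
                ultimately have "ln (?s * ?p) - ln c \<le> ln w" by simp
                then have 1: "- (?a * ?s) * ln w \<le> - (?a * ?s) * (ln (?s * ?p) - ln c)"
                  using a0 s1 by (intro mult_left_mono_neg) auto
                have kc: "0 < \<kappa> * c" using sp sp2 by linarith
                have l0: "ln (?s * ?p) \<le> ln (\<kappa> * c)" "ln (\<kappa> * c) \<le> 0"
                  using sp sp2 kc \<kappa>(2) by (simp_all only: ln_le_cancel_iff ln_le_zero_iff)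
                have "(1 + \<eta>) * ?a * ?s \<le> h n * ?s" using elim s1 by (intro mult_right_mono) auto
                then have "\<eta> * (?a * ?s) \<le> h n * ?s - ?a * ?s" by (simp add: algebra_simps)
                then have "(h n * ?s - ?a * ?s) * ln (?s * ?p) \<le> \<eta> * (?a * ?s) * ln (?s * ?p)"
                  using l0 by (intro mult_right_mono_neg) auto
                also have "\<dots> \<le> \<eta> * (?a * ?s) * ln (\<kappa> * c)"
                  using l0 \<eta> a0 s1 by (intro mult_left_mono) auto
                also have "\<dots> = (?a * ?s) * (\<eta> * ln (\<kappa> * c))" by simp
                also have "\<dots> = - (?a * ?s) * (5 + ln c)" unfolding ln\<kappa> by (simp add: algebra_simps)
                finally have "- (?a * ?s) * ln w + 2 * (?a * ?s) + h n * ?s * ln (?s * ?p) \<le> - 3 * (?a * ?s)"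
                  using 1 by (simp add: algebra_simps)
                also have "\<dots> \<le> - 3 * (ln n * ?s)" using elim s1
                  by (intro mult_left_mono_neg mult_right_mono) auto
                finally show ?thesis by (simp add: mult.assoc)
              qed
              finally show ?thesis .
            qed
            also have "\<dots> = exp (- 3 * ln (real n)) ^ card X"
              using exp_of_nat_mult[of "card X" "- 3 * ln (real n)"] by (simp add: mult.commute)
            finally show ?thesis .
          qed (simp add: not_le)
        qed
      qed
    qed
    then show ?thesis
    proof (rule whp_mono)
      show "\<forall>\<^sub>F n in sequentially. \<forall>E\<subseteq>all_edges {1..n}. (\<forall>X\<in>Pow {1..n} - {{}}. \<not> ?R n X E) \<longrightarrow>
        (expanding E {1..n} (\<kappa> * (n / ln n)) (A n) (h n))"
        by (intro always_eventually allI impI) (metis (no_types, lifting) Diff_iff Pow_iff not_le singletonD)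
    qed
  qed
  then show ?thesis using \<kappa>(1) by (intro exI[of _ \<kappa>] conjI allI impI) auto
qed

text \<open>Edges \<open>X0\<close> seen before can only increase the degree. The \<open>- 1\<close>
  accounts for \<open>x\<close> itself when it belongs to \<open>S\<close>.\<close>

lemma low_degree_prob:
  assumes "finite A" "finite S" "cross {x} (S - {x}) \<subseteq> A" "0 \<le> p" "p \<le> 1" "0 < \<rho>" "\<rho> \<le> 1" "\<tau> \<le> real (card S)"
  shows "prob (random_subset A p) {Z. deg (X0 \<union> Z) x S \<le> a} \<le> \<rho> powr (-a) * exp (- (1 - \<rho>) * p * (\<tau> - 1))"
proof -
  let ?F = "cross {x} (S - {x})"
  have "real (card (Z \<inter> ?F)) \<le> deg (X0 \<union> Z) x S" for Z
  proof -
    have "card (Z \<inter> ?F) = card (nbr Z x \<inter> (S - {x}))"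
      using assms(2) by (intro card_nbr_cross[symmetric]) auto
    also have "\<dots> \<le> card (nbr (X0 \<union> Z) x \<inter> S)" using assms(2) by (intro card_mono) (auto simp: nbr_def)
    finally show ?thesis by simp
  qed
  then have "prob (random_subset A p) {Z. deg (X0 \<union> Z) x S \<le> a}
    \<le> prob (random_subset A p) {Z. real (card (Z \<inter> ?F)) \<le> a}"
    by (intro measure_pmf.finite_measure_mono Collect_mono impI) (blast intro: order_trans, simp)
  also have "\<dots> \<le> \<rho> powr (-a) * exp (- (1 - \<rho>) * p * real (card ?F))"
    using assms by (intro lower_tail) auto
  also have "\<dots> \<le> \<rho> powr (-a) * exp (- (1 - \<rho>) * p * (\<tau> - 1))"
  proof -
    have "card S \<le> Suc (card (S - {x}))" using assms(2) by (cases "x \<in> S") (auto simp: card_Suc_Diff1)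
    then have "\<tau> - 1 \<le> real (card (S - {x}))" using assms(8) by linarith
    also have "real (card (S - {x})) = real (card ?F)" by (simp add: card_cross)
    finally have "(1 - \<rho>) * p * (\<tau> - 1) \<le> (1 - \<rho>) * p * real (card ?F)" using assms
      by (intro mult_left_mono) auto
    then have "- (1 - \<rho>) * p * real (card ?F) \<le> - (1 - \<rho>) * p * (\<tau> - 1)"
      by (simp only: mult_minus_left neg_le_iff_le)
    then show ?thesis by (intro mult_left_mono) auto
  qed
  finally show ?thesis .
qed

text \<open>The lost vertex changes the exponent by at most \<open>(1 - \<rho>) * p \<le> 1\<close>,
  whence the factor \<open>exp 1\<close>.\<close>

lemma low_degree_edge_prob:
  assumes "finite A" "finite S" "cross {x} (S - {x}) \<subseteq> A" "0 \<le> edge_prob c n" "edge_prob c n \<le> 1" "1 \<le> n"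
    "0 < \<rho>" "\<rho> \<le> 1" "t * n \<le> real (card S)"
  shows "prob (random_subset A (edge_prob c n)) {Z. deg (X0 \<union> Z) x S \<le> \<alpha> * ln n}
    \<le> exp 1 * exp (- ((1 - \<rho>) * c * t + \<alpha> * ln \<rho>) * ln n)"
proof -
  let ?p = "edge_prob c n"
  have "(1 - \<rho>) * ?p \<le> 1" using assms by (intro mult_le_one) auto
  moreover have "(1 - \<rho>) * ?p * (t * n) = (1 - \<rho>) * c * t * ln n" using assms(6) by simp
  moreover have "- (1 - \<rho>) * q * (t * n - 1) = (1 - \<rho>) * q - (1 - \<rho>) * q * (t * n)" for q
    by (simp add: algebra_simps)
  ultimately have le: "- (1 - \<rho>) * ?p * (t * n - 1) \<le> 1 - (1 - \<rho>) * c * t * ln n"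
    by (simp only:)
  have "prob (random_subset A ?p) {Z. deg (X0 \<union> Z) x S \<le> \<alpha> * ln n}
    \<le> \<rho> powr (- (\<alpha> * ln n)) * exp (- (1 - \<rho>) * ?p * (t * n - 1))"
    using assms by (intro low_degree_prob) auto
  also have "\<dots> \<le> \<rho> powr (- (\<alpha> * ln n)) * exp (1 - (1 - \<rho>) * c * t * ln n)"
    using le by (intro mult_left_mono) auto
  also have "\<dots> = exp 1 * exp (- ((1 - \<rho>) * c * t + \<alpha> * ln \<rho>) * ln n)"
    using assms by (simp add: powr_def exp_add[symmetric] algebra_simps)
  finally show ?thesis .
qed

lemma whp_max_degree:
  assumes c: "0 < c"
  shows "whp c (\<lambda>n E. \<forall>x\<in>{1..n}. deg E x {1..n} \<le> (2 * c + 2) * ln n)"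
proof (rule whpI)
  show "(\<lambda>n. real n * exp (- 2 * ln (real n))) \<longlonglongrightarrow> 0" by real_asymp
  show "\<forall>\<^sub>F n in sequentially. prob (gnp c n) {E. \<not> (\<forall>x\<in>{1..n}. deg E x {1..n} \<le> (2 * c + 2) * ln n)}
    \<le> real n * exp (- 2 * ln (real n))"
    using edge_prob_bounds[OF c]
  proof eventually_elim
    case (elim n)
    let ?p = "edge_prob c n"
    have each: "prob (gnp c n) {E. (2 * c + 2) * ln n \<le> real (card (E \<inter> cross {x} ({1..n} - {x})))} \<le>
      exp (- 2 * ln n)"
      if x: "x \<in> {1..n}" for x
    proof -
      let ?F = "cross {x} ({1..n} - {x})"
      have F: "?F \<subseteq> all_edges {1..n}" using x by (intro cross_subset) auto
      have "card ({1..n} - {x}) \<le> card {1..n}" by (rule card_mono) auto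
      then have "card ?F \<le> n" by (simp add: card_cross)
      then have cF: "?p * real (card ?F) \<le> ?p * n" using elim by (intro mult_left_mono) auto
      have e: "exp 1 \<le> (3::real)" using exp_le by simp
      \<comment> \<open>With \<open>\<rho> = exp 1\<close> and \<open>exp 1 - 1 \<le> 2\<close> the
        exponent of \<open>n\<close> is at most \<open>- (2 * c + 2) + 2 * c = - 2\<close>, which
        beats the \<open>n\<close> vertices.\<close>
      have "prob (gnp c n) {E. (2 * c + 2) * ln n \<le> real (card (E \<inter> ?F))}
        \<le> exp 1 powr (- ((2 * c + 2) * ln n)) * exp ((exp 1 - 1) * ?p * real (card ?F))"
        using F elim by (intro upper_tail) auto
      also have "\<dots> = exp (- ((2 * c + 2) * ln n) + (exp 1 - 1) * (?p * real (card ?F)))"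
        by (simp add: exp_powr_real exp_add[symmetric] mult.assoc)
      also have "\<dots> \<le> exp (- ((2 * c + 2) * ln n) + 2 * (c * ln n))"
      proof -
        have "(exp 1 - 1) * (?p * real (card ?F)) \<le> 2 * (?p * n)"
        proof (rule mult_mono)
          show "0 \<le> ?p * real (card ?F)" using elim by (intro mult_nonneg_nonneg) auto
        qed (use e cF in auto)
        then show ?thesis using elim by simp
      qed
      also have "\<dots> = exp (- 2 * ln n)" by (simp add: algebra_simps)
      finally show ?thesis .
    qed
    have "prob (gnp c n) {E. \<not> (\<forall>x\<in>{1..n}. deg E x {1..n} \<le> (2 * c + 2) * ln n)}
      \<le> (\<Sum>x\<in>{1..n}. exp (- 2 * ln n))"
    proof (rule prob_UN_le[where R = "\<lambda>x E. (2 * c + 2) * ln n \<le> real (card (E \<inter> cross {x} ({1..n} - {x})))"])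
      fix E assume "E \<in> set_pmf (gnp c n)"
      then have E: "E \<subseteq> all_edges {1..n}" using set_random_subset by blast
      assume "\<not> (\<forall>x\<in>{1..n}. deg E x {1..n} \<le> (2 * c + 2) * ln n)"
      then obtain x where x: "x \<in> {1..n}" "(2 * c + 2) * ln n < deg E x {1..n}" by force
      have "x \<notin> nbr E x" using E by (auto simp: nbr_def all_edges_def)
      then have "nbr E x \<inter> {1..n} = nbr E x \<inter> ({1..n} - {x})" by auto
      then have "card (nbr E x \<inter> {1..n}) = card (E \<inter> cross {x} ({1..n} - {x}))"
        using card_nbr_cross[of "{1..n} - {x}" x E] by simp
      then show "\<exists>x\<in>{1..n}. (2 * c + 2) * ln n \<le> real (card (E \<inter> cross {x} ({1..n} - {x})))" using x by force
    qed (use each in auto)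
    then show ?case by simp
  qed
qed

lemma whp_edges_between:
  fixes c \<alpha> \<beta> :: real
  assumes c: "0 < c" and \<alpha>\<beta>: "0 < \<alpha>" "0 < \<beta>"
  shows "whp c (\<lambda>n E. joined E {1..n} (\<alpha> * n) (\<beta> * n))"
proof (rule whpI)
  define K where "K = \<alpha> * \<beta> * c / 2"
  have "0 < K" using assms by (simp add: K_def)
  then show "(\<lambda>n. 4 ^ n * exp (- (K * n * ln (real n)))) \<longlonglongrightarrow> 0" by real_asymp
  let ?R = "\<lambda>(n::nat) E (X::nat set) Y. X \<inter> Y = {} \<and> \<alpha> * n \<le> real (card X) \<and> \<beta> * n \<le> real (card Y) \<and>
    E \<inter> cross X Y = {}"
  show "\<forall>\<^sub>F n in sequentially. prob (gnp c n) {E. \<not> (joined E {1..n} (\<alpha> * n) (\<beta> * n))}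
    \<le> 4 ^ n * exp (- (K * n * ln (real n)))"
    using edge_prob_bounds[OF c]
  proof eventually_elim
    case (elim n)
    let ?p = "edge_prob c n"
    have each: "prob (gnp c n) {E. ?R n E (fst Z) (snd Z)} \<le> exp (- (K * n * ln (real n)))"
      if Z: "Z \<in> Pow {1..n} \<times> Pow {1..n}" for Z
    proof (cases "fst Z \<inter> snd Z = {} \<and> \<alpha> * n \<le> real (card (fst Z)) \<and> \<beta> * n \<le> real (card (snd Z))")
      case True
      obtain X Y where XY: "Z = (X, Y)" by (cases Z)
      have F: "cross X Y \<subseteq> all_edges {1..n}" using Z True XY by (intro cross_subset) auto
      have "finite (E \<inter> cross X Y)" for E using F finite_subset
        by (metis finite_Int finite_all_edges finite_atLeastAtMost)
      then have "prob (gnp c n) {E. ?R n E (fst Z) (snd Z)} = prob (gnp c n) {E. real (card (E \<inter> cross X Y))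
        \<le> 0}"
        using True XY by simp
      \<comment> \<open>The lower tail at threshold 0 bounds the probability of no edge by
        \<open>exp (- K * n * ln n)\<close>, which beats the \<open>4 ^ n\<close> pairs of
        sets.\<close>
      also have "\<dots> \<le> (1/2) powr (-0) * exp (- (1 - 1/2) * ?p * real (card (cross X Y)))"
        using F elim by (intro lower_tail) auto
      also have "\<dots> \<le> exp (- (K * n * ln (real n)))"
      proof -
        have "(\<alpha> * n) * (\<beta> * n) \<le> real (card X) * real (card Y)" using True XY \<alpha>\<beta> by (intro mult_mono) auto
        then have "?p * ((\<alpha> * n) * (\<beta> * n)) \<le> ?p * (real (card X) * real (card Y))"
          using elim by (intro mult_left_mono) auto
        moreover have "K * n * ln n = ?p * ((\<alpha> * n) * (\<beta> * n)) / 2" using elim by (simp add: K_def)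
        ultimately have "K * n * ln n \<le> ?p * (real (card X) * real (card Y)) / 2"
          by (simp only: divide_right_mono)
        also have "\<dots> = (1 - 1/2) * ?p * real (card (cross X Y))" using True XY by (simp add: card_cross)
        finally have "K * n * ln n \<le> (1 - 1/2) * ?p * real (card (cross X Y))" .
        then show ?thesis by simp
      qed
      finally show ?thesis .
    next
      case False
      then have *: "{E. ?R n E (fst Z) (snd Z)} = {}" by auto
      show ?thesis unfolding * by simp
    qed
    have "prob (gnp c n) {E. \<not> (joined E {1..n} (\<alpha> * n) (\<beta> * n))}
      \<le> (\<Sum>Z\<in>Pow {1..n} \<times> Pow {1..n}. exp (- (K * n * ln (real n))))"
    proof (rule prob_UN_le[where R = "\<lambda>Z E. ?R n E (fst Z) (snd Z)"])
      fix E assume "\<not> (joined E {1..n} (\<alpha> * n) (\<beta> * n))"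
      then obtain X Y where XY: "X \<subseteq> {1..n}" "Y \<subseteq> {1..n}" "X \<inter> Y = {}" "\<alpha> * n \<le> real (card X)" "\<beta> * n \<le>
        real (card Y)"
        "\<not> (\<exists>x\<in>X. \<exists>y\<in>Y. {x, y} \<in> E)" by blast
      have "E \<inter> cross X Y = {}" using XY(6) by (auto simp: cross_def)
      then show "\<exists>Z\<in>Pow {1..n} \<times> Pow {1..n}. ?R n E (fst Z) (snd Z)"
        using XY by (intro bexI[of _ "(X, Y)"]) auto
    qed (use each in auto)
    also have "\<dots> = 4 ^ n * exp (- (K * n * ln (real n)))"
      by (simp add: card_cartesian_product card_Pow power_mult_distrib[symmetric])
    finally show ?case .
  qed
qed

text \<open>If \<open>S\<close> reaches few vertices of \<open>Z\<close>, some small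
  \<open>Y\<close> leaves no edge between \<open>S\<close> and \<open>Z - Y\<close>. Sets
  \<open>S\<close> of order \<open>n / ln n\<close> number only \<open>exp (o(n))\<close>, whereas
  the absence of all these edges has probability exponentially small in \<open>n\<close>.\<close>

lemma whp_cover:
  fixes c \<delta> :: real
  assumes c: "0 < c" and \<delta>: "0 < \<delta>"
  shows "\<exists>\<gamma>::real. 0 < \<gamma> \<and> (\<forall>Z. (\<forall>n. Z n \<subseteq> {1..n} \<and> \<delta> * n \<le> real (card (Z n))) \<longrightarrow>
    whp c (\<lambda>n E. covers E ({1..n} - Z n) (Z n) (n / (4 * ln n)) (\<gamma> * n)))"
proof -
  \<comment> \<open>The absence of edges has probability at most
    \<open>exp (- 16 * K * ln n)\<close> per vertex of \<open>S\<close>. Half of this exponent pays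
    for choosing \<open>S\<close>; the other half yields \<open>exp (- 2 * K * n)\<close>, as
    \<open>S\<close> has at least \<open>n / (4 * ln n)\<close> vertices.\<close>
  define K where "K = c * \<delta> / 64"
  have K: "0 < K" using assms by (simp add: K_def)
  \<comment> \<open>The exponent per vertex in the count of sets \<open>Y\<close> of size at most
    \<open>\<gamma> * n\<close>; kept below \<open>K\<close>, it leaves a factor
    \<open>exp (- K * n)\<close>.\<close>
  have "((\<lambda>g::real. g - g * ln g) \<longlongrightarrow> 0) (at_right 0)" by real_asymp
  then have "\<forall>\<^sub>F g in at_right 0. g - g * ln g < K" using K by (rule order_tendstoD)
  moreover have "\<forall>\<^sub>F g in at_right 0. g \<in> {0 <..< min 1 (\<delta> / 2)}" using \<delta>
    by (intro eventually_at_right_real) auto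
  ultimately have "\<forall>\<^sub>F g in at_right (0::real). g - g * ln g < K \<and> g \<in> {0 <..< min 1 (\<delta> / 2)}"
    by eventually_elim auto
  then obtain \<gamma> :: real where \<gamma>: "\<gamma> - \<gamma> * ln \<gamma> < K" "0 < \<gamma>" "\<gamma> < 1" "\<gamma> < \<delta> / 2"
    using eventually_happens'[of "at_right (0::real)"] by auto
  have main: "whp c (\<lambda>n E. covers E ({1..n} - Z n) (Z n) (n / (4 * ln n)) (\<gamma> * n))"
    if Z: "\<And>n. Z n \<subseteq> {1..n}" "\<And>n. \<delta> * n \<le> real (card (Z n))" for Z :: "nat \<Rightarrow> nat set"
  proof (rule whpI)
    show "(\<lambda>n. exp (real n * exp (- (8 * K * ln (real n))) - K * real n)) \<longlonglongrightarrow> 0" using K by real_asymp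
    show "\<forall>\<^sub>F n in sequentially. prob (gnp c n) {E. \<not> (covers E ({1..n} - Z n) (Z n) (n / (4 * ln n)) (\<gamma> *
      n))} \<le> exp (real n * exp (- (8 * K * ln (real n))) - K * real n)"
      using edge_prob_bounds[OF c]
    proof eventually_elim
      case (elim n)
      let ?p = "edge_prob c n" and ?s1 = "n / (4 * ln n)"
      let ?x = "exp (- (16 * K * ln n))" and ?y = "exp (8 * K * ln n)"
      let ?I = "{S \<in> Pow ({1..n} - Z n). ?s1 \<le> real (card S)}" and ?J = "{Y \<in> Pow {1..n}. real (card Y) \<le>
        \<gamma> * n}"
      have fZ: "finite (Z n)" using Z finite_subset by blast
      have each: "prob (gnp c n) {E. E \<inter> cross (fst P) (Z n - snd P) = {}} \<le> ?x ^ card (fst P)"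
        if P: "P \<in> ?I \<times> ?J" for P
      proof -
        obtain S Y where SY: "P = (S, Y)" by (cases P)
        have S: "S \<subseteq> {1..n} - Z n" and Y: "Y \<subseteq> {1..n}" "real (card Y) \<le> \<gamma> * n" using P SY by auto
        have dis: "S \<inter> (Z n - Y) = {}" using S by auto
        have F: "cross S (Z n - Y) \<subseteq> all_edges {1..n}" using S Z(1) dis by (intro cross_subset) auto
        have "finite (E \<inter> cross S (Z n - Y))" for E using F finite_subset
          by (metis finite_Int finite_all_edges finite_atLeastAtMost)
        then have "prob (gnp c n) {E. E \<inter> cross S (Z n - Y) = {}} =
          prob (gnp c n) {E. real (card (E \<inter> cross S (Z n - Y))) \<le> 0}" by simp
        also have "\<dots> \<le> (1/2) powr (-0) * exp (- (1 - 1/2) * ?p * real (card (cross S (Z n - Y))))"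
          using F elim by (intro lower_tail) auto
        also have "\<dots> \<le> exp (- (16 * K * ln n) * real (card S))"
        proof -
          have "\<delta> * n - \<gamma> * n \<le> real (card (Z n) - card Y)" using Z(2)[of n] Y(2) by linarith
          also have "\<dots> \<le> real (card (Z n - Y))"
            using diff_card_le_card_Diff[of Y "Z n"] Y(1) finite_subset by (auto intro!: of_nat_mono)
          finally have d: "\<delta> * n - \<gamma> * n \<le> real (card (Z n - Y))" .
          have "\<gamma> * n \<le> \<delta> / 2 * n" using \<gamma> by (intro mult_right_mono) auto
          then have "\<delta> / 2 * n \<le> real (card (Z n - Y))" using d by (simp add: field_simps)
          then have "?p * (real (card S) * (\<delta> / 2 * n)) \<le> ?p * (real (card S) * real (card (Z n - Y)))"
            using elim by (intro mult_left_mono) auto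
          moreover have "16 * K * ln n * real (card S) = ?p * (real (card S) * (\<delta> / 2 * n)) / 2" using elim
            by (simp add: K_def)
          ultimately have "16 * K * ln n * real (card S) \<le> ?p * (real (card S) * real (card (Z n - Y))) / 2"
            by (simp only: divide_right_mono)
          also have "\<dots> = (1 - 1/2) * ?p * real (card (cross S (Z n - Y)))" by (simp add: card_cross[OF dis])
          finally have "16 * K * ln n * real (card S) \<le> (1 - 1/2) * ?p * real (card (cross S (Z n - Y)))" .
          then show ?thesis by simp
        qed
        also have "\<dots> = ?x ^ card S" using exp_of_nat_mult[of "card S" "- (16 * K * ln n)"]
          by (simp add: mult.commute)
        finally show ?thesis using SY by simp
      qed
      have "prob (gnp c n) {E. \<not> (covers E ({1..n} - Z n) (Z n) (?s1) (\<gamma> * n))}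
        \<le> (\<Sum>P\<in>?I \<times> ?J. ?x ^ card (fst P))"
      proof (rule prob_UN_le[where R = "\<lambda>P E. E \<inter> cross (fst P) (Z n - snd P) = {}"])
        fix E assume "\<not> (covers E ({1..n} - Z n) (Z n) (?s1) (\<gamma> * n))"
        then obtain S where S: "S \<subseteq> {1..n} - Z n" "?s1 \<le> real (card S)" "real (card (Z n \<inter> (\<Union>s\<in>S.
          nbr E s))) < \<gamma> * n"
          by (auto simp: not_le)
        show "\<exists>P\<in>?I \<times> ?J. E \<inter> cross (fst P) (Z n - snd P) = {}"
        proof (rule bexI)
          show "E \<inter> cross (fst (S, Z n \<inter> (\<Union>s\<in>S. nbr E s))) (Z n - snd (S, Z n \<inter> (\<Union>s\<in>S. nbr E s))) = {}"
            by (auto simp: cross_def nbr_def)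
          have "Z n \<inter> (\<Union>s\<in>S. nbr E s) \<subseteq> {1..n}" using Z(1)[of n] by blast
          then show "(S, Z n \<inter> (\<Union>s\<in>S. nbr E s)) \<in> ?I \<times> ?J" using S by simp
        qed
      qed (use each in auto)
      also have "\<dots> = (\<Sum>S\<in>?I. \<Sum>Y\<in>?J. ?x ^ card S)" by (simp only: sum.cartesian_product split_def)
      also have "\<dots> = (\<Sum>S\<in>?I. real (card ?J) * ?x ^ card S)" by (simp only: sum_constant)
      also have "\<dots> = real (card ?J) * (\<Sum>S\<in>?I. ?x ^ card S)" by (simp add: sum_distrib_left)
      also have "\<dots> \<le> (\<gamma> powr (- (\<gamma> * n)) * exp (n * \<gamma>)) * (exp (- (2 * K * n)) * exp (n * exp (- (8 * K * ln
        n))))"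
      proof (rule mult_mono)
        show "real (card ?J) \<le> \<gamma> powr (- (\<gamma> * n)) * exp (n * \<gamma>)"
          using card_small_subsets_le[of "{1..n}" \<gamma> "\<gamma> * n"] \<gamma> by simp
        have "(\<Sum>S\<in>?I. ?x ^ card S) \<le> (\<Sum>S\<in>?I. exp (- (2 * K * n)) * exp (- (8 * K * ln n)) ^ card S)"
        proof (rule sum_mono)
          fix S assume S: "S \<in> ?I"
          have "0 < ln (real n)" using elim by linarith
          then have "2 * K * n = 8 * K * ln n * ?s1" by (simp add: field_simps)
          also have "\<dots> \<le> 8 * K * ln n * real (card S)" using S K elim by (intro mult_left_mono) auto
          finally have "exp (- (16 * K * ln n) * real (card S)) \<le> exp (- (2 * K * n) - 8 * K * ln n * real
            (card S))" by simp
          then show "?x ^ card S \<le> exp (- (2 * K * n)) * exp (- (8 * K * ln n)) ^ card S"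
            using exp_of_nat_mult[of "card S" "- (16 * K * ln n)"] exp_of_nat_mult[of "card S" "- (8 * K *
              ln n)"]
            by (simp add: mult.commute mult.left_commute exp_diff exp_minus field_simps)
        qed
        also have "\<dots> \<le> (\<Sum>S\<in>Pow {1..n}. exp (- (2 * K * n)) * exp (- (8 * K * ln n)) ^ card S)"
          by (rule sum_mono2) auto
        also have "\<dots> = exp (- (2 * K * n)) * (\<Sum>S\<in>Pow {1..n}. exp (- (8 * K * ln n)) ^ card S)"
          by (rule sum_distrib_left[symmetric])
        also have "\<dots> \<le> exp (- (2 * K * n)) * exp (n * exp (- (8 * K * ln n)))"
          using sum_pow_card_le_exp(1)[of "{1..n}" "exp (- (8 * K * ln n))"] by (intro mult_left_mono) auto
        finally show "(\<Sum>S\<in>?I. ?x ^ card S) \<le> exp (- (2 * K * n)) * exp (n * exp (- (8 * K * ln n)))" .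
      qed (auto intro!: sum_nonneg)
      also have "\<dots> = exp (n * (\<gamma> - \<gamma> * ln \<gamma>) - 2 * K * n + n * exp (- (8 * K * ln n)))"
        using \<gamma> by (simp add: powr_def exp_add[symmetric] algebra_simps)
      also have "\<dots> \<le> exp (real n * exp (- (8 * K * ln (real n))) - K * real n)"
        using mult_left_mono[OF less_imp_le[OF \<gamma>(1)], of "real n"] by (simp add: algebra_simps)
      finally show ?case .
    qed
  qed
  then show ?thesis using \<gamma>(2) by (intro exI[of _ \<gamma>] conjI allI impI) auto
qed

lemma low_degree_gnp:
  assumes "S \<subseteq> {1..n}" "x \<in> {1..n}" "0 \<le> edge_prob c n" "edge_prob c n \<le> 1" "1 \<le> n" "0 < \<rho>" "\<rho> \<le>
    1" "t * real n \<le> real (card S)"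
  shows "prob (gnp c n) {E. deg E x S \<le> \<alpha> * ln n}
    \<le> exp 1 * exp (- ((1 - \<rho>) * c * t + \<alpha> * ln \<rho>) * ln n)"
proof -
  have "cross {x} (S - {x}) \<subseteq> all_edges {1..n}" using assms by (intro cross_subset) auto
  then show ?thesis
    using low_degree_edge_prob[of "all_edges {1..n}" S x c n \<rho> t "{}" \<alpha>] assms finite_subset[OF assms(1)]
      by simp
qed

lemma whp_min_degree:
  fixes c t \<rho> \<alpha> :: real
  assumes c: "0 < c" and S: "\<forall>\<^sub>F n in sequentially. S n \<subseteq> {1..n} \<and> t * n \<le> real (card (S n))"
    and \<rho>: "0 < \<rho>" "\<rho> \<le> 1" and \<omega>: "1 < (1 - \<rho>) * c * t + \<alpha> * ln \<rho>"
  shows "whp c (\<lambda>n E. \<forall>x\<in>{1..n}. \<alpha> * ln n < deg E x (S n))"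
proof (rule whpI)
  define \<omega> where "\<omega> = (1 - \<rho>) * c * t + \<alpha> * ln \<rho>"
  have "1 < \<omega>" using \<omega> by (simp add: \<omega>_def)
  then show "(\<lambda>n. real n * (exp 1 * exp (- \<omega> * ln (real n)))) \<longlonglongrightarrow> 0" by real_asymp
  show "\<forall>\<^sub>F n in sequentially. prob (gnp c n) {E. \<not> (\<forall>x\<in>{1..n}. \<alpha> * ln n < deg E x (S n))}
    \<le> real n * (exp 1 * exp (- \<omega> * ln (real n)))"
    using edge_prob_bounds[OF c] S
  proof eventually_elim
    case (elim n)
    have "prob (gnp c n) {E. \<not> (\<forall>x\<in>{1..n}. \<alpha> * ln n < deg E x (S n))}
      \<le> (\<Sum>x\<in>{1..n}. exp 1 * exp (- \<omega> * ln (real n)))"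
    proof (rule prob_UN_le[where R = "\<lambda>x E. deg E x (S n) \<le> \<alpha> * ln n"])
      show "prob (gnp c n) {E. deg E x (S n) \<le> \<alpha> * ln n} \<le> exp 1 * exp (- \<omega> * ln n)"
        if "x \<in> {1..n}" for x
        unfolding \<omega>_def using elim \<rho> that by (intro low_degree_gnp) auto
    qed (auto simp: not_less)
    then show ?case by simp
  qed
qed

text \<open>A positive exponent \<open>\<omega>\<close> suffices here, where a minimum degree needs
  \<open>\<omega> > 1\<close>. The bound \<open>n / ln n ^ 2\<close> is small enough to remain
  \<open>o(n)\<close> after adding the \<open>O(ln n)\<close> neighbours of each exceptional
  vertex.\<close>

lemma whp_few_low_degrees:
  fixes c t \<rho> \<alpha> :: real
  assumes c: "0 < c" and S: "\<forall>\<^sub>F n in sequentially. S n \<subseteq> {1..n} \<and> t * n \<le> real (card (S n))"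
    and \<rho>: "0 < \<rho>" "\<rho> \<le> 1" and \<omega>: "0 < (1 - \<rho>) * c * t + \<alpha> * ln \<rho>"
  shows "whp c (\<lambda>n E. real (card {x\<in>{1..n}. deg E x (S n) \<le> \<alpha> * ln n}) \<le> n / ln n ^ 2)"
proof (rule whpI)
  define \<omega> where "\<omega> = (1 - \<rho>) * c * t + \<alpha> * ln \<rho>"
  have "0 < \<omega>" using \<omega> by (simp add: \<omega>_def)
  then show "(\<lambda>n. real n * (exp 1 * exp (- \<omega> * ln (real n))) / (n / ln n ^ 2)) \<longlonglongrightarrow> 0" by real_asymp
  show "\<forall>\<^sub>F n in sequentially. prob (gnp c n) {E. \<not> (real (card {x\<in>{1..n}. deg E x (S n) \<le> \<alpha> * ln n}) \<le>
    n / ln n ^ 2)}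
    \<le> real n * (exp 1 * exp (- \<omega> * ln (real n))) / (n / ln n ^ 2)"
    using edge_prob_bounds[OF c] S
  proof eventually_elim
    case (elim n)
    have "prob (gnp c n) {E. \<not> (real (card {x\<in>{1..n}. deg E x (S n) \<le> \<alpha> * ln n}) \<le> n / ln n ^ 2)}
      \<le> prob (gnp c n) {E. n / ln n ^ 2 \<le> real (card {x\<in>{1..n}. deg E x (S n) \<le> \<alpha> * ln n})}"
      by (intro measure_pmf.finite_measure_mono) auto
    also have "\<dots> \<le> real (card {1..n}) * (exp 1 * exp (- \<omega> * ln (real n))) / (n / ln n ^ 2)"
    proof (rule prob_card_ge)
      show "prob (gnp c n) {E. deg E x (S n) \<le> \<alpha> * ln n} \<le> exp 1 * exp (- \<omega> * ln n)"
        if "x \<in> {1..n}" for x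
        unfolding \<omega>_def using elim \<rho> that by (intro low_degree_gnp) auto
    next
      have "0 < real n" "0 < ln (real n)" using elim by linarith+
      then show "0 < n / ln n ^ 2" by simp
    qed simp
    finally show ?case by simp
  qed
qed

section \<open>Attaching vertices to the reserved block\<close>

text \<open>A single vertex is bad with probability a possibly small negative power of
  \<open>n\<close>, too much for a union bound. But if half of \<open>a * ln n\<close> neighbours
  were bad, together they would send too few edges to \<open>Y\<close>, and this has probability
  \<open>exp (- v * ln n ^ 2)\<close> up to powers of \<open>n\<close>, for some
  \<open>v > 0\<close>.\<close>

lemma good_neighbours_prob:
  fixes a c \<gamma> \<beta> :: real
  assumes fin: "finite A" "finite N" "finite Y" and NY: "N \<inter> Y = {}" and sub: "cross N Y \<subseteq> A"
    and p: "0 \<le> edge_prob c n" "edge_prob c n \<le> 1" "1 \<le> n" "1 \<le> ln n"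
    and a: "0 < a" "a * ln n \<le> real (card N)" and Y: "\<gamma> * n - 1 \<le> real (card Y)"
    and \<omega>: "1 \<le> (\<gamma> * c / 2 - \<beta> * ln 2) * ln n"
  shows "prob (random_subset A (edge_prob c n))
      {Z. real (card {b \<in> N. \<beta> * ln n < deg (X0 \<union> Z) b Y}) < a / 2 * ln n}
    \<le> 2 * exp (a * ln 2 * ln n) * exp (- (a / 2) * ln n * ((\<gamma> * c / 2 - \<beta> * ln 2) * ln n - 1))"
proof -
  let ?p = "edge_prob c n" and ?L = "ln (real n)"
  let ?w = "(\<gamma> * c / 2 - \<beta> * ln 2) * ?L - 1"
  \<comment> \<open>Only about \<open>a * ln n\<close> neighbours are kept, so that choosing the bad
    ones costs \<open>2 ^ k0\<close>, a fixed power of \<open>n\<close>.\<close>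
  define k0 where "k0 = nat \<lceil>a * ?L\<rceil>"
  have aL: "0 \<le> a * ?L" using a p by simp
  then have k0: "a * ?L \<le> real k0" "real k0 \<le> a * ?L + 1" by (auto simp: k0_def)
  have "k0 \<le> card N" using a(2) by (simp add: k0_def nat_le_iff ceiling_le_iff)
  then obtain N0 where N0: "N0 \<subseteq> N" "card N0 = k0" by (metis obtain_subset_with_card_n)
  have fN0: "finite N0" using N0 fin finite_subset by blast
  define k where "k = nat \<lceil>real k0 / 2\<rceil>"
  have k: "real k0 / 2 \<le> real k" "a / 2 * ?L \<le> real k" using k0 by (auto simp: k_def) linarith+
  let ?I = "{F \<in> Pow N0. card F = k}"
  let ?b = "exp (- (a / 2) * ?L * ?w)"
  have each: "prob (random_subset A ?p) {Z. real (card (Z \<inter> cross F Y)) \<le> \<beta> * ?L * real k} \<le> ?b"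
    if F: "F \<in> ?I" for F
  proof -
    have FN: "F \<subseteq> N" "card F = k" "F \<inter> Y = {}" using F N0 NY by auto
    have FA: "cross F Y \<subseteq> A" using FN(1) sub by (auto simp: cross_def)
    have "prob (random_subset A ?p) {Z. real (card (Z \<inter> cross F Y)) \<le> \<beta> * ?L * real k}
      \<le> (1/2) powr (- (\<beta> * ?L * real k)) * exp (- (1 - 1/2) * ?p * real (card (cross F Y)))"
      using FA fin p by (intro lower_tail) auto
    also have "real (card (cross F Y)) = real k * real (card Y)" using FN by (simp add: card_cross)
    also have "(1/2) powr (- (\<beta> * ?L * real k)) = exp (real k * (\<beta> * ln 2 * ?L))"
      by (simp add: powr_def ln_div)
    also have "exp (real k * (\<beta> * ln 2 * ?L)) * exp (- (1 - 1/2) * ?p * (real k * real (card Y)))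
        = exp (real k * (\<beta> * ln 2 * ?L - ?p * real (card Y) / 2))"
      by (simp add: exp_add[symmetric] algebra_simps)
    also have "\<dots> \<le> exp (real k * (- ?w))"
    proof -
      have "?p * (\<gamma> * n - 1) \<le> ?p * real (card Y)" using Y p by (intro mult_left_mono) auto
      moreover have "?p * (\<gamma> * n - 1) = \<gamma> * c * ?L - ?p" using p(3) by (simp add: field_simps)
      moreover have "?w = \<gamma> * c * ?L / 2 - \<beta> * ln 2 * ?L - 1" by (simp add: algebra_simps)
      moreover define q where "q = ?p * real (card Y)"
      ultimately have "\<beta> * ln 2 * ?L - q / 2 \<le> - ?w" using p(2) by linarith
      then have "\<beta> * ln 2 * ?L - ?p * real (card Y) / 2 \<le> - ?w" by (simp only: q_def)
      then show ?thesis by (simp add: mult_left_mono)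
    qed
    also have "\<dots> \<le> ?b"
    proof -
      have "(a / 2 * ?L) * ?w \<le> real k * ?w" using k(2) \<omega> by (intro mult_right_mono) auto
      then have "real k * (- ?w) \<le> - (a / 2) * ?L * ?w"
        by (simp only: mult_minus_left mult_minus_right neg_le_iff_le)
      then show ?thesis by (simp only: exp_le_cancel_iff)
    qed
    finally show ?thesis .
  qed
  have "prob (random_subset A ?p)
      {Z. real (card {b \<in> N. \<beta> * ?L < deg (X0 \<union> Z) b Y}) < a / 2 * ?L} \<le> (\<Sum>F\<in>?I. ?b)"
  proof (rule prob_UN_le[where R = "\<lambda>F Z. real (card (Z \<inter> cross F Y)) \<le> \<beta> * ?L * real k"])
    fix Z assume bad: "real (card {b \<in> N. \<beta> * ?L < deg (X0 \<union> Z) b Y}) < a / 2 * ?L"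
    let ?G = "{b \<in> N0. \<beta> * ?L < deg (X0 \<union> Z) b Y}"
    let ?H = "{b \<in> N0. deg (X0 \<union> Z) b Y \<le> \<beta> * ?L}"
    have "card ?G \<le> card {b \<in> N. \<beta> * ?L < deg (X0 \<union> Z) b Y}"
      using fin N0(1) by (intro card_mono) auto
    moreover have "card N0 = card ?G + card ?H"
      using fN0 by (subst card_Un_disjoint[symmetric]) (auto intro!: arg_cong[where f = card])
    ultimately have "real k0 / 2 \<le> real (card ?H)" using bad k0(1) N0(2) by linarith
    then have "k \<le> card ?H" by (simp add: k_def nat_le_iff ceiling_le_iff)
    from obtain_subset_with_card_n[OF this] obtain F where F: "F \<subseteq> ?H" "card F = k" by auto
    have fF: "finite F" by (rule finite_subset[OF F(1)]) (use fN0 in simp)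
    have dF: "F \<inter> Y = {}" using F(1) N0(1) NY by auto
    have "real (card (Z \<inter> cross F Y)) = (\<Sum>b\<in>F. deg Z b Y)"
      using sum_nbr_cross[OF fF fin(3) dF, of Z] by (simp flip: of_nat_sum)
    also have "\<dots> \<le> (\<Sum>b\<in>F. \<beta> * ?L)"
    proof (rule sum_mono)
      fix b assume b: "b \<in> F"
      have "card (nbr Z b \<inter> Y) \<le> card (nbr (X0 \<union> Z) b \<inter> Y)" using fin
        by (intro card_mono) (auto simp: nbr_def)
      then show "deg Z b Y \<le> \<beta> * ?L" using F(1) b by fastforce
    qed
    also have "\<dots> = \<beta> * ?L * real k" using F(2) by simp
    finally have "real (card (Z \<inter> cross F Y)) \<le> \<beta> * ?L * real k" .
    moreover have "F \<in> ?I" using F by auto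
    ultimately show "\<exists>F\<in>?I. real (card (Z \<inter> cross F Y)) \<le> \<beta> * ?L * real k" by blast
  qed (use each fN0 in auto)
  also have "\<dots> = real (card ?I) * ?b" by simp
  also have "\<dots> \<le> (2 * exp (a * ln 2 * ?L)) * ?b"
  proof (rule mult_right_mono)
    have "card ?I \<le> card (Pow N0)" using fN0 by (intro card_mono) auto
    then have "real (card ?I) \<le> 2 ^ k0" using N0(2) fN0 by (simp add: card_Pow)
    also have "\<dots> = exp (ln 2 * real k0)" by (simp add: powr_realpow[symmetric] powr_def mult.commute)
    also have "\<dots> \<le> exp (ln 2 * (a * ?L + 1))" using k0(2) by (simp add: mult_left_mono)
    also have "\<dots> = 2 * exp (a * ln 2 * ?L)" by (simp add: exp_add algebra_simps)
    finally show "real (card ?I) \<le> 2 * exp (a * ln 2 * ?L)" .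
  qed simp
  finally show ?thesis .
qed

definition unattached :: "nat set set \<Rightarrow> nat set \<Rightarrow> nat set \<Rightarrow> nat set \<Rightarrow> real \<Rightarrow> nat set" where
  "unattached E V T Y \<beta> = {x \<in> V - T - Y. deg E x Y \<le> \<beta>}"

text \<open>The degree condition avoids the unattached vertices as well as the tree, so a matching
  into these neighbours never uses a vertex that needs help itself.\<close>

definition attachable :: "nat set set \<Rightarrow> nat set \<Rightarrow> nat set \<Rightarrow> nat set \<Rightarrow> nat set \<Rightarrow> real \<Rightarrow> real \<Rightarrow> real \<Rightarrow> bool"
  where
  "attachable E V V' T Y \<beta> \<theta> a \<longleftrightarrow> real (card (unattached E V T Y \<beta>)) \<le> \<theta> \<and>
     (\<forall>x\<in>V. a \<le> deg E x (V' - T - unattached E V T Y \<beta>))"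

text \<open>\<open>A\<close> leaves out the edges inside \<open>V'\<close>, which produce the tree,
  and those between \<open>S\<close> and \<open>Z2\<close>, which produce \<open>Y\<close>. The
  summands bound three failures: too many unattached vertices, by Markov; a vertex of
  \<open>Z2\<close> with few neighbours in \<open>V' - T\<close>; a vertex with enough of them but
  too few that are attached.\<close>

lemma attachable_prob:
  fixes a c \<gamma> \<beta> \<theta> \<tau> \<rho> :: real
  assumes V: "V' \<union> Z2 = {1..n}" "V' \<inter> Z2 = {}" and T: "S \<subseteq> T" "T \<subseteq> V'" "Y \<subseteq> Z2"
    and A: "A = all_edges {1..n} - all_edges V' - cross S Z2"
    and p: "0 \<le> edge_prob c n" "edge_prob c n \<le> 1" "1 \<le> n" "1 \<le> ln n"
    and Y: "\<gamma> * n \<le> real (card Y)" and \<tau>: "\<tau> * n \<le> real (card (V' - T))"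
    and a: "0 < a" "\<And>x. x \<in> V' \<Longrightarrow> a * ln n \<le> deg X0 x (V' - T)"
    and \<omega>: "1 \<le> (\<gamma> * c / 2 - \<beta> * ln 2) * ln n" and \<theta>: "0 < \<theta>" and \<rho>: "0 < \<rho>" "\<rho> \<le> 1"
  shows "prob (random_subset A (edge_prob c n)) {Z. \<not> attachable (X0 \<union>
    Z) {1..n} V' T Y (\<beta> * ln n) (\<theta> * n) (a / 2 * ln n)}
    \<le> exp 1 * exp (- (\<gamma> * c / 2 - \<beta> * ln 2) * ln n) / \<theta>
      + real n * (exp 1 * exp (- ((1 - \<rho>) * c * \<tau> + a * ln \<rho>) * ln n))
      + real n * (2 * exp (a * ln 2 * ln n) * exp (- (a / 2) * ln n * ((\<gamma> * c / 2 - \<beta> * ln 2) * ln n - 1)))"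
    (is "_ \<le> ?b1 + ?b2 + ?b3")
proof -
  let ?p = "edge_prob c n" and ?L = "ln (real n)" and ?V = "{1..n}" and ?W = "V' - T"
  let ?M = "random_subset A ?p"
  have sub: "V' \<subseteq> ?V" "Z2 \<subseteq> ?V" using V(1) by auto
  have fin: "finite V'" "finite Z2" "finite Y" "finite ?W" "finite A"
    using sub T(3) by (auto intro: finite_subset simp: A)
  have inA: "{x, y} \<in> A" if "x \<in> ?V - S" "y \<in> Z2" "x \<noteq> y" for x y
  proof -
    have "{x, y} \<in> all_edges ?V" using that sub by (auto simp: all_edges_def)
    moreover have "{x, y} \<notin> all_edges V'" using that V(2) by (auto simp: all_edges_def)
    moreover have "{x, y} \<notin> cross S Z2"
    proof
      assume "{x, y} \<in> cross S Z2"
      then obtain s z where "{x, y} = {s, z}" "s \<in> S" "z \<in> Z2" by (auto simp: cross_def)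
      then have "y = s" using that(1) by (auto simp: doubleton_eq_iff)
      then show False using \<open>s \<in> S\<close> T(1,2) that(2) V(2) by auto
    qed
    ultimately show ?thesis by (simp add: A)
  qed
  \<comment> \<open>Edges from \<open>V'\<close> into \<open>V' - T\<close> are already known, those
    from \<open>Z2\<close> are still random.\<close>
  let ?N = "\<lambda>x Z. nbr (if x \<in> V' then X0 else Z) x \<inter> ?W"
  let ?B1 = "\<lambda>Z. \<theta> * n \<le> real (card {x \<in> ?V - T - Y. deg (X0 \<union> Z) x Y \<le> \<beta> * ?L})"
  let ?B2 = "\<lambda>Z. \<exists>x\<in>Z2. deg ({} \<union> Z) x ?W \<le> a * ?L"
  \<comment> \<open>For \<open>x \<in> Y\<close>, edges at \<open>x\<close> decide which
    \<open>b\<close> are neighbours, so they must not count again as edges into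
    \<open>Y\<close>.\<close>
  let ?bad = "\<lambda>x Z. a * ?L \<le> real (card (?N x Z)) \<and>
    real (card {b \<in> ?N x Z. \<beta> * ?L < deg (X0 \<union> Z) b (Y - {x})}) < a / 2 * ?L"
  let ?B3 = "\<lambda>Z. \<exists>x\<in>?V. ?bad x Z"
  have 1: "prob ?M {Z. ?B1 Z} \<le> ?b1"
  proof -
    have "prob ?M {Z. ?B1 Z} \<le> real (card (?V - T - Y)) * (exp 1 * exp (- (\<gamma> * c / 2 - \<beta> * ln 2) * ?L)) / (\<theta>
      * n)"
    proof (rule prob_card_ge)
      fix x assume x: "x \<in> ?V - T - Y"
      have "{x, y} \<in> A" if "y \<in> Y - {x}" for y using that x T by (intro inA) auto
      then have "cross {x} (Y - {x}) \<subseteq> A" by (auto simp: cross_def)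
      from low_degree_edge_prob[OF fin(5) fin(3) this p(1,2,3), of "1/2" \<gamma> X0 \<beta>] Y
      show "prob ?M {Z. deg (X0 \<union> Z) x Y \<le> \<beta> * ?L} \<le> exp 1 * exp (- (\<gamma> * c / 2 - \<beta> * ln 2) * ?L)"
        by (simp add: ln_div mult.commute)
    qed (use \<theta> p in auto)
    also have "\<dots> \<le> real n * (exp 1 * exp (- (\<gamma> * c / 2 - \<beta> * ln 2) * ?L)) / (\<theta> * n)"
    proof -
      have "card (?V - T - Y) \<le> card ?V" by (intro card_mono) auto
      then show ?thesis using \<theta> by (intro divide_right_mono mult_right_mono) auto
    qed
    also have "\<dots> = ?b1" using p(3) by simp
    finally show ?thesis .
  qed
  have 2: "prob ?M {Z. ?B2 Z} \<le> ?b2"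
  proof -
    have "prob ?M {Z. ?B2 Z} \<le> (\<Sum>x\<in>Z2. exp 1 * exp (- ((1 - \<rho>) * c * \<tau> + a * ln \<rho>) * ?L))"
    proof (rule prob_UN_le[where R = "\<lambda>x Z. deg ({} \<union> Z) x ?W \<le> a * ?L"])
      fix x assume x: "x \<in> Z2"
      have "{x, y} \<in> A" if "y \<in> ?W" for y
      proof -
        have "y \<in> ?V - S" "y \<noteq> x" using that x V(2) T(1) sub by auto
        then show ?thesis using inA[of y x] x by (simp add: insert_commute)
      qed
      then have "cross {x} (?W - {x}) \<subseteq> A" by (auto simp: cross_def)
      from low_degree_edge_prob[OF fin(5) fin(4) this p(1,2,3) \<rho> \<tau>, of "{}" a]
      show "prob ?M {Z. deg ({} \<union> Z) x ?W \<le> a * ?L} \<le> exp 1 * exp (- ((1 - \<rho>) * c * \<tau> + a * ln \<rho>) * ?L)" .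
    qed (use fin in auto)
    also have "\<dots> = real (card Z2) * (exp 1 * exp (- ((1 - \<rho>) * c * \<tau> + a * ln \<rho>) * ?L))" by simp
    also have "\<dots> \<le> ?b2"
      using card_mono[OF _ sub(2)] by (intro mult_right_mono) auto
    finally show ?thesis .
  qed
  have 3: "prob ?M {Z. ?B3 Z} \<le> ?b3"
  proof -
    let ?q = "2 * exp (a * ln 2 * ?L) * exp (- (a / 2) * ?L * ((\<gamma> * c / 2 - \<beta> * ln 2) * ?L - 1))"
    have "prob ?M {Z. ?bad x Z} \<le> ?q" if x: "x \<in> ?V" for x
    proof -
      have cY: "\<gamma> * n - 1 \<le> real (card (Y - {x}))"
      proof -
        have "card Y \<le> Suc (card (Y - {x}))" using fin(3) by (cases "x \<in> Y") (auto simp: card_Suc_Diff1)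
        then show ?thesis using Y by linarith
      qed
      have cr: "cross N (Y - {x}) \<subseteq> A" if "N \<subseteq> ?W" for N
      proof -
        have "{b, y} \<in> A" if "b \<in> ?W" "y \<in> Y - {x}" for b y
        proof (rule inA)
          show "b \<in> ?V - S" "y \<in> Z2" "b \<noteq> y" using that T sub V(2) by auto
        qed
        then show ?thesis using that by (auto simp: cross_def)
      qed
      have fY: "finite (Y - {x})" using fin by simp
      show ?thesis
      proof (cases "x \<in> V'")
        case True
        let ?N0 = "nbr X0 x \<inter> ?W"
        have "prob ?M {Z. ?bad x Z} \<le>
          prob ?M {Z. real (card {b \<in> ?N0. \<beta> * ?L < deg (X0 \<union> Z) b (Y - {x})}) < a / 2 * ?L}"
          using True by (intro measure_pmf.finite_measure_mono) auto
        also have "\<dots> \<le> ?q"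
          using fin T(3) V(2) by (intro good_neighbours_prob[OF fin(5) _ fY _ cr p a(1) a(2)[OF True] cY \<omega>])
            auto
        finally show ?thesis .
      next
        case False
        then have xZ: "x \<in> Z2" using x V(1) by blast
        \<comment> \<open>The neighbours of \<open>x\<close> must be fixed before their edges to
          \<open>Y - {x}\<close> are examined; the two sets of edges are disjoint, so the former can
          be revealed first.\<close>
        define A1 where "A1 = cross {x} ?W"
        have A1: "A1 \<subseteq> A"
        proof -
          have "{x, b} \<in> A" if b: "b \<in> ?W" for b
          proof -
            have "b \<in> ?V - S" "b \<noteq> x" using b xZ V(2) T(1) sub by auto
            then show ?thesis using inA[of b x] xZ by (simp add: insert_commute)
          qed
          then show ?thesis by (auto simp: A1_def cross_def)
        qed
        have A_eq: "A = A1 \<union> (A - A1)" using A1 by (rule Diff_partition[symmetric])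
        have cr1: "cross N (Y - {x}) \<subseteq> A - A1" if N: "N \<subseteq> ?W" for N
        proof -
          have "{b, y} \<notin> A1" if "b \<in> N" "y \<in> Y - {x}" for b y
            using that N xZ V(2) by (auto simp: A1_def cross_def doubleton_eq_iff)
          then show ?thesis using cr[OF N] by (auto simp: cross_def)
        qed
        have "prob (random_subset (A1 \<union> (A - A1)) ?p) {Z. ?bad x Z} \<le> ?q"
        proof (rule prob_random_subset_reveal)
          fix X1 assume X1: "X1 \<subseteq> A1"
          let ?N0 = "nbr X1 x \<inter> ?W"
          show "prob (random_subset (A - A1) ?p) {Z. ?bad x (X1 \<union> Z)} \<le> ?q"
          proof (cases "a * ?L \<le> real (card ?N0)")
            case True
            have "prob (random_subset (A - A1) ?p) {Z. ?bad x (X1 \<union> Z)} \<le>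
              prob (random_subset (A - A1) ?p) {Z. real (card {b \<in> ?N0. \<beta> * ?L < deg ((X0 \<union> X1) \<union> Z) b (Y -
                {x})}) < a / 2 * ?L}"
            proof (rule measure_pmf.finite_measure_mono_AE)
              show "AE Z in random_subset (A - A1) ?p. Z \<in> {Z. ?bad x (X1 \<union> Z)} \<longrightarrow>
                Z \<in> {Z. real (card {b \<in> ?N0. \<beta> * ?L < deg ((X0 \<union> X1) \<union> Z) b (Y - {x})}) < a / 2 * ?L}"
              proof (rule AE_pmfI)
                fix Z assume "Z \<in> set_pmf (random_subset (A - A1) ?p)"
                then have "Z \<inter> A1 = {}" using set_random_subset by fastforce
                then have *: "nbr (X1 \<union> Z) x \<inter> ?W = ?N0" by (auto simp: nbr_def A1_def cross_def)
                show "Z \<in> {Z. ?bad x (X1 \<union> Z)} \<longrightarrow>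
                  Z \<in> {Z. real (card {b \<in> ?N0. \<beta> * ?L < deg ((X0 \<union> X1) \<union> Z) b (Y - {x})}) < a / 2 * ?L}"
                  using False by (simp only: mem_Collect_eq if_False * Un_assoc) blast
              qed
            qed simp
            also have "\<dots> \<le> ?q"
              using fin T(3) V(2) True by (intro good_neighbours_prob[OF _ _ fY _ cr1 p a(1) _ cY \<omega>]) auto
            finally show ?thesis .
          next
            case small: False
            have "prob (random_subset (A - A1) ?p) {Z. ?bad x (X1 \<union> Z)} \<le> prob (random_subset (A - A1) ?p) {}"
            proof (rule measure_pmf.finite_measure_mono_AE)
              show "AE Z in random_subset (A - A1) ?p. Z \<in> {Z. ?bad x (X1 \<union> Z)} \<longrightarrow> Z \<in> {}"
              proof (rule AE_pmfI)
                fix Z assume "Z \<in> set_pmf (random_subset (A - A1) ?p)"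
                then have "Z \<inter> A1 = {}" using set_random_subset by fastforce
                then have *: "nbr (X1 \<union> Z) x \<inter> ?W = ?N0" by (auto simp: nbr_def A1_def cross_def)
                show "Z \<in> {Z. ?bad x (X1 \<union> Z)} \<longrightarrow> Z \<in> {}"
                  using False small by (simp only: mem_Collect_eq if_False * empty_iff) blast
              qed
            qed simp
            then show ?thesis by (simp add: order_trans[OF _ mult_nonneg_nonneg])
          qed
        qed (use fin A1 p finite_subset in auto)
        then show ?thesis using A_eq by simp
      qed
    qed
    then have "prob ?M {Z. ?B3 Z} \<le> (\<Sum>x\<in>?V. ?q)"
      by (intro prob_UN_le[where R = ?bad]) auto
    then show ?thesis by simp
  qed
  have "prob ?M {Z. \<not> attachable (X0 \<union> Z) ?V V' T Y (\<beta> * ?L) (\<theta> * n) (a / 2 * ?L)}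
    \<le> prob ?M ({Z. ?B1 Z} \<union> {Z. ?B2 Z} \<union> {Z. ?B3 Z})"
  proof (intro measure_pmf.finite_measure_mono subsetI CollectI)
    fix Z assume "Z \<in> {Z. \<not> attachable (X0 \<union> Z) ?V V' T Y (\<beta> * ?L) (\<theta> * n) (a / 2 * ?L)}"
    then have na: "\<not> attachable (X0 \<union> Z) ?V V' T Y (\<beta> * ?L) (\<theta> * n) (a / 2 * ?L)" by simp
    show "Z \<in> {Z. ?B1 Z} \<union> {Z. ?B2 Z} \<union> {Z. ?B3 Z}"
    proof (rule ccontr)
      assume no: "Z \<notin> {Z. ?B1 Z} \<union> {Z. ?B2 Z} \<union> {Z. ?B3 Z}"
      let ?U = "unattached (X0 \<union> Z) ?V T Y (\<beta> * ?L)"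
      have "a / 2 * ?L \<le> deg (X0 \<union> Z) x (?W - ?U)" if x: "x \<in> ?V" for x
      proof -
        have "a * ?L \<le> real (card (?N x Z))"
        proof (cases "x \<in> V'")
          case False
          then have "x \<in> Z2" using x V(1) by blast
          then show ?thesis using no False by (auto simp: not_le)
        qed (use a(2) in simp)
        then have "a / 2 * ?L \<le> real (card {b \<in> ?N x Z. \<beta> * ?L < deg (X0 \<union> Z) b (Y - {x})})"
          using no x by (auto simp: not_less)
        also have "\<dots> \<le> deg (X0 \<union> Z) x (?W - ?U)"
        proof (intro of_nat_mono card_mono subsetI)
          fix b assume b: "b \<in> {b \<in> ?N x Z. \<beta> * ?L < deg (X0 \<union> Z) b (Y - {x})}"
          have "card (nbr (X0 \<union> Z) b \<inter> (Y - {x})) \<le> card (nbr (X0 \<union> Z) b \<inter> Y)" using fin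
            by (intro card_mono) auto
          then have "b \<notin> ?U" using b by (auto simp: unattached_def)
          then show "b \<in> nbr (X0 \<union> Z) x \<inter> (?W - ?U)" using b by (auto simp: nbr_def split: if_splits)
        qed (use fin in simp)
        finally show ?thesis .
      qed
      then show False using na no by (auto simp: attachable_def unattached_def)
    qed
  qed simp
  also have "\<dots> \<le> prob ?M ({Z. ?B1 Z} \<union> {Z. ?B2 Z}) + prob ?M {Z. ?B3 Z}"
    by (rule measure_Un_le) auto
  also have "\<dots> \<le> (prob ?M {Z. ?B1 Z} + prob ?M {Z. ?B2 Z}) + prob ?M {Z. ?B3 Z}"
    by (intro add_mono measure_Un_le) auto
  also have "\<dots> \<le> ?b1 + ?b2 + ?b3" using 1 2 3 by linarith
  finally show ?thesis .
qed

text \<open>Hall's condition for \<open>B \<union> Y\<close> into \<open>W\<close> follows from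
  sparseness, as the whole set is small. For the remaining vertices into \<open>Y\<close>, small
  sets expand by sparseness, and large ones reach more than half of \<open>Y\<close>, which
  multiplicity \<open>C\<close> turns into at least \<open>card V\<close> places.\<close>

lemma attachable_gather:
  fixes V :: "nat set" and \<beta> \<theta> a \<eta>1 \<eta>2 l1 l2 :: real
  assumes V: "finite V" and T: "flexible E K M r T S" "T \<subseteq> V'" "V' \<subseteq> V"
    and Y: "Y \<subseteq> V" "Y \<inter> V' = {}" "\<And>y. y \<in> Y \<Longrightarrow> \<exists>s\<in>S. {y, s} \<in> E"
    and att: "attachable E V V' T Y \<beta> \<theta> a"
    and sp1: "sparse E V \<eta>1 l1" "2 * \<eta>1 < a" "0 \<le> \<eta>1" "2 * (\<theta> + real (card Y)) \<le> l1"
    and sp2: "sparse E V \<eta>2 l2" "2 * \<eta>2 < \<beta>" "0 \<le> \<eta>2"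
    and dense: "\<And>X Y1. X \<subseteq> V \<Longrightarrow> Y1 \<subseteq> V \<Longrightarrow> X \<inter> Y1 = {} \<Longrightarrow> l2 / 2 < real (card X) \<Longrightarrow>
      real (card Y) / 2 \<le> real (card Y1) \<Longrightarrow> \<exists>x\<in>X. \<exists>y\<in>Y1. {x, y} \<in> E"
    and C: "1 \<le> C" "2 * card V \<le> C * card Y"
    and deg: "\<And>s. s \<in> V \<Longrightarrow> card (nbr E s \<inter> V) \<le> \<Delta>"
    and K: "2 + 2 * C \<le> K" and M: "\<Delta> * (2 + 2 * C) \<le> M"
  shows "gather E r V"
proof -
  define B where "B = unattached E V T Y \<beta>"
  define R where "R = V - T - Y - B"
  define W where "W = V' - T - B"
  have B: "B \<subseteq> V - T - Y" by (auto simp: B_def unattached_def)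
  have S: "S \<subseteq> T" using T(1) by (simp add: flexible_def)
  have W: "W \<subseteq> R" using T(3) Y(2) by (auto simp: W_def R_def)
  have fin: "finite B" "finite Y" "finite R" "finite W"
    using V B Y(1) T(3) by (auto intro: finite_subset simp: R_def W_def)
  have YT: "Y \<subseteq> V - T" using Y(1,2) T(2) by auto
  have cB: "real (card B) \<le> \<theta>" and dW: "\<And>x. x \<in> V \<Longrightarrow> a \<le> deg E x W"
    using att by (auto simp: attachable_def B_def W_def)
  have "\<exists>f. inj_on f (B \<union> Y) \<and> (\<forall>x\<in>B \<union> Y. f x \<in> nbr E x \<inter> W)"
  proof (rule hall_matching)
    fix X assume X: "X \<subseteq> B \<union> Y"
    have XV: "X \<subseteq> V" using X B Y(1) by auto
    have "card X \<le> card (B \<union> Y)" using X fin by (intro card_mono) auto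
    also have "\<dots> \<le> card B + card Y" by (rule card_Un_le)
    finally have "real (card X) \<le> real (card B) + real (card Y)" by (simp flip: of_nat_add)
    also have "\<dots> \<le> \<theta> + real (card Y)" by (rule add_right_mono[OF cB])
    finally have "2 * real (card X) \<le> 2 * (\<theta> + real (card Y))" by (rule mult_left_mono) simp
    also note sp1(4)
    finally have "2 * real (card X) \<le> l1" .
    moreover have "W \<subseteq> V" "X \<inter> W = {}" using W X B by (auto simp: R_def)
    ultimately show "card X \<le> card (\<Union>x\<in>X. nbr E x \<inter> W)"
      using XV dW sp1(1-3) V by (intro sparse_expands[where \<kappa> = a and l = l1]) auto
  qed (use fin in auto)
  then obtain \<mu> where \<mu>: "inj_on \<mu> (B \<union> Y)" "\<And>x. x \<in> B \<union> Y \<Longrightarrow> \<mu> x \<in> nbr E x \<inter> W" by blast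
  have "\<exists>f. (\<forall>z\<in>R - \<mu> ` Y. f z \<in> nbr E z \<inter> Y) \<and> (\<forall>y. card {z \<in> R - \<mu> ` Y. f z = y} \<le> C)"
  proof (rule hall_assignment)
    fix X assume X: "X \<subseteq> R - \<mu> ` Y"
    let ?N = "\<Union>z\<in>X. nbr E z \<inter> Y"
    have XV: "X \<subseteq> V" "X \<inter> Y = {}" using X by (auto simp: R_def)
    have fX: "finite X" using XV V finite_subset by auto
    show "card X \<le> C * card ?N"
    proof (cases "2 * real (card X) \<le> l2")
      case True
      have "\<beta> \<le> deg E z Y" if "z \<in> X" for z
        using that X by (auto simp: R_def B_def unattached_def)
      then have "card X \<le> card ?N"
        using XV Y(1) sp2 V True by (intro sparse_expands[where \<kappa> = \<beta> and l = l2]) auto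
      also have "\<dots> \<le> C * card ?N" using C(1) by simp
      finally show ?thesis .
    next
      case False
      have "\<not> real (card Y) / 2 \<le> real (card (Y - ?N))"
      proof
        assume "real (card Y) / 2 \<le> real (card (Y - ?N))"
        then have "\<exists>x\<in>X. \<exists>y\<in>Y - ?N. {x, y} \<in> E"
          using XV Y(1) False by (intro dense) auto
        then show False by (auto simp: nbr_def)
      qed
      moreover have "?N \<subseteq> Y" by auto
      moreover from this have "card (Y - ?N) = card Y - card ?N" "card ?N \<le> card Y"
        using fin by (auto intro: card_Diff_subset finite_subset card_mono)
      ultimately have "card Y \<le> 2 * card ?N" by linarith
      then have "C * card Y \<le> C * (2 * card ?N)" by (rule mult_le_mono2)
      then have "2 * card V \<le> C * (2 * card ?N)" using C(2) by linarith
      then have "card V \<le> C * card ?N" by simp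
      then show ?thesis using card_mono[OF V XV(1)] by linarith
    qed
  qed (use fin in auto)
  then obtain \<phi> where \<phi>: "\<And>z. z \<in> R - \<mu> ` Y \<Longrightarrow> \<phi> z \<in> nbr E z \<inter> Y" "\<And>y. card {z \<in> R - \<mu> ` Y. \<phi> z = y} \<le> C"
    by blast
  obtain \<sigma> where \<sigma>: "\<And>y. y \<in> Y \<Longrightarrow> \<sigma> y \<in> S \<and> {y, \<sigma> y} \<in> E" using Y(3) by metis
  show ?thesis
  proof (rule gather_reserved[where \<sigma> = \<sigma> and \<mu> = \<mu> and \<phi> = \<phi> and R = R and B = B])
    show "V - T - Y = R \<union> B" "R \<inter> B = {}" using B by (auto simp: R_def)
    show "\<mu> x \<in> R \<and> {x, \<mu> x} \<in> E" if "x \<in> B \<union> Y" for x using \<mu>(2)[OF that] W by (auto simp: nbr_def)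
    show "\<phi> z \<in> Y \<and> {z, \<phi> z} \<in> E" if "z \<in> R - \<mu> ` Y" for z using \<phi>(1)[OF that] by (auto simp: nbr_def)
    show "card (nbr E s \<inter> V) \<le> \<Delta>" if "s \<in> S" for s using that S T(2,3) by (intro deg) auto
  qed (use V T YT \<sigma> \<mu>(1) \<phi>(2) K M in auto)
qed

definition skeleton_in :: "nat set set \<Rightarrow> nat set \<Rightarrow> nat \<Rightarrow> nat \<Rightarrow> real \<Rightarrow> real \<Rightarrow> real \<Rightarrow> nat \<Rightarrow> nat set \<Rightarrow> nat set
  \<Rightarrow> bool" where
  "skeleton_in X V' K M s \<tau> a r T S \<longleftrightarrow> T \<subseteq> V' \<and> S \<subseteq> T \<and> s \<le> real (card S) \<and> \<tau> \<le> real (card (V' - T)) \<and>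
     (\<forall>E. X \<subseteq> E \<longrightarrow> flexible E K M r T S) \<and> (\<forall>x\<in>V'. a \<le> deg X x (V' - T))"

text \<open>Only edges inside \<open>V'\<close> are consulted, so tree and bottoms can be chosen
  before any other edge is revealed.\<close>

abbreviation has_skeleton :: "nat set set \<Rightarrow> nat set \<Rightarrow> nat \<Rightarrow> nat \<Rightarrow> real \<Rightarrow> real \<Rightarrow> real \<Rightarrow> bool" where
  "has_skeleton E V' K M s \<tau> a \<equiv> \<exists>r T S. skeleton_in (E \<inter> all_edges V') V' K M s \<tau> a r T S"

text \<open>The size of \<open>Y\<close> is prescribed exactly because it is used from both sides:
  sparseness needs \<open>Y\<close> small, bounded multiplicity needs it large.\<close>

definition completed :: "nat set set \<Rightarrow> nat set \<Rightarrow> nat set \<Rightarrow> nat \<Rightarrow> nat \<Rightarrow> nat \<Rightarrow> real \<Rightarrow> real \<Rightarrow> real \<Rightarrow> bool" where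
  "completed E V' Z K M g \<beta> \<theta> a \<longleftrightarrow> (\<exists>r T S Y. T \<subseteq> V' \<and> Y \<subseteq> Z \<and> card Y = g \<and> (\<forall>y\<in>Y. \<exists>s\<in>S. {y, s} \<in> E) \<and>
     flexible E K M r T S \<and> attachable E (V' \<union> Z) V' T Y \<beta> \<theta> a)"

text \<open>Three exposures: edges inside \<open>V'\<close> fix the tree, edges between
  \<open>S\<close> and \<open>Z\<close> fix \<open>Y\<close>, all others are left for
  \<open>attachable_prob\<close>. The skeleton and covering conditions belong to the event, so
  exposed parts violating them contribute nothing.\<close>

lemma completed_prob:
  fixes a c \<gamma> \<beta> \<theta> \<tau> \<rho> s :: real and g :: nat
  assumes V: "V' \<union> Z = {1..n}" "V' \<inter> Z = {}"
    and p: "0 \<le> edge_prob c n" "edge_prob c n \<le> 1" "1 \<le> n" "1 \<le> ln n"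
    and g: "\<gamma> * n \<le> real g" "real g < \<gamma> * n + 1" and a: "0 < a"
    and \<omega>: "1 \<le> (\<gamma> * c / 2 - \<beta> * ln 2) * ln n" and \<theta>: "0 < \<theta>" and \<rho>: "0 < \<rho>" "\<rho> \<le> 1"
    and b: "b = exp 1 * exp (- (\<gamma> * c / 2 - \<beta> * ln 2) * ln n) / \<theta>
      + real n * (exp 1 * exp (- ((1 - \<rho>) * c * \<tau> + a * ln \<rho>) * ln n))
      + real n * (2 * exp (a * ln 2 * ln n) * exp (- (a / 2) * ln n * ((\<gamma> * c / 2 - \<beta> * ln 2) * ln n - 1)))"
  shows "prob (gnp c n) {E. (has_skeleton E V' K M s (\<tau> * n) (a * ln n)) \<and>
      (covers E V' Z s (\<gamma> * n)) \<and>
      \<not> completed E V' Z K M g (\<beta> * ln n) (\<theta> * n) (a / 2 * ln n)} \<le> b"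
proof -
  let ?p = "edge_prob c n" and ?L = "ln (real n)" and ?A1 = "all_edges V'"
  let ?A = "all_edges {1..n} - ?A1"
  let ?Q = "\<lambda>E. (\<exists>r T S. skeleton_in (E \<inter> ?A1) V' K M s (\<tau> * n) (a * ?L) r T S) \<and>
      (covers E V' Z s (\<gamma> * n)) \<and>
      \<not> completed E V' Z K M g (\<beta> * ?L) (\<theta> * n) (a / 2 * ?L)"
  have b0: "0 \<le> b" unfolding b using \<theta> by (intro add_nonneg_nonneg) auto
  have sub: "V' \<subseteq> {1..n}" "Z \<subseteq> {1..n}" using V(1) by auto
  have fin: "finite V'" "finite Z" using sub finite_subset by blast+
  have zero: "prob (random_subset D ?p) {E. P E} \<le> b"
    if "\<And>E. E \<subseteq> D \<Longrightarrow> \<not> P E" for D :: "nat set set" and P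
  proof -
    have "prob (random_subset D ?p) {E. P E} \<le> prob (random_subset D ?p) {}"
      using that set_random_subset[of D ?p] by (intro measure_pmf.finite_measure_mono_AE) (auto simp:
        AE_measure_pmf_iff)
    then show ?thesis using b0 by simp
  qed
  have "prob (random_subset (?A1 \<union> ?A) ?p) {E. ?Q E} \<le> b"
  proof (rule prob_random_subset_reveal)
    fix X assume X: "X \<subseteq> ?A1"
    have X_eq: "(X \<union> E) \<inter> ?A1 = X" if "E \<subseteq> ?A" for E using X that by blast
    show "prob (random_subset ?A ?p) {E. ?Q (X \<union> E)} \<le> b"
    proof (cases "\<exists>r T S. skeleton_in X V' K M s (\<tau> * n) (a * ?L) r T S")
      case False
      then show ?thesis by (intro zero) (simp add: X_eq)
    next
      case True
      then obtain r T S where sk: "skeleton_in X V' K M s (\<tau> * n) (a * ?L) r T S" by blast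
      then have TS: "T \<subseteq> V'" "S \<subseteq> T" "s \<le> real (card S)" "\<tau> * n \<le> real (card (V' - T))"
        and flex: "\<And>E. X \<subseteq> E \<Longrightarrow> flexible E K M r T S"
        and degX: "\<And>x. x \<in> V' \<Longrightarrow> a * ?L \<le> deg X x (V' - T)"
        by (auto simp: skeleton_in_def)
      have SV: "S \<subseteq> V'" using TS by auto
      let ?A2 = "cross S Z"
      have A2: "?A2 \<subseteq> ?A"
      proof
        fix e assume "e \<in> ?A2"
        then obtain x z where e: "e = {x, z}" "x \<in> S" "z \<in> Z" by (auto simp: cross_def)
        then have "x \<in> {1..n}" "z \<in> {1..n}" "x \<noteq> z" "z \<notin> V'" using SV sub V(2) by auto
        then show "e \<in> ?A" by (auto simp: e all_edges_def)
      qed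
      \<comment> \<open>The last exposure does not affect which vertices of \<open>Z\<close> have a
        neighbour in \<open>S\<close>, so \<open>Y\<close> may be chosen before it.\<close>
      have nbr_eq: "Z \<inter> (\<Union>x\<in>S. nbr (X \<union> (X1 \<union> E)) x) = Z \<inter> (\<Union>x\<in>S. nbr (X \<union> X1) x)"
        if "E \<subseteq> ?A - ?A2" for X1 E
        using that by (auto simp: nbr_def cross_def)
      have "prob (random_subset (?A2 \<union> (?A - ?A2)) ?p) {E. ?Q (X \<union> E)} \<le> b"
      proof (rule prob_random_subset_reveal)
        fix X1 assume X1: "X1 \<subseteq> ?A2"
        let ?N = "Z \<inter> (\<Union>x\<in>S. nbr (X \<union> X1) x)"
        show "prob (random_subset (?A - ?A2) ?p) {E. ?Q (X \<union> (X1 \<union> E))} \<le> b"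
        proof (cases "\<gamma> * n \<le> real (card ?N)")
          case False
          show ?thesis
          proof (rule zero)
            fix E assume "E \<subseteq> ?A - ?A2"
            from nbr_eq[OF this, of X1] False SV TS(3) show "\<not> ?Q (X \<union> (X1 \<union> E))" by auto
          qed
        next
          case True
          then have "g \<le> card ?N" using g(2) by linarith
          then obtain Y where Y: "Y \<subseteq> ?N" "card Y = g"
            by (rule obtain_subset_with_card_n) (rule that)
          have "prob (random_subset (?A - ?A2) ?p) {E. ?Q (X \<union> (X1 \<union> E))} \<le>
            prob (random_subset (?A - ?A2) ?p) {E. \<not> attachable ((X \<union> X1) \<union> E) {1..n} V' T Y (\<beta> * ?L) (\<theta> *
              n) (a / 2 * ?L)}"
          proof (intro measure_pmf.finite_measure_mono subsetI CollectI notI)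
            fix E assume E: "E \<in> {E. ?Q (X \<union> (X1 \<union> E))}"
              and att: "attachable ((X \<union> X1) \<union> E) {1..n} V' T Y (\<beta> * ?L) (\<theta> * n) (a / 2 * ?L)"
            have "\<forall>y\<in>Y. \<exists>s\<in>S. {y, s} \<in> X \<union> (X1 \<union> E)"
            proof
              fix y assume "y \<in> Y"
              then obtain s where "s \<in> S" "{s, y} \<in> X \<union> X1" using Y(1) by (auto simp: nbr_def)
              then show "\<exists>s\<in>S. {y, s} \<in> X \<union> (X1 \<union> E)" by (auto simp: insert_commute)
            qed
            then have "completed (X \<union> (X1 \<union> E)) V' Z K M g (\<beta> * ?L) (\<theta> * n) (a / 2 * ?L)"
              unfolding completed_def V(1)
            proof (intro exI conjI)
              show "attachable (X \<union> (X1 \<union> E)) {1..n} V' T Y (\<beta> * ?L) (\<theta> * n) (a / 2 * ?L)"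
                using att by (simp only: Un_assoc)
              show "flexible (X \<union> (X1 \<union> E)) K M r T S" by (rule flex) simp
              show "Y \<subseteq> Z" using Y(1) by blast
            qed (use TS(1) Y(2) in auto)
            then show False using E by simp
          qed simp
          also have "\<dots> \<le> b"
            unfolding b
          proof (rule attachable_prob[OF V TS(2,1) _ refl p _ TS(4) a _ \<omega> \<theta> \<rho>])
            show "Y \<subseteq> Z" using Y by auto
            show "\<gamma> * n \<le> real (card Y)" using Y g by simp
            fix x assume x: "x \<in> V'"
            have "card (nbr X x \<inter> (V' - T)) \<le> card (nbr (X \<union> X1) x \<inter> (V' - T))"
              using fin by (intro card_mono) (auto simp: nbr_def)
            then show "a * ?L \<le> deg (X \<union> X1) x (V' - T)" using degX[OF x] by linarith
          qed
          finally show ?thesis .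
        qed
      qed (use p b0 finite_subset[OF A2] in auto)
      moreover have "?A2 \<union> (?A - ?A2) = ?A" using A2 by (rule Diff_partition)
      ultimately show ?thesis by simp
    qed
  qed (use fin p b0 in auto)
  moreover have "?A1 \<union> ?A = all_edges {1..n}" using all_edges_mono[OF sub(1)] by (rule Diff_partition)
  ultimately show ?thesis by simp
qed

section \<open>Finding the skeleton\<close>

lemma nbr_restrict:
  assumes "E \<subseteq> all_edges V" "x \<in> V'" "S \<subseteq> V'"
  shows "nbr (E \<inter> all_edges V') x \<inter> S = nbr E x \<inter> S"
proof -
  have "{x, y} \<in> all_edges V'" if "{x, y} \<in> E" "y \<in> S" for y
  proof -
    have "card {x, y} = 2" using that(1) assms(1) by (auto simp: all_edges_def)
    then show ?thesis using assms(2,3) that(2) by (auto simp: all_edges_def)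
  qed
  then show ?thesis by (auto simp: nbr_def)
qed

lemma sparse_mono:
  assumes "sparse E V \<eta> l" "E' \<subseteq> E" "V' \<subseteq> V" "finite V"
  shows "sparse E' V' \<eta> l"
  unfolding sparse_def
proof (intro allI impI)
  fix X assume X: "X \<subseteq> V'" "real (card X) \<le> l"
  have fX: "finite X" by (rule finite_subset[OF order_trans[OF X(1) assms(3)] assms(4)])
  have "(\<Sum>x\<in>X. card (nbr E' x \<inter> X)) \<le> (\<Sum>x\<in>X. card (nbr E x \<inter> X))"
    using fX assms(2) by (intro sum_mono card_mono) (auto simp: nbr_def)
  then have "real (\<Sum>x\<in>X. card (nbr E' x \<inter> X)) \<le> real (\<Sum>x\<in>X. card (nbr E x \<inter> X))" by (rule of_nat_mono)
  also have "\<dots> \<le> \<eta> * real (card X)" using assms(1,3) X unfolding sparse_def by blast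
  finally show "real (\<Sum>x\<in>X. card (nbr E' x \<inter> X)) \<le> \<eta> * real (card X)" .
qed

text \<open>\<open>\<rho> = \<alpha> / m\<close> is the optimal choice, and positivity is the strict
  inequality \<open>ln y < y - 1\<close> at \<open>y = m / \<alpha>\<close>, which differs from
  1.\<close>

lemma chernoff_exponent_pos:
  fixes \<alpha> m :: real
  assumes "0 < \<alpha>" "\<alpha> < m"
  shows "\<exists>\<rho>>0. \<rho> \<le> 1 \<and> 0 < (1 - \<rho>) * m + \<alpha> * ln \<rho>"
proof (intro exI conjI)
  let ?\<rho> = "\<alpha> / m"
  show "0 < ?\<rho>" "?\<rho> \<le> 1" using assms by auto
  have "ln (m / \<alpha>) < m / \<alpha> - 1"
    using ln_le_minus_one[of "m / \<alpha>"] ln_eq_minus_one[of "m / \<alpha>"] assms by fastforce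
  then have "\<alpha> * ln (m / \<alpha>) < \<alpha> * (m / \<alpha> - 1)" using assms by (intro mult_strict_left_mono) auto
  also have "\<dots> = m - \<alpha>" using assms by (simp add: right_diff_distrib)
  finally have "\<alpha> * ln (m / \<alpha>) < m - \<alpha>" .
  moreover have "ln ?\<rho> = - ln (m / \<alpha>)" using assms by (simp add: ln_div)
  moreover have "(1 - ?\<rho>) * m = m - \<alpha>" using assms by (simp add: field_simps)
  ultimately show "0 < (1 - ?\<rho>) * m + \<alpha> * ln ?\<rho>" by simp
qed

text \<open>After losing the share \<open>\<epsilon> / 4\<close> of the vertices the coefficient is
  still at least \<open>1 / ln 2 \<ge> 36 / 25\<close>, well above the connectivity threshold 1. So
  a crude \<open>\<rho> = 1 / 10\<close> suffices:
  \<open>9 / 10 * 36 / 25 - 4 / 20 > 1\<close>.\<close>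

lemma min_degree_exponent:
  fixes \<epsilon> c a :: real
  assumes \<epsilon>: "0 < \<epsilon>" "\<epsilon> \<le> 1" and c: "c = (1 + \<epsilon>) / ln 2" and a: "0 < a" "a \<le> 1 / 20"
  shows "1 < (1 - 1 / 10) * c * (1 - \<epsilon> / 4) + a * ln (1 / 10)"
proof -
  have l2: "0 < ln (2::real)" "ln (2::real) \<le> 25 / 36" using ln2_le_25_over_36 by auto
  have "1 \<le> (1 + \<epsilon>) * (1 - \<epsilon> / 4)"
    using \<epsilon> mult_left_mono[of \<epsilon> 1 \<epsilon>] by (simp add: algebra_simps)
  then have le: "1 / ln 2 \<le> ((1 + \<epsilon>) * (1 - \<epsilon> / 4)) / ln 2" using l2 by (intro divide_right_mono) auto
  have "36 / 25 \<le> 1 / ln (2::real)" using l2 by (simp add: field_simps)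
  also note le
  also have "((1 + \<epsilon>) * (1 - \<epsilon> / 4)) / ln 2 = c * (1 - \<epsilon> / 4)" by (simp add: c)
  finally have c1: "36 / 25 \<le> c * (1 - \<epsilon> / 4)" .
  have "ln 10 \<le> ln (2 ^ 4 :: real)" by simp
  then have "ln (10::real) \<le> 4" using l2
    by (simp add: ln_realpow del: power_numeral numeral_power_eq_of_nat_cancel_iff)
  then have "a * ln 10 \<le> 1 / 20 * 4" using a by (intro mult_mono) auto
  moreover have "1 < 9 / 10 * u - v" if "36 / 25 \<le> u" "v \<le> 1 / 20 * 4" for u v :: real using that by argo
  ultimately have "1 < 9 / 10 * (c * (1 - \<epsilon> / 4)) - a * ln 10" using c1 by blast
  also have "\<dots> = (1 - 1/10) * c * (1 - \<epsilon> / 4) + a * ln (1 / 10)" by (simp add: ln_div)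
  finally show ?thesis .
qed

text \<open>The reserved vertices form an initial segment; the next segment of the same length
  serves as \<open>Z\<close> in \<open>skeleton_embedding\<close> and the rest as
  \<open>U\<close>.\<close>

definition block :: "real \<Rightarrow> nat \<Rightarrow> nat" where
  "block \<epsilon> n = nat \<lceil>\<epsilon> / 8 * real n\<rceil>"

abbreviation reserve :: "real \<Rightarrow> nat \<Rightarrow> nat set" where
  "reserve \<epsilon> n \<equiv> {1..block \<epsilon> n}"

abbreviation core :: "real \<Rightarrow> nat \<Rightarrow> nat set" where
  "core \<epsilon> n \<equiv> {Suc (block \<epsilon> n)..n}"

lemma block_bounds: "0 \<le> \<epsilon> \<Longrightarrow> \<epsilon> / 8 * real n \<le> real (block \<epsilon> n)" "0 \<le> \<epsilon> \<Longrightarrow> real (block \<epsilon> n) \<le>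
  \<epsilon> / 8 * real n + 1"
proof -
  assume "0 \<le> \<epsilon>"
  then have "0 \<le> \<epsilon> / 8 * real n" by simp
  then show "\<epsilon> / 8 * real n \<le> real (block \<epsilon> n)" "real (block \<epsilon> n) \<le> \<epsilon> / 8 * real n + 1"
    unfolding block_def by linarith+
qed

lemma whp_skeleton:
  fixes \<epsilon> c a C0 :: real and M :: "nat \<Rightarrow> nat" and t0 K :: nat
  assumes \<epsilon>: "0 < \<epsilon>" "\<epsilon> \<le> 1" and c: "c = (1 + \<epsilon>) / ln 2"
    and a: "0 < a" "a \<le> 1 / 20" "a \<le> c * \<epsilon> / 32"
    and K: "K \<le> 2 ^ t0" and C0: "0 < C0" and M: "\<forall>\<^sub>F n in sequentially. real (2 ^ t0 + M n) \<le> C0 * ln n"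
  shows "whp c (\<lambda>n E. has_skeleton E (core \<epsilon> n) K (M n) (n / (4 * ln n)) ((1 - \<epsilon> / 4) * n) (a * ln n))"
proof -
  have l2: "0 < ln (2::real)" "ln (2::real) \<le> 25 / 36" using ln2_le_25_over_36 by auto
  have ln_le: "y \<le> y / ln 2" if "0 \<le> y" for y :: real
    using that l2 mult_left_le[of "ln 2" y] by (simp add: le_divide_eq)
  have c_ge: "1 \<le> c"
  proof -
    have "ln 2 \<le> 1 + \<epsilon>" using l2 \<epsilon> by linarith
    then show ?thesis using l2 by (simp add: c)
  qed
  then have c0: "0 < c" by simp
  \<comment> \<open>In units of \<open>ln n / ln 2\<close>: tree degrees are at most
    \<open>1 + \<epsilon> / 32\<close>, \<open>D\<close> is about
    \<open>1 + \<epsilon> / 16\<close>, \<open>e\<close> about \<open>\<epsilon> / 16\<close>,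
    \<open>h\<close> is \<open>1 + 3 * \<epsilon> / 16\<close>, and \<open>\<alpha> * ln n\<close>
    is \<open>h\<close> plus twice the peeling bound \<open>\<epsilon> / 32\<close>. Mean degrees
    into \<open>U\<close> are about \<open>(1 + \<epsilon>) * (1 - \<epsilon> / 3)\<close> or more,
    still above this.\<close>
  define \<alpha> where "\<alpha> = (1 + \<epsilon> / 4) / ln 2"
  define Low where "Low n E = {x\<in>{1..n}. deg E x {Suc (2 * block \<epsilon> n)..n} \<le> \<alpha> * ln n}" for n E
  define Q where "Q n E = {x\<in>{1..n}. deg E x {Suc (block \<epsilon> n)..2 * block \<epsilon> n} \<le> a * ln n}" for n E
  have blocks: "\<forall>\<^sub>F n in sequentially. 2 * block \<epsilon> n \<le> n \<and> (1 - \<epsilon> / 3) * n \<le> real (n - 2 * block \<epsilon> n)"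
  proof -
    have "\<forall>\<^sub>F n::nat in sequentially. 2 \<le> \<epsilon> / 12 * n" using \<epsilon> by real_asymp
    then show ?thesis
    proof eventually_elim
      case (elim n)
      have le: "real (2 * block \<epsilon> n) \<le> \<epsilon> / 4 * n + 2" using block_bounds(2)[of \<epsilon> n] \<epsilon> by simp
      have "\<epsilon> * n \<le> 1 * real n" using \<epsilon> by (intro mult_right_mono) auto
      then have "real (2 * block \<epsilon> n) \<le> real n" using le elim by simp
      then have "2 * block \<epsilon> n \<le> n" by (simp only: of_nat_le_iff)
      then show ?case using le elim by (simp add: of_nat_diff algebra_simps)
    qed
  qed
  obtain \<theta>3 :: real where \<theta>3: "0 < \<theta>3" "whp c (\<lambda>n E. sparse E {1..n} (\<epsilon> / 80 * ln n) (\<theta>3 * n))"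
    using whp_sparse[OF c0, of "\<epsilon> / 80"] \<epsilon> by auto
  define D where "D n = nat \<lfloor>(1 + \<epsilon> / 16) * (ln (real n) / ln 2)\<rfloor>" for n
  define e where "e n = nat \<lfloor>\<epsilon> / 16 * (ln (real n) / ln 2)\<rfloor>" for n
  define h where "h n = (1 + 3 * \<epsilon> / 16) * (ln (real n) / ln 2)" for n
  have De: "\<forall>\<^sub>F n in sequentially. (1 + \<epsilon> / 32) * (ln n / ln 2) \<le> real (D n) \<and> \<epsilon> / 16 * ln n \<le> real (e n) \<and>
      real (D n) + real (e n) \<le> (1 + \<epsilon> / 8) * (ln n / ln 2) \<and> 1 \<le> ln (real n)"
  proof -
    have "\<forall>\<^sub>F n::nat in sequentially. 1 \<le> \<epsilon> / 32 * (ln n / ln 2)" using \<epsilon> by real_asymp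
    moreover have "\<forall>\<^sub>F n::nat in sequentially. 1 \<le> ln n" by real_asymp
    moreover have "\<forall>\<^sub>F n::nat in sequentially. 1 \<le> \<epsilon> / 16 * (ln n / ln 2) - \<epsilon> / 16 * ln n"
    proof -
      define w where "w = \<epsilon> / 16 * (1 / ln 2 - 1)"
      have "0 < w" using \<epsilon> l2 by (simp add: w_def)
      then have "\<forall>\<^sub>F n::nat in sequentially. 1 \<le> w * ln n" by real_asymp
      then show ?thesis by eventually_elim (simp add: w_def algebra_simps)
    qed
    ultimately show ?thesis
    proof eventually_elim
      case (elim n)
      have "0 \<le> (1 + \<epsilon> / 16) * (ln n / ln 2)" "0 \<le> \<epsilon> / 16 * (ln n / ln 2)" using elim(2) \<epsilon> l2 by auto
      then have fl: "real (D n) \<le> (1 + \<epsilon> / 16) * (ln n / ln 2)" "(1 + \<epsilon> / 16) * (ln n / ln 2) - 1 \<le>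
        real (D n)"
        "real (e n) \<le> \<epsilon> / 16 * (ln n / ln 2)" "\<epsilon> / 16 * (ln n / ln 2) - 1 \<le> real (e n)"
        unfolding D_def e_def by linarith+
      have eq: "(1 + \<epsilon> / 16) * (ln n / ln 2) = (1 + \<epsilon> / 32) * (ln n / ln 2) + \<epsilon> / 32 * (ln n / ln 2)"
        "(1 + \<epsilon> / 8) * (ln n / ln 2) = (1 + \<epsilon> / 16) * (ln n / ln 2) + \<epsilon> / 16 * (ln n / ln 2)"
        by (simp_all add: algebra_simps)
      have "v \<le> d \<and> y \<le> e' \<and> d + e' \<le> t" if "d \<le> w" "w - 1 \<le> d" "e' \<le> u" "u - 1 \<le> e'"
        "w = v + u'" "t = w + u" "1 \<le> u'" "1 \<le> u - y" for d e' u u' v w t y :: real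
        using that by linarith
      from this[OF fl eq elim(1,3)] elim(2) show ?case by simp
    qed
  qed
  have "\<exists>\<kappa>::real. 0 < \<kappa> \<and> (\<forall>A h. (\<forall>\<^sub>F n in sequentially. ln (real n) \<le> real (A n) \<and> real (A n) \<le>
    c * ln (real n) \<and> (1 + \<epsilon> / 32) * real (A n) \<le> h n) \<longrightarrow>
    whp c (\<lambda>n E. expanding E {1..n} (\<kappa> * (n / ln n)) (A n) (h n)))"
    using \<epsilon> c_ge by (intro whp_sparse_pairs) auto
  then obtain \<kappa> :: real where \<kappa>: "0 < \<kappa>" "\<And>A h. \<forall>\<^sub>F n in sequentially. ln (real n) \<le> real (A n) \<and>
    real (A n) \<le> c * ln (real n) \<and> (1 + \<epsilon> / 32) * real (A n) \<le> h n \<Longrightarrow>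
    whp c (\<lambda>n E. expanding E {1..n} (\<kappa> * (n / ln n)) (A n) (h n))"
    by (elim exE conjE) (rule that, auto)
  have pairs: "whp c (\<lambda>n E. expanding E {1..n} (\<kappa> * (n / ln n)) (D n + e n) (h n))"
  proof (rule \<kappa>(2))
    show "\<forall>\<^sub>F n in sequentially. ln (real n) \<le> real (D n + e n) \<and> real (D n + e n) \<le> c * ln (real n) \<and>
      (1 + \<epsilon> / 32) * real (D n + e n) \<le> h n"
      using De
    proof eventually_elim
      case (elim n)
      define l where "l = ln (real n) / ln 2"
      note De = elim[folded l_def]
      have l: "ln (real n) \<le> l" "0 \<le> l" using ln_le[of "ln (real n)"] De l2 by (auto simp: l_def)
      note l(1)
      also have "l = 1 * l" by simp
      also have "1 * l \<le> (1 + \<epsilon> / 32) * l" using l(2) \<epsilon> by (intro mult_right_mono) auto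
      also have "\<dots> \<le> real (D n)" using De by blast
      also have "\<dots> \<le> real (D n + e n)" by simp
      finally have 1: "ln (real n) \<le> real (D n + e n)" .
      have "(1 + \<epsilon> / 8) * l \<le> (1 + \<epsilon>) * l" using l(2) \<epsilon> by (intro mult_right_mono) auto
      moreover have "(1 + \<epsilon>) * l = c * ln (real n)" by (simp add: c l_def)
      ultimately have 2: "real (D n + e n) \<le> c * ln (real n)" using De by simp
      have "(1 + \<epsilon> / 32) * real (D n + e n) \<le> (1 + \<epsilon> / 32) * ((1 + \<epsilon> / 8) * l)"
        using De \<epsilon> by (intro mult_left_mono) auto
      also have "\<dots> = ((1 + \<epsilon> / 32) * (1 + \<epsilon> / 8)) * l" by (simp only: mult.assoc)
      also have "\<dots> \<le> (1 + 3 * \<epsilon> / 16) * l"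
      proof (rule mult_right_mono)
        have "\<epsilon> * \<epsilon> \<le> 1 * \<epsilon>" using \<epsilon> by (intro mult_right_mono) auto
        then show "(1 + \<epsilon> / 32) * (1 + \<epsilon> / 8) \<le> 1 + 3 * \<epsilon> / 16" using \<epsilon> by (simp add: algebra_simps)
      qed (rule l(2))
      finally show ?case using 1 2 by (simp add: h_def l_def)
    qed
  qed
  have low: "whp c (\<lambda>n E. real (card (Low n E)) \<le> n / ln n ^ 2)"
  proof -
    have "\<alpha> < c * (1 - \<epsilon> / 3)"
    proof -
      have "\<epsilon> * \<epsilon> \<le> 1 * \<epsilon>" using \<epsilon> by (intro mult_right_mono) auto
      moreover have "\<epsilon> / 4 + (\<epsilon> + q) / 3 < \<epsilon>" if "q \<le> 1 * \<epsilon>" for q using that \<epsilon> by argo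
      ultimately have "\<epsilon> / 4 + (\<epsilon> + \<epsilon> * \<epsilon>) / 3 < \<epsilon>" by blast
      moreover have "(1 + \<epsilon>) * (1 - \<epsilon> / 3) = 1 + \<epsilon> - (\<epsilon> + \<epsilon> * \<epsilon>) / 3"
        by (simp add: algebra_simps add_divide_distrib)
      ultimately have "1 + \<epsilon> / 4 < (1 + \<epsilon>) * (1 - \<epsilon> / 3)" by linarith
      then have "(1 + \<epsilon> / 4) / ln 2 < (1 + \<epsilon>) * (1 - \<epsilon> / 3) / ln 2" using l2
        by (intro divide_strict_right_mono) auto
      then show ?thesis by (simp add: \<alpha>_def c)
    qed
    moreover have "0 < \<alpha>" using \<epsilon> l2 by (simp add: \<alpha>_def)
    ultimately obtain \<rho> where \<rho>: "0 < \<rho>" "\<rho> \<le> 1" "0 < (1 - \<rho>) * (c * (1 - \<epsilon> / 3)) + \<alpha> * ln \<rho>"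
      using chernoff_exponent_pos by blast
    show ?thesis
      unfolding Low_def
    proof (rule whp_few_low_degrees[OF c0 _ \<rho>(1,2)])
      show "\<forall>\<^sub>F n in sequentially. {Suc (2 * block \<epsilon> n)..n} \<subseteq> {1..n} \<and> (1 - \<epsilon> / 3) * n \<le>
        real (card {Suc (2 * block \<epsilon> n)..n})"
        using blocks by eventually_elim auto
      show "0 < (1 - \<rho>) * c * (1 - \<epsilon> / 3) + \<alpha> * ln \<rho>" using \<rho>(3) by (simp add: mult.assoc)
    qed
  qed
  have Q: "whp c (\<lambda>n E. real (card (Q n E)) \<le> n / ln n ^ 2)"
    unfolding Q_def
  proof (rule whp_few_low_degrees[OF c0, where \<rho> = "1/2" and t = "\<epsilon> / 8"])
    show "\<forall>\<^sub>F n in sequentially. {Suc (block \<epsilon> n)..2 * block \<epsilon> n} \<subseteq> {1..n} \<and> \<epsilon> / 8 * n \<le>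
      real (card {Suc (block \<epsilon> n)..2 * block \<epsilon> n})"
      using blocks by eventually_elim (use block_bounds(1)[of \<epsilon>] \<epsilon> in auto)
    \<comment> \<open>The exponent is \<open>c * \<epsilon> / 16 - a * ln 2\<close>; here
      \<open>a \<le> c * \<epsilon> / 32\<close> is used.\<close>
    have "a * ln 2 \<le> (c * \<epsilon> / 32) * 1" using a l2 c0 \<epsilon> by (intro mult_mono) auto
    moreover have "0 < c * \<epsilon>" using c0 \<epsilon> by simp
    ultimately show "0 < (1 - 1/2) * c * (\<epsilon> / 8) + a * ln (1 / 2)" by (simp add: ln_div)
  qed auto
  have mindeg: "whp c (\<lambda>n E. \<forall>x\<in>{1..n}. a * ln n < deg E x (core \<epsilon> n))"
  proof (rule whp_min_degree[OF c0, where \<rho> = "1/10" and t = "1 - \<epsilon> / 4"])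
    have "\<forall>\<^sub>F n::nat in sequentially. 1 \<le> \<epsilon> / 8 * n" using \<epsilon> by real_asymp
    with blocks show "\<forall>\<^sub>F n in sequentially. (core \<epsilon> n) \<subseteq> {1..n} \<and> (1 - \<epsilon> / 4) * n \<le> real (card (core \<epsilon> n))"
    proof eventually_elim
      case (elim n)
      then show ?case using block_bounds(2)[of \<epsilon> n] \<epsilon> by (auto simp: of_nat_diff algebra_simps)
    qed
    show "1 < (1 - 1/10) * c * (1 - \<epsilon> / 4) + a * ln (1 / 10)"
      using \<epsilon> c a(1,2) by (rule min_degree_exponent)
  qed auto
  define m where "m n = nat \<lfloor>\<kappa> * n / (2 * ln (real n))\<rfloor>" for n
  \<comment> \<open>\<open>e n * m n\<close> is at least \<open>\<epsilon> / 16 * ln n\<close> times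
    \<open>\<kappa> * n / (4 * ln n)\<close>, hence the first bound; the second keeps most of the
    core off the tree.\<close>
  define \<zeta> where "\<zeta> = min (\<epsilon> * \<kappa> / 64) (\<epsilon> / 16)"
  have \<zeta>: "0 < \<zeta>" using \<epsilon> \<kappa> by (simp add: \<zeta>_def)
  let ?typ = "\<lambda>(n::nat) E. ((((sparse E {1..n} (\<epsilon> / 80 * ln n) (\<theta>3 * n) \<and>
    (\<forall>x\<in>{1..n}. deg E x {1..n} \<le> (2 * c + 2) * ln n)) \<and> expanding E {1..n} (\<kappa> * (n / ln n)) (D n + e n) (h
      n)) \<and>
    real (card (Low n E)) \<le> n / ln n ^ 2) \<and> real (card (Q n E)) \<le> n / ln n ^ 2) \<and>
    (\<forall>x\<in>{1..n}. a * ln n < deg E x (core \<epsilon> n))"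
  have "whp c (\<lambda>n E. ?typ n E)"
    by (rule whp_conj[OF whp_conj[OF whp_conj[OF whp_conj[OF whp_conj[OF \<theta>3(2) whp_max_degree[OF c0]] pairs]
      low] Q] mindeg])
  then show ?thesis
  proof (rule whp_mono)
    have "\<forall>\<^sub>F n::nat in sequentially. 2 * (2 * (n / ln n ^ 2) + n / ln n ^ 2 * ((2 * c + 2) * ln n)) \<le> \<theta>3 * n"
      using \<theta>3(1) c0 by real_asymp
    moreover have "\<forall>\<^sub>F n::nat in sequentially. 2 * (2 * (n / ln n ^ 2) + n / ln n ^ 2 * ((2 * c +
      2) * ln n)) < 2 / 3 * n"
      using c0 by real_asymp
    moreover have "\<forall>\<^sub>F n::nat in sequentially. 4 \<le> \<kappa> * n / ln n" using \<kappa>(1) by real_asymp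
    moreover have "\<forall>\<^sub>F n::nat in sequentially. \<kappa> * n / ln n \<le> \<theta>3 * n" using \<kappa>(1) \<theta>3(1) by real_asymp
    moreover have "\<forall>\<^sub>F n::nat in sequentially. 1 \<le> \<epsilon> / 16 * n" using \<epsilon> by real_asymp
    moreover have "\<forall>\<^sub>F n in sequentially. \<forall>M. real (2 ^ t0 + M) \<le> C0 * ln n \<longrightarrow>
      (\<exists>ks. real n / (4 * ln n) \<le> real (prod_list ks) \<and> real (sz (skel t0 M ks)) \<le> \<zeta> * n \<and>
       real (max_deg (skel t0 M ks)) \<le> (1 + \<epsilon> / 32) * (ln n / ln 2))"
      using \<epsilon> by (intro skeleton_exists[OF C0 \<zeta>]) auto
    ultimately show "\<forall>\<^sub>F n in sequentially. \<forall>E\<subseteq>all_edges {1..n}. (?typ n E) \<longrightarrow>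
     (has_skeleton E (core \<epsilon> n) K (M n) (n / (4 * ln n)) ((1 - \<epsilon> / 4) * n) (a * ln n))"
      using M blocks De
    proof eventually_elim
      case (elim n)
      show ?case
      proof (intro allI impI)
        fix E assume E: "E \<subseteq> all_edges {1..n}"
        assume "?typ n E"
        then have sp: "sparse E {1..n} (\<epsilon> / 80 * ln n) (\<theta>3 * n)"
          and md: "\<And>x. x \<in> {1..n} \<Longrightarrow> deg E x {1..n} \<le> (2 * c + 2) * ln n"
          and pr: "\<And>X Y. X \<subseteq> {1..n} \<Longrightarrow> Y \<subseteq> {1..n} \<Longrightarrow> X \<inter> Y = {} \<Longrightarrow> X \<noteq> {} \<Longrightarrow> real (card X) \<le> \<kappa> * (n / ln n) \<Longrightarrow>
            card Y \<le> (D n + e n) * card X \<Longrightarrow> real (\<Sum>x\<in>X. card (nbr E x \<inter> Y)) < h n * real (card X)"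
          and lw: "real (card (Low n E)) \<le> n / ln n ^ 2" and q: "real (card (Q n E)) \<le> n / ln n ^ 2"
          and dg: "\<And>x. x \<in> {1..n} \<Longrightarrow> a * ln n < deg E x (core \<epsilon> n)"
          by (simp_all only: atLeastAtMost_iff) blast+
        let ?z = "block \<epsilon> n"
        let ?V = "{Suc ?z..n}" and ?U = "{Suc (2 * ?z)..n}" and ?Z = "{Suc ?z..2 * ?z}"
        let ?E = "E \<inter> all_edges ?V" and ?Q = "Q n E \<inter> ?V"
        have VU: "?V = ?U \<union> ?Z" "?U \<inter> ?Z = {}" using elim(8) by auto
        have sub: "?V \<subseteq> {1..n}" "?U \<subseteq> ?V" "?Z \<subseteq> ?V" using VU by auto
        have nb: "nbr ?E x \<inter> S = nbr E x \<inter> S" if "x \<in> ?V" "S \<subseteq> ?V" for x S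
          by (rule nbr_restrict[OF E that])
        obtain ks where ks: "real n / (4 * ln n) \<le> real (prod_list ks)" "real (sz (skel t0 (M n) ks)) \<le> \<zeta> * n"
          "real (max_deg (skel t0 (M n) ks)) \<le> (1 + \<epsilon> / 32) * (ln n / ln 2)"
          using elim(6,7) by blast
        have L: "1 \<le> ln (real n)" and lpos: "0 \<le> ln n / ln 2" using elim(9) l2 by auto
        have m: "real (m n) \<le> \<kappa> * n / (2 * ln n)" "\<kappa> * n / (4 * ln n) \<le> real (m n)"
        proof -
          have "0 \<le> \<kappa> * n / (2 * ln n)" "1 \<le> \<kappa> * n / (4 * ln n)" "\<kappa> * n / (2 * ln n) =
            2 * (\<kappa> * n / (4 * ln n))"
            using elim(3) L \<kappa>(1) by (auto simp: field_simps)
          then show "real (m n) \<le> \<kappa> * n / (2 * ln n)" "\<kappa> * n / (4 * ln n) \<le> real (m n)"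
            unfolding m_def by linarith+
        qed
        have m2: "2 * real (m n) \<le> \<kappa> * (n / ln n)" using m(1) L by (simp add: field_simps)
        have m0: "0 < m n" using m(2) elim(3) L by (cases "m n = 0") (auto simp: field_simps)
        have "0 < \<epsilon> / 16 * ln n" using \<epsilon> L by simp
        also have "\<dots> \<le> real (e n)" using elim(9) by blast
        finally have e0: "0 < e n" by simp
        have em: "sz (skel t0 (M n) ks) \<le> e n * m n"
        proof -
          have "\<zeta> * n \<le> (\<epsilon> * \<kappa> / 64) * n" by (intro mult_right_mono) (auto simp: \<zeta>_def)
          also have "\<dots> = (\<epsilon> / 16 * ln n) * (\<kappa> * n / (4 * ln n))" using L by (simp add: field_simps)
          also have "\<dots> \<le> real (e n) * real (m n)" using elim(9) m(2) \<kappa>(1) L by (intro mult_mono) auto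
          finally have "real (sz (skel t0 (M n) ks)) \<le> real (e n * m n)" using ks(2) by simp
          then show ?thesis by (simp only: of_nat_le_iff)
        qed
        have degD: "max_deg (skel t0 (M n) ks) \<le> D n"
        proof -
          have "real (max_deg (skel t0 (M n) ks)) \<le> real (D n)" using ks(3) elim(9) by linarith
          then show ?thesis by (simp only: of_nat_le_iff)
        qed
        define F0 where "F0 = ?U \<inter> (Low n E \<union> ?Q \<union> (\<Union>x\<in>?Q. nbr ?E x))"
        have cF0: "real (card F0) \<le> 2 * (n / ln n ^ 2) + n / ln n ^ 2 * ((2 * c + 2) * ln n)"
        proof -
          have fQ: "finite (Q n E)" "finite (Low n E)" by (auto simp: Q_def Low_def)
          have "F0 \<subseteq> Low n E \<union> (Q n E \<union> (\<Union>x\<in>Q n E. nbr E x \<inter> {1..n}))"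
            using sub by (auto simp: F0_def nbr_def)
          then have "card F0 \<le> card (Low n E \<union> (Q n E \<union> (\<Union>x\<in>Q n E. nbr E x \<inter> {1..n})))"
            using fQ by (intro card_mono) auto
          also have "\<dots> \<le> card (Low n E) + card (Q n E \<union> (\<Union>x\<in>Q n E. nbr E x \<inter> {1..n}))" by (rule card_Un_le)
          also have "\<dots> \<le> card (Low n E) + (card (Q n E) + card (\<Union>x\<in>Q n E. nbr E x \<inter> {1..n}))"
            by (intro add_left_mono card_Un_le)
          also have "\<dots> \<le> card (Low n E) + (card (Q n E) + (\<Sum>x\<in>Q n E. card (nbr E x \<inter> {1..n})))"
            using fQ by (intro add_left_mono card_UN_le)
          finally have "real (card F0) \<le> real (card (Low n E)) + (real (card (Q n E)) + (\<Sum>x\<in>Q n E.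
            deg E x {1..n}))"
            by (simp flip: of_nat_sum of_nat_add)
          also have "(\<Sum>x\<in>Q n E. deg E x {1..n}) \<le> (\<Sum>x\<in>Q n E. (2 * c + 2) * ln n)"
            by (intro sum_mono md) (auto simp: Q_def)
          also have "\<dots> = real (card (Q n E)) * ((2 * c + 2) * ln n)" by simp
          also have "\<dots> \<le> n / ln n ^ 2 * ((2 * c + 2) * ln n)"
            using q c0 L by (intro mult_right_mono) auto
          finally show ?thesis using lw q by simp
        qed
        have "\<exists>v T. T \<subseteq> ?U \<and> tree_at ?E (skel t0 (M n) ks) v T \<and> (\<forall>x\<in>?V. a * ln n \<le> deg ?E x (?V - T))"
        proof (rule skeleton_embedding[OF _ VU, where l = "\<theta>3 * n" and \<eta> = "\<epsilon> / 80 * ln n"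
          and \<theta> = "\<epsilon> / 32 * (ln n / ln 2)"
            and h = "h n" and m = "m n" and D = "D n" and e = "e n" and Low = "Low n E" and Q = ?Q
              and ?F0.0 = F0])
          show "finite ?V" by simp
          show "sparse ?E ?V (\<epsilon> / 80 * ln n) (\<theta>3 * n)" by (rule sparse_mono[OF sp _ sub(1)]) auto
          show "2 * (\<epsilon> / 80 * ln n) < \<epsilon> / 32 * (ln n / ln 2)"
          proof -
            have "ln n \<le> ln n / ln 2" using ln_le[of "ln (real n)"] L by simp
            then have "\<epsilon> / 32 * ln n \<le> \<epsilon> / 32 * (ln n / ln 2)" using \<epsilon> by (intro mult_left_mono) auto
            moreover have "2 * (\<epsilon> / 80 * ln n) < \<epsilon> / 32 * ln n" using \<epsilon> L by simp
            ultimately show ?thesis by linarith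
          qed
          show "0 \<le> \<epsilon> / 80 * ln n" using \<epsilon> L by simp
          show "real (\<Sum>x\<in>X. card (nbr ?E x \<inter> Y)) < h n * real (card X)"
            if X: "X \<subseteq> ?U" "Y \<subseteq> ?U" "X \<inter> Y = {}" "X \<noteq> {}" "card X \<le> 2 * m n" "card Y \<le>
              (D n + e n) * card X" for X Y
          proof -
            have "(\<Sum>x\<in>X. card (nbr ?E x \<inter> Y)) = (\<Sum>x\<in>X. card (nbr E x \<inter> Y))"
              using X(1,2) sub(2) by (intro sum.cong arg_cong[where f = card] nb) auto
            moreover have "real (card X) \<le> \<kappa> * (n / ln n)" using X(5) m2 by linarith
            moreover have "X \<subseteq> {1..n}" "Y \<subseteq> {1..n}" using X(1,2) sub by auto
            ultimately show ?thesis using pr X by simp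
          qed
          show "h n + 2 * (\<epsilon> / 32 * (ln n / ln 2)) \<le> deg ?E x ?U" if x: "x \<in> ?U - Low n E" for x
          proof -
            have "x \<in> {1..n}" using x by auto
            then have "\<alpha> * ln n < deg E x ?U" using x by (auto simp: Low_def not_le)
            moreover have "h n + 2 * (\<epsilon> / 32 * (ln n / ln 2)) = \<alpha> * ln n"
              by (simp add: h_def \<alpha>_def field_simps)
            moreover have "nbr ?E x \<inter> ?U = nbr E x \<inter> ?U" using x sub by (intro nb) auto
            ultimately show ?thesis by simp
          qed
          show "?Q \<subseteq> ?V" by auto
          show "a * ln n \<le> deg ?E x ?Z" if x: "x \<in> ?V - ?Q" for x
          proof -
            have "nbr ?E x \<inter> ?Z = nbr E x \<inter> ?Z" using x sub by (intro nb) auto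
            moreover have "x \<in> {1..n}" "x \<notin> Q n E" using x by auto
            ultimately show ?thesis by (auto simp: Q_def not_le)
          qed
          show "a * ln n \<le> deg ?E x ?V" if x: "x \<in> ?V" for x
          proof -
            have "nbr ?E x \<inter> ?V = nbr E x \<inter> ?V" using x by (intro nb) auto
            moreover have "x \<in> {1..n}" using x by auto
            ultimately show ?thesis using dg[of x] by simp
          qed
          show "F0 = ?U \<inter> (Low n E \<union> ?Q \<union> (\<Union>x\<in>?Q. nbr ?E x))" by (rule F0_def)
          have F2: "2 * real (card F0) \<le> 2 * (2 * (n / ln n ^ 2) + n / ln n ^ 2 * ((2 * c + 2) * ln n))"
            using cF0 by (rule mult_left_mono) simp
          show "2 * real (card F0) \<le> \<theta>3 * n" by (rule order_trans[OF F2 elim(1)])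
          show "2 * card F0 < card ?U"
          proof -
            have "2 / 3 * n \<le> (1 - \<epsilon> / 3) * n" using \<epsilon> by (intro mult_right_mono) auto
            also have "\<dots> \<le> real (n - 2 * ?z)" using elim(8) by blast
            finally have "2 * real (card F0) < real (n - 2 * ?z)" using le_less_trans[OF F2 elim(2)]
              by linarith
            then have "real (2 * card F0) < real (n - 2 * ?z)" by simp
            then have "2 * card F0 < n - 2 * ?z" by (simp only: of_nat_less_iff)
            then show ?thesis by simp
          qed
          show "2 * real (m n) \<le> \<theta>3 * n" using m2 elim(4) by simp
        qed (use m0 e0 em degD in auto)
        then obtain v T where T: "T \<subseteq> ?U" "tree_at ?E (skel t0 (M n) ks) v T"
          "\<And>x. x \<in> ?V \<Longrightarrow> a * ln n \<le> deg ?E x (?V - T)" by blast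
        obtain S where S: "card S = prod_list ks" "\<And>E'. ?E \<subseteq> E' \<Longrightarrow> flexible E' K (M n) v T S"
          using skel_flexible[OF T(2) K] by blast
        have "skeleton_in ?E ?V K (M n) (n / (4 * ln n)) ((1 - \<epsilon> / 4) * n) (a * ln n) v T S"
          unfolding skeleton_in_def
        proof (intro conjI allI impI ballI)
          show TV: "T \<subseteq> ?V" using T(1) sub by auto
          show "S \<subseteq> T" using S(2)[OF order_refl] by (simp add: flexible_def)
          show "n / (4 * ln n) \<le> real (card S)" using ks(1) S(1) by simp
          have fT: "finite T" by (rule finite_subset[OF TV]) simp
          have "real (card T) \<le> \<epsilon> / 16 * n"
          proof -
            have "\<zeta> * n \<le> \<epsilon> / 16 * n" by (intro mult_right_mono) (auto simp: \<zeta>_def)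
            then show ?thesis using ks(2) tree_at_card[OF T(2)] by simp
          qed
          moreover have "card ?V - card T \<le> card (?V - T)" using fT by (rule diff_card_le_card_Diff)
          moreover have "real (card ?V) = real n - real ?z" using elim(8) by (simp add: of_nat_diff)
          moreover have "(1 - \<epsilon> / 4) * n = n - \<epsilon> / 8 * n - \<epsilon> / 16 * n - \<epsilon> / 16 * n"
            by (simp add: algebra_simps)
          ultimately show "(1 - \<epsilon> / 4) * n \<le> real (card (?V - T))"
            using block_bounds(2)[of \<epsilon> n] \<epsilon> elim(5) by linarith
        qed (use S T in auto)
        then show "\<exists>r T S. skeleton_in ?E ?V K (M n) (n / (4 * ln n)) ((1 - \<epsilon> / 4) * n) (a * ln n) r T S"
          by blast
      qed
    qed
  qed
qed

section \<open>Conclusion\<close>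

text \<open>A vertex expects about \<open>\<gamma> * c * ln n\<close> neighbours in
  \<open>Y\<close>; having at most a quarter of them has probability at most a negative power of
  \<open>n\<close>.\<close>

lemma whp_completed:
  fixes c a \<epsilon> \<gamma> \<beta> \<theta> :: real and M :: "nat \<Rightarrow> nat"
  assumes \<epsilon>: "0 < \<epsilon>" "\<epsilon> \<le> 1" and c: "c = (1 + \<epsilon>) / ln 2" and a: "0 < a" "a \<le> 1 / 20"
    and \<gamma>: "0 < \<gamma>" and \<beta>: "\<beta> = \<gamma> * c / 4" and \<theta>: "0 < \<theta>"
    and sk: "whp c (\<lambda>n E. has_skeleton E (core \<epsilon> n) K (M n) (n / (4 * ln n)) ((1 - \<epsilon> / 4) * n) (a * ln n))"
    and cov: "whp c (\<lambda>n E. covers E (core \<epsilon> n) (reserve \<epsilon> n) (n / (4 * ln n)) (\<gamma> * n))"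
    and blk: "\<And>n. block \<epsilon> n \<le> n"
  shows "whp c (\<lambda>n E. completed E (core \<epsilon> n) (reserve \<epsilon> n) K (M n) (nat \<lceil>\<gamma> * n\<rceil>) (\<beta> * ln n) (\<theta> * n) (a / 2 *
    ln n))"
proof -
  have l2: "0 < ln (2::real)" "ln (2::real) \<le> 25 / 36" using ln2_le_25_over_36 by auto
  have c0: "0 < c" using \<epsilon> l2 by (simp add: c)
  define \<omega> where "\<omega> = \<gamma> * c / 2 - \<beta> * ln 2"
  define \<omega>1 where "\<omega>1 = (1 - 1 / 10) * c * (1 - \<epsilon> / 4) + a * ln (1 / 10)"
  define w where "w = a * ln 2"
  have \<omega>: "0 < \<omega>"
  proof -
    have "\<beta> * ln 2 \<le> \<beta> * 1" using l2 \<gamma> c0 by (intro mult_left_mono) (auto simp: \<beta>)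
    moreover have "0 < \<gamma> * c" using \<gamma> c0 by simp
    ultimately show ?thesis by (simp add: \<omega>_def \<beta>)
  qed
  have \<omega>1: "1 < \<omega>1"
    unfolding \<omega>1_def using \<epsilon> c a by (rule min_degree_exponent)
  let ?b = "\<lambda>n::nat. exp 1 * exp (- \<omega> * ln n) / \<theta> + real n * (exp 1 * exp (- \<omega>1 * ln n))
      + real n * (2 * exp (w * ln n) * exp (- (a / 2) * ln n * (\<omega> * ln n - 1)))"
  let ?P = "\<lambda>(n::nat) E. (has_skeleton E (core \<epsilon> n) K (M n) (n / (4 * ln n)) ((1 - \<epsilon> / 4) * n) (a * ln n)) \<and>
      (covers E (core \<epsilon> n) (reserve \<epsilon> n) (n / (4 * ln n)) (\<gamma> * n))"
  let ?C = "\<lambda>(n::nat) E. completed E (core \<epsilon> n) (reserve \<epsilon> n) K (M n) (nat \<lceil>\<gamma> * n\<rceil>) (\<beta> * ln n) (\<theta> * n) (a /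
    2 * ln n)"
  have PC: "whp c (\<lambda>n E. ?P n E \<longrightarrow> ?C n E)"
  proof (rule whpI)
    have "(\<lambda>n::nat. exp 1 * exp (- \<omega> * ln n) / \<theta>) \<longlonglongrightarrow> 0" using \<omega> \<theta> by real_asymp
    moreover have "(\<lambda>n::nat. real n * (exp 1 * exp (- \<omega>1 * ln n))) \<longlonglongrightarrow> 0" using \<omega>1 by real_asymp
    moreover have "(\<lambda>n::nat. real n * (2 * exp (w * ln n) * exp (- (a / 2) * ln n * (\<omega> * ln n - 1)))) \<longlonglongrightarrow> 0"
    proof -
      \<comment> \<open>However small \<open>v\<close> is, \<open>v * ln n ^ 2\<close> in the
        exponent beats every power of \<open>n\<close>.\<close>
      define v where "v = a / 2 * \<omega>"
      have "0 < v" using a \<omega> by (simp add: v_def)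
      then have "(\<lambda>n::nat. real n * (2 * exp ((w + a / 2) * ln n - v * ln n ^ 2))) \<longlonglongrightarrow> 0" by real_asymp
      moreover have "exp ((w + a / 2) * y - v * y ^ 2) = exp (w * y) * exp (- (a / 2) * y * (\<omega> * y - 1))"
        for y :: real
      proof -
        have "(w + a / 2) * y - v * y ^ 2 = w * y + - (a / 2) * y * (\<omega> * y - 1)"
          by (simp add: v_def power2_eq_square field_simps)
        then show ?thesis by (simp only: exp_add)
      qed
      ultimately show ?thesis by (simp add: mult.assoc)
    qed
    ultimately show "?b \<longlonglongrightarrow> 0" by (intro tendsto_add_zero)
    have "\<forall>\<^sub>F n::nat in sequentially. 1 \<le> \<omega> * ln n" using \<omega> by real_asymp
    with edge_prob_bounds[OF c0]
    show "\<forall>\<^sub>F n in sequentially. prob (gnp c n) {E. \<not> (?P n E \<longrightarrow> ?C n E)} \<le> ?b n"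
    proof eventually_elim
      case (elim n)
      have un: "(core \<epsilon> n) \<union> (reserve \<epsilon> n) = {1..n}" "(core \<epsilon> n) \<inter> (reserve \<epsilon> n) = {}"
        using blk[of n] by auto
      have g: "\<gamma> * n \<le> real (nat \<lceil>\<gamma> * n\<rceil>)" "real (nat \<lceil>\<gamma> * n\<rceil>) < \<gamma> * n + 1"
      proof -
        have "0 \<le> \<gamma> * n" using \<gamma> by simp
        then show "\<gamma> * n \<le> real (nat \<lceil>\<gamma> * n\<rceil>)" "real (nat \<lceil>\<gamma> * n\<rceil>) < \<gamma> * n + 1" by linarith+
      qed
      have "prob (gnp c n) {E. (has_skeleton E (core \<epsilon> n) K (M n) (n / (4 * ln n)) ((1 - \<epsilon> / 4) * n) (a * ln
        n)) \<and>
        (covers E (core \<epsilon> n) (reserve \<epsilon> n) (n / (4 * ln n)) (\<gamma> * n)) \<and>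
        \<not> ?C n E} \<le> ?b n"
      proof (rule completed_prob[OF un _ _ _ _ g a(1) _ \<theta>, where \<rho> = "1 / 10"])
        show "1 \<le> (\<gamma> * c / 2 - \<beta> * ln 2) * ln n" using elim by (simp add: \<omega>_def)
      qed (use elim in \<open>simp_all add: \<omega>_def \<omega>1_def w_def\<close>)
      then show ?case by (simp only: not_imp conj_assoc)
    qed
  qed
  show ?thesis
    by (rule whp_mono[OF whp_conj[OF PC whp_conj[OF sk cov]]]) (intro always_eventually allI impI, blast)
qed

text \<open>The constants avoid circularity: \<open>a\<close>, then \<open>\<theta>1\<close>,
  \<open>\<gamma>\<close>, \<open>\<beta>\<close>, \<open>\<theta>2\<close>, and from
  \<open>\<gamma>\<close> the multiplicity \<open>C\<close>, the bottom weight \<open>K\<close> and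
  the loads \<open>M\<close>. The tree depends on \<open>M\<close>, but \<open>\<gamma>0\<close>
  needs only the number \<open>n / (4 * ln n)\<close> of bottoms, which does not.\<close>

theorem whp_gather:
  assumes \<epsilon>: "0 < \<epsilon>" "\<epsilon> \<le> 1" and c: "c = (1 + \<epsilon>) / ln 2"
  shows "whp c (\<lambda>n E. \<exists>r. gather E r {1..n})"
proof -
  have l2: "0 < ln (2::real)" "ln (2::real) \<le> 25 / 36" using ln2_le_25_over_36 by auto
  have c0: "0 < c" using \<epsilon> l2 by (simp add: c)
  define a where "a = min (1 / 20) (c * \<epsilon> / 32)"
  have a: "0 < a" "a \<le> 1 / 20" "a \<le> c * \<epsilon> / 32" using c0 \<epsilon> by (auto simp: a_def)
  have blk: "block \<epsilon> n \<le> n" for n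
  proof -
    have "\<epsilon> / 8 * real n \<le> 1 * real n" using \<epsilon> by (intro mult_right_mono) auto
    then show ?thesis by (simp add: block_def nat_le_iff ceiling_le_iff)
  qed
  obtain \<theta>1 :: real where \<theta>1: "0 < \<theta>1" "whp c (\<lambda>n E. sparse E {1..n} (a / 8 * ln n) (\<theta>1 * n))"
    using whp_sparse[OF c0, of "a / 8"] a by auto
  obtain \<gamma>0 :: real where \<gamma>0: "0 < \<gamma>0" "\<And>Z. (\<forall>n. Z n \<subseteq> {1..n} \<and> \<epsilon> / 8 * n \<le> real (card (Z n))) \<Longrightarrow>
    whp c (\<lambda>n E. covers E ({1..n} - Z n) (Z n) (n / (4 * ln n)) (\<gamma>0 * n))"
    using whp_cover[OF c0, of "\<epsilon> / 8"] \<epsilon> by auto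
  \<comment> \<open>\<open>\<gamma> \<le> \<theta>1 / 16\<close> makes \<open>Y\<close>, together
    with at most \<open>\<theta>1 / 4 * n\<close> unattached vertices, small enough for
    sparseness.\<close>
  define \<gamma> where "\<gamma> = min \<gamma>0 (\<theta>1 / 16)"
  have \<gamma>: "0 < \<gamma>" "\<gamma> \<le> \<gamma>0" "\<gamma> \<le> \<theta>1 / 16" using \<gamma>0(1) \<theta>1(1) by (auto simp: \<gamma>_def)
  have cov: "whp c (\<lambda>n E. covers E (core \<epsilon> n) (reserve \<epsilon> n) (n / (4 * ln n)) (\<gamma> * n))"
  proof (rule whp_mono[OF \<gamma>0(2)[of "\<lambda>n. (reserve \<epsilon> n)"]])
    show "\<forall>n. (reserve \<epsilon> n) \<subseteq> {1..n} \<and> \<epsilon> / 8 * real n \<le> real (card (reserve \<epsilon> n))"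
      using blk block_bounds(1)[of \<epsilon>] \<epsilon> by auto
    have diff: "{1..n} - (reserve \<epsilon> n) = (core \<epsilon> n)" for n by auto
    have le: "\<gamma> * n \<le> \<gamma>0 * n" for n :: nat using \<gamma>(2) by (intro mult_right_mono) auto
    show "\<forall>\<^sub>F n in sequentially. \<forall>E\<subseteq>all_edges {1..n}.
        (covers E ({1..n} - (reserve \<epsilon> n)) (reserve \<epsilon> n) (n / (4 * ln n)) (\<gamma>0 * n)) \<longrightarrow>
        (covers E (core \<epsilon> n) (reserve \<epsilon> n) (n / (4 * ln n)) (\<gamma> * n))"
      unfolding diff using le by (intro always_eventually allI impI) (meson order_trans)
  qed
  define \<beta> where "\<beta> = \<gamma> * c / 4"
  have \<beta>: "0 < \<beta>" using \<gamma> c0 by (simp add: \<beta>_def)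
  obtain \<theta>2 :: real where \<theta>2: "0 < \<theta>2" "whp c (\<lambda>n E. sparse E {1..n} (\<beta> / 4 * ln n) (\<theta>2 * n))"
    using whp_sparse[OF c0, of "\<beta> / 4"] \<beta> by auto
  have dense: "whp c (\<lambda>n E. joined E {1..n} (\<theta>2 / 2 * n) (\<gamma> / 2 * n))"
    using \<theta>2(1) \<gamma>(1) by (intro whp_edges_between[OF c0]) auto
  \<comment> \<open>\<open>Y\<close> will have at least \<open>\<gamma> * n\<close> vertices, so
    \<open>C \<ge> 2 / \<gamma>\<close> gives \<open>2 * n \<le> C * card Y\<close>.\<close>
  define C where "C = nat \<lceil>2 / \<gamma>\<rceil>"
  have C: "1 \<le> C" "2 / \<gamma> \<le> real C"
  proof -
    have "0 < 2 / \<gamma>" using \<gamma>(1) by simp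
    then show "1 \<le> C" "2 / \<gamma> \<le> real C" unfolding C_def by linarith+
  qed
  define K where "K = 2 + 2 * C"
  define \<Delta> where "\<Delta> n = nat \<lfloor>(2 * c + 2) * ln (real n)\<rfloor>" for n
  define M where "M n = \<Delta> n * K" for n
  have sk: "whp c (\<lambda>n E. has_skeleton E (core \<epsilon> n) K (M n) (n / (4 * ln n)) ((1 - \<epsilon> / 4) * n) (a * ln n))"
  proof (rule whp_skeleton[OF \<epsilon> c a, where ?t0.0 = K and ?C0.0 = "2 ^ K + (2 * c + 2) * real K"])
    \<comment> \<open>Bottoms are binomial trees of order \<open>K\<close>, a constant.\<close>
    show "K \<le> 2 ^ K" by (simp add: less_imp_le)
    show "0 < 2 ^ K + (2 * c + 2) * real K" using c0 by (intro add_pos_nonneg) auto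
    show "\<forall>\<^sub>F n in sequentially. real (2 ^ K + M n) \<le> (2 ^ K + (2 * c + 2) * real K) * ln n"
      using edge_prob_bounds[OF c0]
    proof eventually_elim
      case (elim n)
      have "0 \<le> (2 * c + 2) * ln n" using c0 elim by simp
      then have "real (\<Delta> n) \<le> (2 * c + 2) * ln n" unfolding \<Delta>_def by linarith
      then have "real (\<Delta> n) * real K \<le> (2 * c + 2) * ln n * real K" by (intro mult_right_mono) auto
      moreover have "2 ^ K * 1 \<le> 2 ^ K * ln (real n)" using elim by (intro mult_left_mono) auto
      ultimately have "2 ^ K * 1 + real (\<Delta> n) * real K \<le> 2 ^ K * ln (real n) + (2 * c + 2) * ln n * real K"
        by (intro add_mono)
      also have "\<dots> = (2 ^ K + (2 * c + 2) * real K) * ln n" by (simp add: algebra_simps)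
      finally show ?case by (simp add: M_def)
    qed
  qed
  have comp: "whp c (\<lambda>n E. completed E (core \<epsilon> n) (reserve \<epsilon> n) K (M n) (nat \<lceil>\<gamma> * n\<rceil>) (\<beta> * ln n) (\<theta>1 / 4 *
    n) (a / 2 * ln n))"
    using \<theta>1(1) by (intro whp_completed[OF \<epsilon> c a(1,2) \<gamma>(1) \<beta>_def _ sk cov blk]) auto
  show ?thesis
  proof (rule whp_mono[OF whp_conj[OF comp whp_conj[OF \<theta>1(2) whp_conj[OF \<theta>2(2) whp_conj[OF dense
    whp_max_degree[OF c0]]]]]])
    have "\<forall>\<^sub>F n::nat in sequentially. 2 \<le> 3 / 8 * \<theta>1 * n" using \<theta>1(1) by real_asymp
    with edge_prob_bounds[OF c0]
    show "\<forall>\<^sub>F n in sequentially. \<forall>E\<subseteq>all_edges {1..n}.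
      completed E (core \<epsilon> n) (reserve \<epsilon> n) K (M n) (nat \<lceil>\<gamma> * n\<rceil>) (\<beta> * ln n) (\<theta>1 / 4 * n) (a / 2 * ln n) \<and>
      sparse E {1..n} (a / 8 * ln n) (\<theta>1 * n) \<and> sparse E {1..n} (\<beta> / 4 * ln n) (\<theta>2 * n) \<and>
      (joined E {1..n} (\<theta>2 / 2 * n) (\<gamma> / 2 * n)) \<and>
      (\<forall>x\<in>{1..n}. deg E x {1..n} \<le> (2 * c + 2) * ln n) \<longrightarrow>
      (\<exists>r. gather E r {1..n})"
    proof eventually_elim
      case (elim n)
      show ?case
      proof (intro allI impI, elim conjE)
        fix E
        assume "completed E (core \<epsilon> n) (reserve \<epsilon> n) K (M n) (nat \<lceil>\<gamma> * n\<rceil>) (\<beta> * ln n) (\<theta>1 / 4 * n) (a / 2 *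
          ln n)"
          and sp: "sparse E {1..n} (a / 8 * ln n) (\<theta>1 * n)" "sparse E {1..n} (\<beta> / 4 * ln n) (\<theta>2 * n)"
          and dn: "joined E {1..n} (\<theta>2 / 2 * n) (\<gamma> / 2 * n)"
          and md: "\<forall>x\<in>{1..n}. deg E x {1..n} \<le> (2 * c + 2) * ln n"
        moreover have un: "(core \<epsilon> n) \<union> (reserve \<epsilon> n) = {1..n}" using blk[of n] by auto
        ultimately obtain r T S Y where T: "T \<subseteq> (core \<epsilon> n)" and Y: "Y \<subseteq> (reserve \<epsilon> n)" "card Y = nat \<lceil>\<gamma> * n\<rceil>"
          "\<forall>y\<in>Y. \<exists>s\<in>S. {y, s} \<in> E" and fl: "flexible E K (M n) r T S"
          and att: "attachable E {1..n} (core \<epsilon> n) T Y (\<beta> * ln n) (\<theta>1 / 4 * n) (a / 2 * ln n)"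
          unfolding completed_def by (simp only: un) blast
        have "0 \<le> \<gamma> * n" using \<gamma> by simp
        then have g: "\<gamma> * n \<le> real (card Y)" "real (card Y) \<le> \<gamma> * n + 1" unfolding Y(2) by linarith+
        have L: "0 < ln (real n)" using elim by linarith
        have "gather E r {1..n}"
        proof (rule attachable_gather[OF _ fl T, where Y = Y and \<beta> = "\<beta> * ln n" and \<theta> = "\<theta>1 / 4 * n"
          and a = "a / 2 * ln n"
            and ?\<eta>1.0 = "a / 8 * ln n" and ?l1.0 = "\<theta>1 * n" and ?\<eta>2.0 = "\<beta> / 4 * ln n" and ?l2.0 = "\<theta>2 * n"
            and C = C and \<Delta> = "\<Delta> n"])
          show "Y \<subseteq> {1..n}" using Y(1) blk[of n] by auto
          show "Y \<inter> (core \<epsilon> n) = {}" using Y(1) by auto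
          show "2 * (\<theta>1 / 4 * n + real (card Y)) \<le> \<theta>1 * n"
          proof -
            have "\<gamma> * n \<le> \<theta>1 / 16 * n" using \<gamma>(3) by (intro mult_right_mono) auto
            then have 1: "\<gamma> * n \<le> 1 / 16 * (\<theta>1 * n)" by simp
            have 2: "2 \<le> 3 / 8 * (\<theta>1 * n)" using elim(2) by (simp only: mult.assoc)
            have "2 * (1 / 4 * x + y) \<le> x" if "y \<le> g + 1" "g \<le> 1 / 16 * x" "2 \<le> 3 / 8 * x" for x y g :: real
              using that by argo
            from this[OF g(2) 1 2] show ?thesis by simp
          qed
          show "\<exists>x\<in>X. \<exists>y\<in>Y1. {x, y} \<in> E" if "X \<subseteq> {1..n}" "Y1 \<subseteq> {1..n}" "X \<inter> Y1 = {}" "\<theta>2 * n / 2 <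
            real (card X)" "real (card Y) / 2 \<le> real (card Y1)" for X Y1
          proof -
            have "\<gamma> / 2 * n \<le> real (card Y1)" using that(5) g(1) by simp
            moreover have "\<theta>2 / 2 * n \<le> real (card X)" using that(4) by simp
            ultimately show ?thesis using dn that(1-3) by blast
          qed
          show "2 * card {1..n} \<le> C * card Y"
          proof -
            have "2 * real n = 2 / \<gamma> * (\<gamma> * n)" using \<gamma>(1) by simp
            also have "\<dots> \<le> real C * real (card Y)" using C(2) g(1) \<gamma>(1) by (intro mult_mono) auto
            finally have "real (2 * n) \<le> real (C * card Y)" by simp
            then have "2 * n \<le> C * card Y" by (simp only: of_nat_le_iff)
            then show ?thesis by simp
          qed
          show "card (nbr E s \<inter> {1..n}) \<le> \<Delta> n" if "s \<in> {1..n}" for s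
            unfolding \<Delta>_def using md that by (intro le_nat_floor) blast
        qed (use C(1) Y(3) att sp a \<beta> L in \<open>auto simp: K_def M_def\<close>)
        then show "\<exists>r. gather E r {1..n}" by blast
      qed
    qed
  qed
qed

theorem theorem1p1:
  fixes \<epsilon> :: real and p :: "nat \<Rightarrow> real"
  assumes "\<epsilon> > 0"
    and "\<And>n. 0 \<le> p n \<and> p n \<le> 1"
    and "\<forall>\<^sub>F n in sequentially. p n \<ge> (1 + \<epsilon>) / ln 2 * (ln (real n) / real n)"
  shows "(\<lambda>n. measure_pmf.prob (binomial_random_graph n (p n))
                {E. total_acquisition_number {1..n} E = 1}) \<longlonglongrightarrow> 1"
proof -
  \<comment> \<open>The estimates assume \<open>\<epsilon> \<le> 1\<close>; capping
    \<open>\<epsilon>\<close> only lowers the threshold, and monotonicity in the edge probability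
    covers the rest.\<close>
  define \<epsilon>' where "\<epsilon>' = min \<epsilon> 1"
  define c where "c = (1 + \<epsilon>') / ln 2"
  have \<epsilon>': "0 < \<epsilon>'" "\<epsilon>' \<le> 1" "\<epsilon>' \<le> \<epsilon>" using assms(1) by (auto simp: \<epsilon>'_def)
  have c0: "0 < c" using \<epsilon>' by (simp add: c_def)
  let ?G = "\<lambda>n. {E. \<exists>r. gather E r {1..n}}"
  have "(\<lambda>n. 1 - measure_pmf.prob (gnp c n) {E. \<not> (\<exists>r. gather E r {1..n})}) \<longlonglongrightarrow> 1 - 0"
    using whp_gather[OF \<epsilon>'(1,2) c_def] unfolding whp_def by (intro tendsto_intros)
  then have lower: "(\<lambda>n. 1 - measure_pmf.prob (gnp c n) {E. \<not> (\<exists>r. gather E r {1..n})}) \<longlonglongrightarrow> 1" by simp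
  show ?thesis
  proof (rule tendsto_sandwich[OF _ _ lower tendsto_const])
    show "\<forall>\<^sub>F n in sequentially. measure_pmf.prob (binomial_random_graph n (p n)) {E.
      total_acquisition_number {1..n} E = 1} \<le> 1"
      by simp
    show "\<forall>\<^sub>F n in sequentially. 1 - measure_pmf.prob (gnp c n) {E. \<not> (\<exists>r. gather E r {1..n})} \<le>
      measure_pmf.prob (binomial_random_graph n (p n)) {E. total_acquisition_number {1..n} E = 1}"
      using edge_prob_bounds[OF c0] assms(3)
    proof eventually_elim
      case (elim n)
      have "c \<le> (1 + \<epsilon>) / ln 2" using \<epsilon>'(3) by (simp add: c_def divide_right_mono)
      then have "c * (ln n / n) \<le> (1 + \<epsilon>) / ln 2 * (ln n / n)" using elim by (intro mult_right_mono) auto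
      then have le: "edge_prob c n \<le> p n" using elim by simp
      have "{E. \<not> (\<exists>r. gather E r {1..n})} = UNIV - ?G n" by auto
      then have "1 - measure_pmf.prob (gnp c n) {E. \<not> (\<exists>r. gather E r {1..n})} =
        measure_pmf.prob (gnp c n) (?G n)"
        using measure_pmf.prob_compl[of "?G n" "gnp c n"] by simp
      \<comment> \<open>Monotonicity is applied to \<open>gather\<close>, which passes to every
        larger family of sets; the acquisition number enters only on the support, where edges lie in
        \<open>all_edges {1..n}\<close>.\<close>
      also have "\<dots> \<le> measure_pmf.prob (random_subset (all_edges {1..n}) (p n)) (?G n)"
        using elim le assms(2)[of n] by (intro prob_random_subset_mono) (auto intro: gather_mono)
      also have "\<dots> \<le> measure_pmf.prob (random_subset (all_edges {1..n}) (p n)) {E. total_acquisition_number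
        {1..n} E = 1}"
      proof (rule measure_pmf.finite_measure_mono_AE)
        show "AE E in random_subset (all_edges {1..n}) (p n). E \<in> ?G n \<longrightarrow>
          E \<in> {E. total_acquisition_number {1..n} E = 1}"
        proof (rule AE_pmfI)
          fix E assume "E \<in> set_pmf (random_subset (all_edges {1..n}) (p n))"
          then have E: "E \<subseteq> all_edges {1..n}" using set_random_subset by blast
          show "E \<in> ?G n \<longrightarrow> E \<in> {E. total_acquisition_number {1..n} E = 1}"
            unfolding mem_Collect_eq by (intro impI, elim exE, rule gather_total_acquisition_number[OF _ E])
        qed
      qed simp
      finally show ?case by (simp add: binomial_random_graph_eq)
    qed
  qed
qed

end
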